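(* Let $\mathcal{C}$ be a family of one-ended groups that is closed under taking finite-index subgroups, and suppose there is a multiplicative invariant $\rho:\mathcal{C}\to\mathbb{R}$ with $\rho(G)\neq 0$ for every $G\in\mathcal{C}$. Let $n>1$ and, for each $1\le i\le n$, let $G_i\in\mathcal{C}$ and let $H_i\le G_i$ be a proper finite-index subgroup. Then the free products $G_1*\cdots*G_n$ and $H_1*\cdots*H_n$ are quasi-isometric and are not abstractly commensurable.
   Context: One-ended groups are finitely generated by convention. For a family of groups $\mathcal{C}$ closed under taking finite-index subgroups, a multiplicative invariant on $\mathcal{C}$ is a function $\rho:\mathcal{C}\to\mathbb{R}$ such that whenever $G\in\mathcal{C}$ and $H$ is a finite-index subgroup of $G$, one has $\rho(H)=[G:H]\,\rho(G)$. Families of groups are understood up to isomorphism: $\mathcal{C}$ is closed under isomorphism and $\rho$ takes equal values on isomorphic groups. Two groups are abstractly commensurable if they contain isomorphic finite-index subgroups. Quasi-isometry of finitely generated groups is with respect to word metrics from finite generating sets. *)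

theory Defs
  imports Complex_Main "HOL-Library.FuncSet" "HOL-Algebra.Generated_Groups"
begin

section \<open>Finite-index subgroups and commensurability\<close>

definition finite_index_subgroup :: "'a set \<Rightarrow> ('a, 'm) monoid_scheme \<Rightarrow> bool" where
  "finite_index_subgroup H G \<longleftrightarrow> subgroup H G \<and> finite (rcosets\<^bsub>G\<^esub> H)"

definition subgroup_index :: "('a, 'm) monoid_scheme \<Rightarrow> 'a set \<Rightarrow> nat" where
  "subgroup_index G H = card (rcosets\<^bsub>G\<^esub> H)"

definition abstractly_commensurable ::
    "('a, 'm) monoid_scheme \<Rightarrow> ('b, 'n) monoid_scheme \<Rightarrow> bool" where
  "abstractly_commensurable G H \<longleftrightarrow>
     (\<exists>K L. finite_index_subgroup K G \<and> finite_index_subgroup L H \<and>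
            G\<lparr>carrier := K\<rparr> \<cong> H\<lparr>carrier := L\<rparr>)"

text \<open>
  A family of groups is a set of groups carried by subsets of one fixed type. For finitely
  generated groups, which are countable, this is no restriction up to isomorphism: take the type
  to be \<^typ>\<open>nat\<close>.
\<close>

definition isomorphism_closed :: "'a monoid set \<Rightarrow> bool" where
  "isomorphism_closed C \<longleftrightarrow> (\<forall>G\<in>C. \<forall>H. group H \<and> G \<cong> H \<longrightarrow> H \<in> C)"

definition finite_index_closed :: "'a monoid set \<Rightarrow> bool" where
  "finite_index_closed C \<longleftrightarrow>
     (\<forall>G\<in>C. \<forall>H. finite_index_subgroup H G \<longrightarrow> G\<lparr>carrier := H\<rparr> \<in> C)"

definition multiplicative_invariant :: "'a monoid set \<Rightarrow> ('a monoid \<Rightarrow> real) \<Rightarrow> bool" where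
  "multiplicative_invariant C \<rho> \<longleftrightarrow>
     (\<forall>G\<in>C. \<forall>H\<in>C. G \<cong> H \<longrightarrow> \<rho> G = \<rho> H) \<and>
     (\<forall>G\<in>C. \<forall>H. finite_index_subgroup H G \<longrightarrow>
        \<rho> (G\<lparr>carrier := H\<rparr>) = real (subgroup_index G H) * \<rho> G)"


section \<open>Finite generation and ends\<close>

definition finite_generating_set :: "('a, 'm) monoid_scheme \<Rightarrow> 'a set \<Rightarrow> bool" where
  "finite_generating_set G S \<longleftrightarrow> finite S \<and> S \<subseteq> carrier G \<and> generate G S = carrier G"

definition cayley_edges :: "('a, 'm) monoid_scheme \<Rightarrow> 'a set \<Rightarrow> ('a \<times> 'a) set" where
  "cayley_edges G S = {(g, g \<otimes>\<^bsub>G\<^esub> s) | g s. g \<in> carrier G \<and> s \<in> S}"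

text \<open>
  Connected components of the graph with vertex set \<open>V\<close> and edge set \<open>E\<close>
  (orientations of edges being ignored) after the vertices in \<open>F\<close> have been deleted.
\<close>

definition components_off :: "'a set \<Rightarrow> ('a \<times> 'a) set \<Rightarrow> 'a set \<Rightarrow> 'a set set" where
  "components_off V E F =
     (V - F) // (((E \<union> E\<inverse>) \<inter> ((V - F) \<times> (V - F)))\<^sup>*)"

text \<open>
  The ends of a locally finite graph: the inverse limit, over the finite vertex sets \<open>F\<close>, of
  the sets of components of the complement of \<open>F\<close>. An element of this limit only selects
  infinite components, because a finite selected component can itself be deleted.
\<close>

definition graph_ends :: "'a set \<Rightarrow> ('a \<times> 'a) set \<Rightarrow> ('a set \<Rightarrow> 'a set) set" where
  "graph_ends V E =
     {e \<in> (\<Pi>\<^sub>E F\<in>{F. finite F \<and> F \<subseteq> V}. components_off V E F).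
        \<forall>F F'. finite F' \<and> F \<subseteq> F' \<and> F' \<subseteq> V \<longrightarrow> e F' \<subseteq> e F}"

text \<open>The number of ends does not depend on the finite generating set.\<close>

definition one_ended_group :: "('a, 'm) monoid_scheme \<Rightarrow> bool" where
  "one_ended_group G \<longleftrightarrow> group G \<and>
     (\<exists>S. finite_generating_set G S \<and> card (graph_ends (carrier G) (cayley_edges G S)) = 1)"


section \<open>Quasi-isometry\<close>

definition quasi_isometric_spaces ::
    "'a set \<Rightarrow> ('a \<Rightarrow> 'a \<Rightarrow> real) \<Rightarrow> 'b set \<Rightarrow> ('b \<Rightarrow> 'b \<Rightarrow> real) \<Rightarrow> bool" where
  "quasi_isometric_spaces X dX Y dY \<longleftrightarrow>
     (\<exists>f\<in>X \<rightarrow> Y. \<exists>K\<ge>1. \<exists>A\<ge>0.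
        (\<forall>x\<in>X. \<forall>x'\<in>X. dX x x' / K - A \<le> dY (f x) (f x') \<and>
                        dY (f x) (f x') \<le> K * dX x x' + A) \<and>
        (\<forall>y\<in>Y. \<exists>x\<in>X. dY (f x) y \<le> A))"

definition word_length :: "('a, 'm) monoid_scheme \<Rightarrow> 'a set \<Rightarrow> 'a \<Rightarrow> nat" where
  "word_length G S g =
     (LEAST k. \<exists>ws. length ws = k \<and> set ws \<subseteq> S \<union> m_inv G ` S \<and>
                    g = foldr (\<otimes>\<^bsub>G\<^esub>) ws \<one>\<^bsub>G\<^esub>)"

definition word_dist :: "('a, 'm) monoid_scheme \<Rightarrow> 'a set \<Rightarrow> 'a \<Rightarrow> 'a \<Rightarrow> real" where
  "word_dist G S g h = real (word_length G S (inv\<^bsub>G\<^esub> g \<otimes>\<^bsub>G\<^esub> h))"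

definition quasi_isometric_groups ::
    "('a, 'm) monoid_scheme \<Rightarrow> ('b, 'n) monoid_scheme \<Rightarrow> bool" where
  "quasi_isometric_groups G H \<longleftrightarrow>
     (\<exists>S. finite_generating_set G S) \<and> (\<exists>T. finite_generating_set H T) \<and>
     (\<forall>S T. finite_generating_set G S \<and> finite_generating_set H T \<longrightarrow>
        quasi_isometric_spaces (carrier G) (word_dist G S) (carrier H) (word_dist H T))"


section \<open>Free products\<close>

text \<open>
  The free product of the groups \<open>G i\<close>, \<open>i \<in> I\<close>, as the group of reduced words: an element is a
  list of pairs \<open>(i, g)\<close> with \<open>g\<close> a nontrivial element of \<open>G i\<close> and with consecutive indices
  distinct, and words are multiplied by concatenation followed by reduction.
\<close>

definition reduced_words ::
    "'i set \<Rightarrow> ('i \<Rightarrow> ('a, 'm) monoid_scheme) \<Rightarrow> ('i \<times> 'a) list set" where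
  "reduced_words I G =
     {w. (\<forall>(i, g)\<in>set w. i \<in> I \<and> g \<in> carrier (G i) \<and> g \<noteq> \<one>\<^bsub>G i\<^esub>) \<and>
         successively (\<lambda>p q. fst p \<noteq> fst q) w}"

fun reduced_cons ::
    "('i \<Rightarrow> ('a, 'm) monoid_scheme) \<Rightarrow> 'i \<times> 'a \<Rightarrow> ('i \<times> 'a) list \<Rightarrow> ('i \<times> 'a) list" where
  "reduced_cons G (i, g) [] = (if g = \<one>\<^bsub>G i\<^esub> then [] else [(i, g)])"
| "reduced_cons G (i, g) ((j, h) # w) =
     (if g = \<one>\<^bsub>G i\<^esub> then (j, h) # w
      else if i \<noteq> j then (i, g) # (j, h) # w
      else if g \<otimes>\<^bsub>G i\<^esub> h = \<one>\<^bsub>G i\<^esub> then w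
      else (i, g \<otimes>\<^bsub>G i\<^esub> h) # w)"

definition free_product ::
    "'i set \<Rightarrow> ('i \<Rightarrow> ('a, 'm) monoid_scheme) \<Rightarrow> ('i \<times> 'a) list monoid" where
  "free_product I G =
     \<lparr>carrier = reduced_words I G, mult = (\<lambda>u v. foldr (reduced_cons G) u v), one = []\<rparr>"

end

theory Submission
  imports Defs
begin

text \<open>
  Write \<open>P\<close> for the free product of the groups \<open>G i\<close> and \<open>Q\<close> for that of the subgroups \<open>H i\<close>.

  \<^emph>\<open>The free products are not commensurable.\<close> The absolute value of a multiplicative invariant is again
  multiplicative, so \<open>\<rho>\<close> may be taken to be positive. Let \<open>K\<close> be a subgroup of finite index \<open>d\<close> in \<open>P\<close>. Its
  vertex groups are the intersections of \<open>K\<close> with the conjugates of the factors; they are the nontrivial vertex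
  stabilisers for the action of \<open>K\<close> on the Bass--Serre tree of \<open>P\<close>. Up to isomorphism they belong to \<open>C\<close>. A one-ended
  subgroup of a free product is conjugate into a factor (\<open>one_ended_conjugate_into_factor\<close>), and an infinite
  subgroup lies in at most one conjugate of a factor (\<open>conjugating_coset_unique\<close>). Hence the vertex groups
  are exactly the maximal subgroups of \<open>K\<close> that are isomorphic to members of \<open>C\<close>
  (\<open>maximal_C_subgroups_eq\<close>), and so the group \<open>K\<close> alone determines them, without reference to \<open>P\<close>.

  Two numbers attached to \<open>K\<close> therefore depend only on its isomorphism type. The first one is the sum of
  \<open>\<bar>\<rho>\<bar>\<close> over the conjugacy classes of vertex groups; it equals \<open>d\<close> times the sum of the
  \<open>\<bar>\<rho> (G i)\<bar>\<close> (\<open>total_weight_eq\<close>). The second one counts the homomorphisms from \<open>K\<close> to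
  the group of two elements together with a compatible two-valued function on the set of vertex groups; with \<open>n\<close>
  factors it is 2 to the power \<open>(n - 1) * d + 1\<close> (\<open>card_colourings\<close>). As \<open>n > 1\<close>, the second number
  determines \<open>d\<close>, and then the first one determines the sum of the \<open>\<bar>\<rho> (G i)\<bar>\<close>. So this sum
  agrees for commensurable free products. Passing to the proper subgroups \<open>H i\<close> at least doubles each of its terms.

  \<^emph>\<open>The free products are quasi-isometric.\<close> There is an explicit bijection from \<open>Q\<close> to \<open>P\<close> that is
  bilipschitz for word metrics. In general \<open>G i\<close> and \<open>H i\<close> are not in bilipschitz bijection, there is only a
  finite-to-one map from \<open>G i\<close> to \<open>H i\<close> of bounded displacement. Applied to the letters of words, it leaves
  several elements of \<open>P\<close> for each element of \<open>Q\<close>. One of them is placed there, and the others are handed on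
  to words of \<open>Q\<close> that are two letters longer, where they displace what would have been placed otherwise. The
  bijection is bilipschitz because displacements do not accumulate: a displaced element is not handed on together
  with the one that displaced it but joins other elements close to itself. Two different factors are
  needed here as well, as an element ending with a letter of type \<open>i\<close> has to wait for a position
  of the same type and skips one letter of another type.
\<close>

section \<open>Reduced words form a group\<close>

locale free_product_of_groups =
  fixes I :: "'i set" and \<Gamma> :: "'i \<Rightarrow> ('a, 'm) monoid_scheme"
  assumes factor_group: "i \<in> I \<Longrightarrow> group (\<Gamma> i)"
begin

abbreviation P where "P \<equiv> free_product I \<Gamma>"

abbreviation mult_words (infixl "\<cdot>" 70) where "u \<cdot> v \<equiv> u \<otimes>\<^bsub>P\<^esub> v"

text \<open>
  A trivial element gives the empty word, and so \<open>letter i\<close> is a homomorphism from the factor \<open>i\<close>.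
\<close>

definition letter :: "'i \<Rightarrow> 'a \<Rightarrow> ('i \<times> 'a) list" where
  "letter i g = (if g = \<one>\<^bsub>\<Gamma> i\<^esub> then [] else [(i, g)])"

lemma carrier_P: "carrier P = reduced_words I \<Gamma>"
  and mult_P: "u \<cdot> v = foldr (reduced_cons \<Gamma>) u v"
  and one_P: "\<one>\<^bsub>P\<^esub> = []"
  by (simp_all add: free_product_def)

lemma Nil_in_P [simp]: "[] \<in> carrier P"
  by (simp add: carrier_P reduced_words_def)

lemma Cons_in_P:
  "(i, g) # w \<in> carrier P \<longleftrightarrow>
     i \<in> I \<and> g \<in> carrier (\<Gamma> i) \<and> g \<noteq> \<one>\<^bsub>\<Gamma> i\<^esub> \<and> w \<in> carrier P \<and> (w = [] \<or> fst (hd w) \<noteq> i)"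
  by (cases w) (auto simp: carrier_P reduced_words_def)

lemma append_in_P:
  "u @ v \<in> carrier P \<longleftrightarrow>
     u \<in> carrier P \<and> v \<in> carrier P \<and> (u = [] \<or> v = [] \<or> fst (last u) \<noteq> fst (hd v))"
  by (auto simp: carrier_P reduced_words_def successively_append_iff)

lemma snoc_in_P:
  "u @ [(i, g)] \<in> carrier P \<longleftrightarrow>
     u \<in> carrier P \<and> i \<in> I \<and> g \<in> carrier (\<Gamma> i) \<and> g \<noteq> \<one>\<^bsub>\<Gamma> i\<^esub> \<and> (u = [] \<or> fst (last u) \<noteq> i)"
  by (auto simp: append_in_P Cons_in_P)

lemma letter_in_P: "i \<in> I \<Longrightarrow> g \<in> carrier (\<Gamma> i) \<Longrightarrow> letter i g \<in> carrier P"
  by (simp add: letter_def Cons_in_P)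

lemma reduced_cons_closed:
  assumes "i \<in> I" "g \<in> carrier (\<Gamma> i)" "w \<in> carrier P"
  shows "reduced_cons \<Gamma> (i, g) w \<in> carrier P"
proof (cases w)
  case Nil
  then show ?thesis using assms by (simp add: Cons_in_P)
next
  case (Cons p w')
  obtain j h where p: "p = (j, h)" by (cases p)
  interpret group "\<Gamma> i" using factor_group assms by blast
  have "j = i \<Longrightarrow> g \<otimes>\<^bsub>\<Gamma> i\<^esub> h \<in> carrier (\<Gamma> i)"
    using assms by (auto simp: Cons p Cons_in_P)
  then show ?thesis using assms by (auto simp: Cons p Cons_in_P)
qed

lemma reduced_cons_reduced:
  assumes "(i, g) # w \<in> carrier P"
  shows "reduced_cons \<Gamma> (i, g) w = (i, g) # w"
  using assms by (cases w) (auto simp: Cons_in_P)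

lemma reduced_cons_one: "reduced_cons \<Gamma> (i, \<one>\<^bsub>\<Gamma> i\<^esub>) w = w"
  by (cases w) auto

text \<open>
  Each factor acts on the set of reduced words from the left. Associativity of the multiplication of words follows
  from this by induction, one letter at a time, and different ways of reducing a word need not be compared.
\<close>

lemma reduced_cons_compose:
  assumes "i \<in> I" "g \<in> carrier (\<Gamma> i)" "h \<in> carrier (\<Gamma> i)" "w \<in> carrier P"
  shows "reduced_cons \<Gamma> (i, g) (reduced_cons \<Gamma> (i, h) w) = reduced_cons \<Gamma> (i, g \<otimes>\<^bsub>\<Gamma> i\<^esub> h) w"
proof -
  interpret group "\<Gamma> i" using factor_group assms by blast
  show ?thesis
  proof (cases w)
    case Nil
    then show ?thesis using assms by auto
  next
    case (Cons p w')
    obtain j x where p: "p = (j, x)" by (cases p)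
    have w': "w' \<in> carrier P" "w' = [] \<or> fst (hd w') \<noteq> j" and x: "x \<in> carrier (\<Gamma> j)" "x \<noteq> \<one>\<^bsub>\<Gamma> j\<^esub>"
      using assms(4) by (auto simp: Cons p Cons_in_P)
    show ?thesis
    proof (cases "i = j")
      case False
      then show ?thesis using assms by (auto simp: Cons p)
    next
      case ij: True
      show ?thesis
      proof (cases "h = \<one>\<^bsub>\<Gamma> i\<^esub> \<or> g = \<one>\<^bsub>\<Gamma> i\<^esub>")
        case True
        then show ?thesis
          using assms reduced_cons_one by auto
      next
        case nt: False
        have xi: "x \<in> carrier (\<Gamma> i)" using x ij by simp
        show ?thesis
        proof (cases "h \<otimes>\<^bsub>\<Gamma> i\<^esub> x = \<one>\<^bsub>\<Gamma> i\<^esub>")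
          case True
          have "g \<otimes>\<^bsub>\<Gamma> i\<^esub> h \<otimes>\<^bsub>\<Gamma> i\<^esub> x = g" using True assms xi by (simp add: m_assoc)
          moreover have "x = g" if "g \<otimes>\<^bsub>\<Gamma> i\<^esub> h = \<one>\<^bsub>\<Gamma> i\<^esub>"
            using that calculation xi assms by simp
          moreover have "reduced_cons \<Gamma> (i, g) w' = (i, g) # w'"
            using w' nt assms ij by (intro reduced_cons_reduced) (auto simp: Cons_in_P)
          ultimately show ?thesis using nt True ij by (auto simp: Cons p)
        next
          case False
          have "g \<otimes>\<^bsub>\<Gamma> i\<^esub> h \<otimes>\<^bsub>\<Gamma> i\<^esub> x = g \<otimes>\<^bsub>\<Gamma> i\<^esub> (h \<otimes>\<^bsub>\<Gamma> i\<^esub> x)" using assms xi by (simp add: m_assoc)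
          moreover have "g \<otimes>\<^bsub>\<Gamma> i\<^esub> (h \<otimes>\<^bsub>\<Gamma> i\<^esub> x) = x" if "g \<otimes>\<^bsub>\<Gamma> i\<^esub> h = \<one>\<^bsub>\<Gamma> i\<^esub>"
            using calculation that xi by simp
          ultimately show ?thesis using nt False ij x by (auto simp: Cons p)
        qed
      qed
    qed
  qed
qed

lemma mult_Cons: "(p # u) \<cdot> v = reduced_cons \<Gamma> p (u \<cdot> v)"
  by (simp add: mult_P)

lemma mult_closed:
  assumes "u \<in> carrier P" "v \<in> carrier P"
  shows "u \<cdot> v \<in> carrier P"
  using assms(1)
proof (induction u)
  case Nil
  then show ?case using assms by (simp add: mult_P)
next
  case (Cons p u)
  then show ?case by (cases p) (auto simp: mult_Cons Cons_in_P intro: reduced_cons_closed)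
qed

lemma reduced_cons_mult:
  assumes "i \<in> I" "g \<in> carrier (\<Gamma> i)" "u \<in> carrier P" "v \<in> carrier P"
  shows "reduced_cons \<Gamma> (i, g) u \<cdot> v = reduced_cons \<Gamma> (i, g) (u \<cdot> v)"
proof -
  interpret group "\<Gamma> i" using factor_group assms by blast
  have one: "reduced_cons \<Gamma> (i, \<one>\<^bsub>\<Gamma> i\<^esub>) w = w" for w by (cases w) auto
  show ?thesis
  proof (cases u)
    case Nil
    then show ?thesis using one by (simp add: mult_P)
  next
    case (Cons p u')
    obtain j x where p: "p = (j, x)" by (cases p)
    have u': "u' \<in> carrier P" "x \<in> carrier (\<Gamma> j)" using assms by (auto simp: Cons p Cons_in_P)
    have "u' \<cdot> v \<in> carrier P" using u' assms mult_closed by blast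
    then have "i = j \<Longrightarrow> reduced_cons \<Gamma> (i, g) (reduced_cons \<Gamma> (i, x) (u' \<cdot> v))
        = reduced_cons \<Gamma> (i, g \<otimes>\<^bsub>\<Gamma> i\<^esub> x) (u' \<cdot> v)"
      using reduced_cons_compose assms u' by blast
    then show ?thesis using one by (auto simp: Cons p mult_Cons)
  qed
qed

lemma letter_mult: "letter i g \<cdot> w = reduced_cons \<Gamma> (i, g) w"
  by (cases w) (auto simp: letter_def mult_P)

lemma mult_reduced:
  "u @ v \<in> carrier P \<Longrightarrow> u \<cdot> v = u @ v"
proof (induction u)
  case Nil
  then show ?case by (simp add: mult_P)
next
  case (Cons p u)
  then show ?case by (cases p) (auto simp: mult_Cons Cons_in_P reduced_cons_reduced)
qed

lemma mult_assoc_P: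
  assumes "u \<in> carrier P" "v \<in> carrier P" "w \<in> carrier P"
  shows "u \<cdot> v \<cdot> w = u \<cdot> (v \<cdot> w)"
  using assms(1)
proof (induction u)
  case Nil
  then show ?case by (simp add: mult_P)
next
  case (Cons p u)
  obtain i g where p: "p = (i, g)" by (cases p)
  have u: "i \<in> I" "g \<in> carrier (\<Gamma> i)" "u \<in> carrier P" using Cons.prems by (auto simp: p Cons_in_P)
  have "(p # u) \<cdot> v \<cdot> w = reduced_cons \<Gamma> p (u \<cdot> v \<cdot> w)"
    using u assms mult_closed by (simp add: mult_Cons p reduced_cons_mult)
  then show ?case using Cons.IH u by (simp add: mult_Cons)
qed

lemma left_inverse_ex: "u \<in> carrier P \<Longrightarrow> \<exists>v\<in>carrier P. v \<cdot> u = []"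
proof (induction u)
  case Nil
  then show ?case by (intro bexI[of _ "[]"]) (auto simp: mult_P)
next
  case (Cons p u)
  obtain i g where p: "p = (i, g)" by (cases p)
  have u: "i \<in> I" "g \<in> carrier (\<Gamma> i)" "u \<in> carrier P" using Cons.prems by (auto simp: p Cons_in_P)
  interpret group "\<Gamma> i" using factor_group u by blast
  obtain v where v: "v \<in> carrier P" "v \<cdot> u = []" using Cons.IH u by blast
  have l: "letter i (inv\<^bsub>\<Gamma> i\<^esub> g) \<in> carrier P" using u by (auto intro: letter_in_P)
  have "letter i (inv\<^bsub>\<Gamma> i\<^esub> g) \<cdot> (p # u) = reduced_cons \<Gamma> (i, inv\<^bsub>\<Gamma> i\<^esub> g) (reduced_cons \<Gamma> (i, g) u)"
    using Cons.prems by (simp add: letter_mult p reduced_cons_reduced)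
  also have "\<dots> = u" using u reduced_cons_one by (simp add: reduced_cons_compose)
  finally have "(v \<cdot> letter i (inv\<^bsub>\<Gamma> i\<^esub> g)) \<cdot> (p # u) = []"
    using v l Cons.prems by (simp add: mult_assoc_P)
  then show ?case using v l mult_closed by blast
qed

lemma group_P: "group P"
proof (rule groupI)
  show "\<And>x. x \<in> carrier P \<Longrightarrow> \<exists>y\<in>carrier P. y \<cdot> x = \<one>\<^bsub>P\<^esub>"
    using left_inverse_ex by (simp add: one_P)
qed (simp_all add: mult_closed mult_assoc_P one_P, simp add: mult_P)

sublocale P: group P by (rule group_P)

lemma mult_Nil [simp]: "u \<in> carrier P \<Longrightarrow> u \<cdot> [] = u" "[] \<cdot> u = u"
  using P.r_one by (simp_all add: one_P mult_P)

lemma letter_hom: "i \<in> I \<Longrightarrow> letter i \<in> hom (\<Gamma> i) P"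
proof (rule homI)
  fix x y assume A: "i \<in> I" "x \<in> carrier (\<Gamma> i)" "y \<in> carrier (\<Gamma> i)"
  interpret group "\<Gamma> i" using factor_group A by blast
  show "letter i (x \<otimes>\<^bsub>\<Gamma> i\<^esub> y) = letter i x \<cdot> letter i y"
    using A by (simp add: letter_mult) (simp add: letter_def)
qed (simp add: letter_in_P)

lemma letter_group_hom: "i \<in> I \<Longrightarrow> group_hom (\<Gamma> i) P (letter i)"
  by (simp add: group_hom_def group_hom_axioms_def factor_group group_P letter_hom)

lemma letter_inj: "inj_on (letter i) (carrier (\<Gamma> i))"
  by (auto simp: inj_on_def letter_def split: if_splits)

lemma letter_one [simp]: "letter i \<one>\<^bsub>\<Gamma> i\<^esub> = []"
  by (simp add: letter_def)

lemma letter_not_one: "g \<noteq> \<one>\<^bsub>\<Gamma> i\<^esub> \<Longrightarrow> letter i g = [(i, g)]"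
  by (simp add: letter_def)

lemma letter_mult_letter:
  "i \<in> I \<Longrightarrow> g \<in> carrier (\<Gamma> i) \<Longrightarrow> h \<in> carrier (\<Gamma> i) \<Longrightarrow>
     letter i g \<cdot> letter i h = letter i (g \<otimes>\<^bsub>\<Gamma> i\<^esub> h)"
  using letter_hom hom_mult by metis

lemma inv_letter:
  "i \<in> I \<Longrightarrow> g \<in> carrier (\<Gamma> i) \<Longrightarrow> inv\<^bsub>P\<^esub> (letter i g) = letter i (inv\<^bsub>\<Gamma> i\<^esub> g)"
  using group_hom.hom_inv[OF letter_group_hom] by metis

lemma Cons_eq_mult:
  "(i, g) # w \<in> carrier P \<Longrightarrow> (i, g) # w = letter i g \<cdot> w"
  by (simp add: letter_mult reduced_cons_reduced)

lemma snoc_eq_mult: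
  "u @ [(i, g)] \<in> carrier P \<Longrightarrow> u @ [(i, g)] = u \<cdot> letter i g"
  using mult_reduced[of u "[(i,g)]"] by (simp add: snoc_in_P letter_not_one)

text \<open>
  Words are extended at their right end: there the Cayley graph and the Bass--Serre tree branch, as groups act from
  the left.
\<close>

lemma P_letter_induct [consumes 1, case_names one mult]:
  assumes "w \<in> carrier P" "Q []"
    and "\<And>u i g. u \<in> carrier P \<Longrightarrow> Q u \<Longrightarrow> i \<in> I \<Longrightarrow> g \<in> carrier (\<Gamma> i) \<Longrightarrow> g \<noteq> \<one>\<^bsub>\<Gamma> i\<^esub> \<Longrightarrow>
      u = [] \<or> fst (last u) \<noteq> i \<Longrightarrow> Q (u @ [(i, g)])"
  shows "Q w"
  using assms(1)
proof (induction w rule: rev_induct)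
  case (snoc p w)
  then show ?case using assms(3) by (cases p) (auto simp: snoc_in_P)
qed (rule assms(2))

end

section \<open>One-ended groups are not split by finite sets\<close>

lemma (in group) foldr_mult_closed:
  "set ws \<subseteq> carrier G \<Longrightarrow> foldr (\<otimes>) ws \<one> \<in> carrier G"
  by (induction ws) auto

lemma (in group) foldr_mult_append:
  "set us \<subseteq> carrier G \<Longrightarrow> set ws \<subseteq> carrier G \<Longrightarrow>
     foldr (\<otimes>) (us @ ws) \<one> = foldr (\<otimes>) us \<one> \<otimes> foldr (\<otimes>) ws \<one>"
  by (induction us) (auto simp: m_assoc foldr_mult_closed simp del: foldr_append)

lemma (in group) generate_as_words:
  assumes "S \<subseteq> carrier G" "x \<in> generate G S"
  shows "\<exists>ws. set ws \<subseteq> S \<union> m_inv G ` S \<and> x = foldr (\<otimes>) ws \<one>"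
  using assms(2)
proof induction
  case one
  then show ?case by (intro exI[of _ "[]"]) auto
next
  case (incl h)
  then show ?case using assms by (intro exI[of _ "[h]"]) auto
next
  case (inv h)
  then show ?case using assms by (intro exI[of _ "[inv h]"]) auto
next
  case (eng h1 h2)
  then obtain us ws where *: "set us \<subseteq> S \<union> m_inv G ` S" "h1 = foldr (\<otimes>) us \<one>"
    "set ws \<subseteq> S \<union> m_inv G ` S" "h2 = foldr (\<otimes>) ws \<one>" by auto
  moreover have "S \<union> m_inv G ` S \<subseteq> carrier G" using assms by auto
  ultimately show ?case
    by (intro exI[of _ "us @ ws"]) (metis Un_subset_iff foldr_mult_append set_append subset_trans)
qed

abbreviation off_edges :: "'a set \<Rightarrow> ('a \<times> 'a) set \<Rightarrow> 'a set \<Rightarrow> ('a \<times> 'a) set" where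
  "off_edges V E F \<equiv> (E \<union> E\<inverse>) \<inter> ((V - F) \<times> (V - F))"

lemma off_edges_rtrancl_sym: "(x, y) \<in> (off_edges V E F)\<^sup>* \<Longrightarrow> (y, x) \<in> (off_edges V E F)\<^sup>*"
proof -
  have "sym (off_edges V E F)" by (auto simp: sym_def)
  then show "(x, y) \<in> (off_edges V E F)\<^sup>* \<Longrightarrow> (y, x) \<in> (off_edges V E F)\<^sup>*"
    by (metis sym_rtrancl symD)
qed

lemma off_edges_rtrancl_in: "(x, y) \<in> (off_edges V E F)\<^sup>* \<Longrightarrow> x \<in> V - F \<Longrightarrow> y \<in> V - F"
  by (induction rule: rtrancl_induct) auto

lemma off_edges_rtrancl_mono:
  "F \<subseteq> F' \<Longrightarrow> (x, y) \<in> (off_edges V E F')\<^sup>* \<Longrightarrow> (x, y) \<in> (off_edges V E F)\<^sup>*"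
  by (erule rtrancl_mono[THEN subsetD, rotated]) auto

lemma component_eq:
  assumes "D \<in> components_off V E F" "x \<in> D"
  shows "D = (off_edges V E F)\<^sup>* `` {x}"
  using assms unfolding components_off_def
  by (auto elim!: quotientE intro: off_edges_rtrancl_sym rtrancl_trans)

lemma component_of:
  assumes "x \<in> V - F"
  shows "(off_edges V E F)\<^sup>* `` {x} \<in> components_off V E F"
  using assms unfolding components_off_def by (rule quotientI)

lemma component_subset: "D \<in> components_off V E F \<Longrightarrow> D \<subseteq> V - F"
  unfolding components_off_def by (auto elim!: quotientE dest: off_edges_rtrancl_in)

lemma component_nonempty: "D \<in> components_off V E F \<Longrightarrow> D \<noteq> {}"
  unfolding components_off_def by (auto elim!: quotientE)

text \<open>
  The sets \<open>ball n\<close> provide an increasing exhaustion by finite sets, along which an end can be chosen step by step.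
\<close>

locale connected_locally_finite_graph =
  fixes V :: "'a set" and E :: "('a \<times> 'a) set" and ball :: "nat \<Rightarrow> 'a set"
  assumes connected: "x \<in> V \<Longrightarrow> y \<in> V \<Longrightarrow> (x, y) \<in> (off_edges V E {})\<^sup>*"
    and locally_finite: "finite {y. (x, y) \<in> off_edges V E {}}"
    and finite_ball: "finite (ball n)" and ball_mono: "ball n \<subseteq> ball (Suc n)"
    and balls: "(\<Union>n. ball n) = V"
begin

text \<open>
  A path that starts off \<open>F\<close> either stays off \<open>F\<close>, or it reaches a neighbour of \<open>F\<close> before it enters \<open>F\<close>.
  Consequently there are no more components off \<open>F\<close> than neighbours of \<open>F\<close>, provided that \<open>F\<close> is not empty.
\<close>

lemma component_meets_neighbours:
  assumes "(x, y) \<in> (off_edges V E {})\<^sup>*" "x \<in> V - F"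
  shows "(x, y) \<in> (off_edges V E F)\<^sup>* \<or>
    (\<exists>f\<in>F. \<exists>z. (f, z) \<in> off_edges V E {} \<and> (x, z) \<in> (off_edges V E F)\<^sup>*)"
  using assms
proof (induction rule: rtrancl_induct)
  case (step y z)
  from step.IH[OF step.prems] show ?case
  proof
    assume xy: "(x, y) \<in> (off_edges V E F)\<^sup>*"
    then have "y \<in> V - F" using off_edges_rtrancl_in step.prems by metis
    then show ?thesis
    proof (cases "z \<in> F")
      case True
      then show ?thesis using step.hyps(2) xy by blast
    next
      case False
      then have "(y, z) \<in> off_edges V E F" using step.hyps(2) \<open>y \<in> V - F\<close> by auto
      then show ?thesis using xy by (meson rtrancl.rtrancl_into_rtrancl)
    qed
  qed blast
qed auto

lemma finite_components:
  assumes "finite F"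
  shows "finite (components_off V E F)"
proof (cases "F \<inter> V = {}")
  case True
  then have "V - F = V" by auto
  then have "components_off V E F \<subseteq> {V}"
  proof -
    have "D = V" if D: "D \<in> components_off V E F" for D
    proof -
      obtain x where x: "x \<in> D" using component_nonempty[OF D] by blast
      have "(off_edges V E F)\<^sup>* `` {x} = (off_edges V E {})\<^sup>* `` {x}" using \<open>V - F = V\<close> by simp
      moreover have "x \<in> V" using x component_subset[OF that] by blast
      ultimately have "V \<subseteq> D" using component_eq[OF that x] connected by auto
      then show ?thesis using component_subset[OF that] by blast
    qed
    then show ?thesis by blast
  qed
  then show ?thesis using finite_subset by blast
next
  case False
  then obtain f where f: "f \<in> F" "f \<in> V" by auto
  let ?N = "\<Union>f\<in>F. {y. (f, y) \<in> off_edges V E {}}"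
  have "components_off V E F \<subseteq> (\<lambda>z. (off_edges V E F)\<^sup>* `` {z}) ` ?N"
  proof
    fix D assume D: "D \<in> components_off V E F"
    then obtain x where x: "x \<in> D" using component_nonempty by blast
    then have xV: "x \<in> V - F" using D component_subset by blast
    have "(x, f) \<notin> (off_edges V E F)\<^sup>*" using off_edges_rtrancl_in[OF _ xV] f by blast
    moreover have "(x, f) \<in> (off_edges V E {})\<^sup>*" using connected xV f by blast
    ultimately obtain f' z where z: "f' \<in> F" "(f', z) \<in> off_edges V E {}" "(x, z) \<in> (off_edges V E F)\<^sup>*"
      using component_meets_neighbours[OF _ xV] by metis
    then have "z \<in> D" using component_eq[OF D x] by auto
    then show "D \<in> (\<lambda>z. (off_edges V E F)\<^sup>* `` {z}) ` ?N" using component_eq[OF D] z by blast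
  qed
  moreover have "finite ?N" using assms locally_finite by blast
  ultimately show ?thesis using finite_subset by blast
qed

lemma infinite_component:
  assumes "finite F" "infinite Y" "Y \<subseteq> V"
  obtains D where "D \<in> components_off V E F" "infinite (D \<inter> Y)"
proof -
  have "Y - F \<subseteq> (\<Union>D\<in>components_off V E F. D \<inter> Y)"
  proof
    fix x assume "x \<in> Y - F"
    then have "x \<in> V - F" using assms by auto
    then show "x \<in> (\<Union>D\<in>components_off V E F. D \<inter> Y)"
      using component_of[of x V F E] \<open>x \<in> Y - F\<close> by auto
  qed
  moreover have "infinite (Y - F)" using assms by auto
  ultimately have "infinite (\<Union>D\<in>components_off V E F. D \<inter> Y)" using finite_subset by blast
  then show ?thesis using finite_components[OF assms(1)] that by blast
qed

lemma finite_in_ball: "finite F \<Longrightarrow> F \<subseteq> V \<Longrightarrow> \<exists>n. F \<subseteq> ball n"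
proof (induction rule: finite_induct)
  case (insert x F)
  then obtain n m where "F \<subseteq> ball n" "x \<in> ball m" using balls by auto
  moreover have "ball n \<subseteq> ball (max n m)" "ball m \<subseteq> ball (max n m)"
    using lift_Suc_mono_le[of ball, OF ball_mono] by simp_all
  ultimately show ?case by blast
qed auto

text \<open>
  Konig's lemma. As there are finitely many components off a finite set, one of them has infinite intersection with
  any given infinite set. Infinite components off larger and larger finite sets can therefore be chosen in a
  decreasing sequence, which defines an end. The sequence does not leave \<open>B\<close>, because no edge off \<open>F0\<close> does.
\<close>

lemma end_in_set:
  assumes F0: "finite F0" "F0 \<subseteq> V" and B: "infinite B" "B \<subseteq> V"
    and sep: "\<And>x y. (x, y) \<in> off_edges V E F0 \<Longrightarrow> x \<in> B \<longleftrightarrow> y \<in> B"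
  shows "\<exists>e\<in>graph_ends V E. e F0 \<subseteq> B"
proof -
  let ?F = "\<lambda>n. F0 \<union> ball n"
  let ?R = "\<lambda>F. (off_edges V E F)\<^sup>*"
  have comp_B: "?R F0 `` {x} \<subseteq> B" if "x \<in> B" for x
  proof -
    have "y \<in> B" if "(x, y) \<in> ?R F0" for y
      using that \<open>x \<in> B\<close> by (induction rule: rtrancl_induct) (use sep in blast)+
    then show ?thesis by auto
  qed
  have fin: "finite (?F n)" for n using F0 finite_ball by auto
  have mono: "?F n \<subseteq> ?F m" if "n \<le> m" for n m
    using lift_Suc_mono_le[of ball, OF ball_mono that] by auto
  have shrink: "D' \<subseteq> D" if "D \<in> components_off V E F" "D' \<in> components_off V E F'" "F \<subseteq> F'"
    "x \<in> D" "x \<in> D'" for D D' F F' x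
  proof
    fix y assume "y \<in> D'"
    then have "(x, y) \<in> ?R F'" using component_eq[OF that(2,5)] by blast
    then show "y \<in> D" using component_eq[OF that(1,4)] off_edges_rtrancl_mono[OF that(3)] by blast
  qed
  have "\<exists>C. \<forall>n. (C n \<in> components_off V E (?F n) \<and> infinite (C n) \<and> C n \<subseteq> B) \<and> C (Suc n) \<subseteq> C n"
  proof (rule dependent_nat_choice)
    obtain D where D: "D \<in> components_off V E (?F 0)" "infinite (D \<inter> B)"
      using infinite_component[OF fin[of 0] B] by blast
    then obtain x where x: "x \<in> D" "x \<in> B" by (metis Int_iff finite.emptyI ex_in_conv)
    have "D \<subseteq> ?R F0 `` {x}"
    proof
      fix y assume "y \<in> D"
      then have "(x, y) \<in> ?R (?F 0)" using component_eq[OF D(1) x(1)] by blast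
      then show "y \<in> ?R F0 `` {x}" using off_edges_rtrancl_mono[of F0 "?F 0"] by blast
    qed
    then have "D \<subseteq> B" using comp_B x by blast
    then show "\<exists>D. D \<in> components_off V E (?F 0) \<and> infinite D \<and> D \<subseteq> B" using D finite_Int by blast
  next
    fix C n assume C: "C \<in> components_off V E (?F n) \<and> infinite C \<and> C \<subseteq> B"
    then have "C \<subseteq> V" using B by blast
    then obtain D where D: "D \<in> components_off V E (?F (Suc n))" "infinite (D \<inter> C)"
      using infinite_component[OF fin[of "Suc n"]] C by blast
    then obtain x where x: "x \<in> D" "x \<in> C" by (metis Int_iff finite.emptyI ex_in_conv)
    have "D \<subseteq> C" using shrink[OF conjunct1[OF C] D(1) mono[of n "Suc n"] x(2,1)] by simp
    then show "\<exists>D. (D \<in> components_off V E (?F (Suc n)) \<and> infinite D \<and> D \<subseteq> B) \<and> D \<subseteq> C"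
      using D C finite_Int by blast
  qed
  then obtain C where C: "\<And>n. C n \<in> components_off V E (?F n)" "\<And>n. infinite (C n)"
    "\<And>n. C n \<subseteq> B" "\<And>n. C (Suc n) \<subseteq> C n" by blast
  have C_mono: "C m \<subseteq> C n" if "n \<le> m" for n m using lift_Suc_antimono_le[of C] C(4) that by blast
  \<comment> \<open>The end selects off \<open>F\<close> the component that contains almost all of the sets \<open>C n\<close>.\<close>
  define pt where "pt n = (SOME x. x \<in> C n)" for n
  have pt: "pt n \<in> C n" for n using component_nonempty[OF C(1)] by (auto simp: pt_def some_in_eq)
  define N where "N F = (LEAST n. F \<subseteq> ball n)" for F
  have N: "F \<subseteq> ball (N F)" if "finite F" "F \<subseteq> V" for F
    using finite_in_ball[OF that] unfolding N_def by (metis LeastI_ex)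
  define e where "e = (\<lambda>F\<in>{F. finite F \<and> F \<subseteq> V}. ?R F `` {pt (N F)})"
  have e_comp: "e F \<in> components_off V E F \<and> C n \<subseteq> e F" if F: "finite F" "F \<subseteq> V" "F \<subseteq> ?F n" for F n
  proof -
    have "F \<subseteq> ?F (N F)" using N[OF F(1,2)] by auto
    then have "pt (N F) \<in> V - F" using pt C(1) component_subset by blast
    then have c: "?R F `` {pt (N F)} \<in> components_off V E F" by (rule component_of)
    have sub: "C k \<subseteq> D" if "D \<in> components_off V E F" "F \<subseteq> ?F k" "x \<in> D" "x \<in> C k" for k x D
      using shrink[OF that(1) C(1) that(2-4)] .
    have *: "C (N F) \<subseteq> ?R F `` {pt (N F)}" using sub[OF c \<open>F \<subseteq> ?F (N F)\<close> _ pt] by blast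
    have "pt (max n (N F)) \<in> C n \<inter> C (N F)"
      using pt[of "max n (N F)"] C_mono[of n "max n (N F)"] C_mono[of "N F" "max n (N F)"] by auto
    then have "C n \<subseteq> ?R F `` {pt (N F)}" using sub[OF c F(3)] * by blast
    then show ?thesis using c F by (simp add: e_def)
  qed
  have "e \<in> graph_ends V E"
    unfolding graph_ends_def
  proof (intro CollectI conjI allI impI)
    show "e \<in> (\<Pi>\<^sub>E F\<in>{F. finite F \<and> F \<subseteq> V}. components_off V E F)"
    proof (rule PiE_I)
      fix F assume "F \<in> {F. finite F \<and> F \<subseteq> V}"
      then show "e F \<in> components_off V E F" using e_comp[of F "N F"] N[of F] by auto
    qed (auto simp: e_def restrict_def)
  next
    fix F F' assume A: "finite F' \<and> F \<subseteq> F' \<and> F' \<subseteq> V"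
    then have F: "finite F" "F \<subseteq> V" "F \<subseteq> ?F (N F')" "F' \<subseteq> ?F (N F')"
      using N[of F'] finite_subset by auto
    have 1: "e F \<in> components_off V E F" "C (N F') \<subseteq> e F" using e_comp[OF F(1-3)] by simp_all
    have 2: "e F' \<in> components_off V E F'" "C (N F') \<subseteq> e F'" using e_comp[OF _ _ F(4)] A by simp_all
    show "e F' \<subseteq> e F"
      by (rule shrink[OF 1(1) 2(1) _ 1(2)[THEN subsetD, OF pt] 2(2)[THEN subsetD, OF pt]])
        (rule conjunct1[OF conjunct2[OF A]])
  qed
  moreover have "e F0 \<subseteq> B"
  proof -
    have *: "e F0 \<in> components_off V E F0" "C 0 \<subseteq> e F0" using e_comp[of F0 0] F0 by auto
    have "e F0 = ?R F0 `` {pt 0}" by (rule component_eq[OF *(1) subsetD[OF *(2) pt]])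
    then show ?thesis using comp_B[OF subsetD[OF C(3) pt]] by simp
  qed
  ultimately show ?thesis by blast
qed

end

text \<open>
  The exhausting sets consist of the values of words of bounded length in the generators and their inverses.
\<close>

lemma cayley_graph_exhausted:
  assumes "group G" "finite_generating_set G S"
  obtains ball where "connected_locally_finite_graph (carrier G) (cayley_edges G S) ball"
proof -
  interpret group G by fact
  have S: "finite S" "S \<subseteq> carrier G" "generate G S = carrier G"
    using assms by (auto simp: finite_generating_set_def)
  let ?T = "S \<union> m_inv G ` S"
  have T: "?T \<subseteq> carrier G" "finite ?T" using S by auto
  define ball where "ball n = (\<lambda>ws. foldr (\<otimes>\<^bsub>G\<^esub>) ws \<one>\<^bsub>G\<^esub>) ` {ws. set ws \<subseteq> ?T \<and> length ws \<le> n}" for n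
  have edge: "(g, g \<otimes>\<^bsub>G\<^esub> t) \<in> off_edges (carrier G) (cayley_edges G S) {}" if gt: "g \<in> carrier G" "t \<in> ?T" for g t
  proof (cases "t \<in> S")
    case True
    then show ?thesis using that S by (auto simp: cayley_edges_def)
  next
    case False
    then obtain s where s: "s \<in> S" "t = inv\<^bsub>G\<^esub> s" using gt(2) by blast
    then have "(g \<otimes>\<^bsub>G\<^esub> t) \<otimes>\<^bsub>G\<^esub> s = g" using that S by (auto simp: m_assoc)
    then have "(g \<otimes>\<^bsub>G\<^esub> t, g) \<in> cayley_edges G S" using s that S T
      by (auto simp: cayley_edges_def intro!: exI[of _ "g \<otimes>\<^bsub>G\<^esub> t"] exI[of _ s])
    then show ?thesis using that T by auto
  qed
  have path: "(g, g \<otimes>\<^bsub>G\<^esub> foldr (\<otimes>\<^bsub>G\<^esub>) ws \<one>\<^bsub>G\<^esub>) \<in> (off_edges (carrier G) (cayley_edges G S) {})\<^sup>*"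
    if "g \<in> carrier G" "set ws \<subseteq> ?T" for g ws
    using that
  proof (induction ws arbitrary: g)
    case (Cons t ws)
    have c: "t \<in> carrier G" "set ws \<subseteq> carrier G" using Cons.prems T by auto
    have "(g, g \<otimes>\<^bsub>G\<^esub> t) \<in> off_edges (carrier G) (cayley_edges G S) {}" using edge Cons.prems by auto
    moreover have "(g \<otimes>\<^bsub>G\<^esub> t, (g \<otimes>\<^bsub>G\<^esub> t) \<otimes>\<^bsub>G\<^esub> foldr (\<otimes>\<^bsub>G\<^esub>) ws \<one>\<^bsub>G\<^esub>) \<in> (off_edges (carrier G) (cayley_edges G S) {})\<^sup>*"
      using Cons.IH[of "g \<otimes>\<^bsub>G\<^esub> t"] Cons.prems c by auto
    ultimately have "(g, (g \<otimes>\<^bsub>G\<^esub> t) \<otimes>\<^bsub>G\<^esub> foldr (\<otimes>\<^bsub>G\<^esub>) ws \<one>\<^bsub>G\<^esub>) \<in> (off_edges (carrier G) (cayley_edges G S) {})\<^sup>*"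
      by (rule converse_rtrancl_into_rtrancl)
    then show ?case
      using Cons.prems c foldr_mult_closed m_assoc[of g t] by (simp only: foldr.simps o_apply)
  qed auto
  have words: "\<exists>ws. set ws \<subseteq> ?T \<and> x = foldr (\<otimes>\<^bsub>G\<^esub>) ws \<one>\<^bsub>G\<^esub>" if "x \<in> carrier G" for x
    using generate_as_words[OF S(2)] that S(3) by blast
  have "connected_locally_finite_graph (carrier G) (cayley_edges G S) ball"
  proof
    fix x y assume xy: "x \<in> carrier G" "y \<in> carrier G"
    then obtain ws where "set ws \<subseteq> ?T" "inv\<^bsub>G\<^esub> x \<otimes>\<^bsub>G\<^esub> y = foldr (\<otimes>\<^bsub>G\<^esub>) ws \<one>\<^bsub>G\<^esub>"
      using words[of "inv\<^bsub>G\<^esub> x \<otimes>\<^bsub>G\<^esub> y"] by auto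
    then show "(x, y) \<in> (off_edges (carrier G) (cayley_edges G S) {})\<^sup>*"
      using path[of x ws] xy by (metis inv_closed inv_solve_left m_closed)
  next
    fix x
    have "{y. (x, y) \<in> off_edges (carrier G) (cayley_edges G S) {}} \<subseteq> (\<lambda>t. x \<otimes>\<^bsub>G\<^esub> t) ` ?T"
    proof
      fix y assume "y \<in> {y. (x, y) \<in> off_edges (carrier G) (cayley_edges G S) {}}"
      then consider s where "s \<in> S" "y = x \<otimes>\<^bsub>G\<^esub> s" "x \<in> carrier G"
        | s where "s \<in> S" "x = y \<otimes>\<^bsub>G\<^esub> s" "y \<in> carrier G"
        by (auto simp: cayley_edges_def)
      then show "y \<in> (\<lambda>t. x \<otimes>\<^bsub>G\<^esub> t) ` ?T"
      proof cases
        case 2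
        then have "y = x \<otimes>\<^bsub>G\<^esub> inv\<^bsub>G\<^esub> s" using S by (auto simp: m_assoc)
        then show ?thesis using 2 by blast
      qed auto
    qed
    then show "finite {y. (x, y) \<in> off_edges (carrier G) (cayley_edges G S) {}}"
      using T finite_subset by blast
  next
    fix n
    show "finite (ball n)" unfolding ball_def using finite_lists_length_le[OF T(2)] by auto
    show "ball n \<subseteq> ball (Suc n)" unfolding ball_def by auto
    show "(\<Union>n. ball n) = carrier G"
    proof
      show "(\<Union>n. ball n) \<subseteq> carrier G" 
      proof
        fix x assume "x \<in> (\<Union>n. ball n)"
        then obtain ws where "set ws \<subseteq> ?T" "x = foldr (\<otimes>\<^bsub>G\<^esub>) ws \<one>\<^bsub>G\<^esub>" by (auto simp: ball_def)
        then show "x \<in> carrier G" using foldr_mult_closed[of ws] T by blast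
      qed
      show "carrier G \<subseteq> (\<Union>n. ball n)"
      proof
        fix x assume "x \<in> carrier G"
        then obtain ws where "set ws \<subseteq> ?T" "x = foldr (\<otimes>\<^bsub>G\<^esub>) ws \<one>\<^bsub>G\<^esub>" using words by blast
        then have "x \<in> ball (length ws)" unfolding ball_def by blast
        then show "x \<in> (\<Union>n. ball n)" by blast
      qed
    qed
  qed
  then show ?thesis by (rule that)
qed

text \<open>
  If both \<open>B\<close> and its complement are infinite, then each of them contains an end after deletion of the finitely many
  elements at which edges lead from one to the other, and these ends differ. The group is infinite because a finite
  graph has no ends: deletion of all vertices leaves no component.
\<close>

lemma one_ended_group_splits_trivially:
  assumes "one_ended_group G"
  obtains S where "finite_generating_set G S" "infinite (carrier G)"
    "\<And>B. B \<subseteq> carrier G \<Longrightarrow>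
       (\<And>s. s \<in> S \<Longrightarrow> finite {g \<in> carrier G. g \<in> B \<longleftrightarrow> g \<otimes>\<^bsub>G\<^esub> s \<notin> B}) \<Longrightarrow>
       finite B \<or> finite (carrier G - B)"
proof -
  obtain S where S: "group G" "finite_generating_set G S"
    and one: "card (graph_ends (carrier G) (cayley_edges G S)) = 1"
    using assms by (auto simp: one_ended_group_def)
  interpret group G by fact
  have Sc: "finite S" "S \<subseteq> carrier G" using S by (auto simp: finite_generating_set_def)
  let ?V = "carrier G" and ?E = "cayley_edges G S"
  obtain ball where "connected_locally_finite_graph ?V ?E ball"
    using cayley_graph_exhausted S by blast
  then interpret connected_locally_finite_graph ?V ?E ball .
  obtain e0 where e0: "graph_ends ?V ?E = {e0}" using one card_1_singletonE by blast
  have "infinite ?V"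
  proof
    assume "finite ?V"
    have "e0 \<in> (\<Pi>\<^sub>E F\<in>{F. finite F \<and> F \<subseteq> ?V}. components_off ?V ?E F)"
    proof -
      have "e0 \<in> graph_ends ?V ?E" using e0 by simp
      then show ?thesis unfolding graph_ends_def by (elim CollectE conjE)
    qed
    from PiE_mem[OF this, of ?V] have "e0 ?V \<in> components_off ?V ?E ?V" using \<open>finite ?V\<close> by simp
    then show False by (simp add: components_off_def quotient_def)
  qed
  moreover have "finite B \<or> finite (?V - B)"
    if B: "B \<subseteq> ?V" and fin: "\<And>s. s \<in> S \<Longrightarrow> finite {g \<in> ?V. g \<in> B \<longleftrightarrow> g \<otimes>\<^bsub>G\<^esub> s \<notin> B}" for B
  proof (rule ccontr)
    assume "\<not> (finite B \<or> finite (?V - B))"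
    then have inf: "infinite B" "infinite (?V - B)" by auto
    define F where "F = (\<Union>s\<in>S. {g \<in> ?V. g \<in> B \<longleftrightarrow> g \<otimes>\<^bsub>G\<^esub> s \<notin> B})"
    have F: "finite F" "F \<subseteq> ?V" unfolding F_def using Sc fin by auto
    have sep: "x \<in> B \<longleftrightarrow> y \<in> B" "x \<in> ?V - B \<longleftrightarrow> y \<in> ?V - B" if "(x, y) \<in> off_edges ?V ?E F" for x y
      using that by (auto simp: cayley_edges_def F_def)
    obtain e e' where *: "e \<in> graph_ends ?V ?E" "e F \<subseteq> B" "e' \<in> graph_ends ?V ?E" "e' F \<subseteq> ?V - B"
      using end_in_set[OF F inf(1) B sep(1)] end_in_set[OF F inf(2) _ sep(2)] by blast
    have "e0 F \<subseteq> B" "e0 F \<subseteq> ?V - B" "e0 F \<in> components_off ?V ?E F"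
    proof -
      have "e = e0" "e' = e0" using * e0 by blast+
      then show "e0 F \<subseteq> B" "e0 F \<subseteq> ?V - B" using * by simp_all
      have "e0 \<in> graph_ends ?V ?E" using e0 by simp
      then have "e0 \<in> (\<Pi>\<^sub>E F\<in>{F. finite F \<and> F \<subseteq> ?V}. components_off ?V ?E F)"
        unfolding graph_ends_def by (elim CollectE conjE)
      from PiE_mem[OF this, of F] show "e0 F \<in> components_off ?V ?E F" using F by simp
    qed
    then show False using component_nonempty by blast
  qed
  ultimately show ?thesis using S that by blast
qed

section \<open>One-ended subgroups of free products\<close>

context free_product_of_groups
begin

text \<open>
  The Bass--Serre tree of the free product has as vertices the words \<open>t\<close> and the cosets \<open>t \<cdot> \<Gamma> i\<close>, and an edge
  from \<open>t\<close> to \<open>t \<cdot> \<Gamma> i\<close> for each \<open>t\<close> and \<open>i\<close>. Removing the edge between the empty word and the coset \<open>\<Gamma> i\<close>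
  separates the words in \<open>half i\<close> from the others. So the translates \<open>t \<cdot> half i\<close> are the half-spaces of all
  edges, on the side of the coset \<open>t \<cdot> \<Gamma> i\<close>.
\<close>

definition half :: "'i \<Rightarrow> ('i \<times> 'a) list set" where
  "half i = {w \<in> carrier P. w \<noteq> [] \<and> fst (hd w) = i}"

text \<open>
  Multiplication by a letter acts at the end of a word and reaches its first letter only if the word has one letter.
\<close>

lemma first_type_mult_letter:
  assumes "w \<in> carrier P" "w \<noteq> []" "j \<in> I" "x \<in> carrier (\<Gamma> j)"
  shows "w \<cdot> letter j x = [] \<or> fst (hd (w \<cdot> letter j x)) = fst (hd w)"
  using assms(1,2)
proof (induction w)
  case (Cons p w)
  obtain k g where p: "p = (k, g)" by (cases p)
  have w: "w \<in> carrier P" "w = [] \<or> fst (hd w) \<noteq> k" "g \<noteq> \<one>\<^bsub>\<Gamma> k\<^esub>"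
    using Cons.prems by (auto simp: p Cons_in_P)
  show ?case
  proof (cases "w = []")
    case True
    then show ?thesis using w by (auto simp: p mult_P letter_def)
  next
    case False
    then have "w \<cdot> letter j x = [] \<or> fst (hd (w \<cdot> letter j x)) \<noteq> k"
      using Cons.IH w by auto
    then show ?thesis using w by (cases "w \<cdot> letter j x") (auto simp: p mult_Cons)
  qed
qed simp

text \<open>
  By the previous lemma only the empty word is moved into \<open>half i\<close> by multiplication with a single letter. For a
  word \<open>s\<close> the exceptions are those words that become empty after multiplication with some prefix of \<open>s\<close>.
\<close>

lemma finite_half_boundary:
  assumes "s \<in> carrier P"
  shows "finite {w \<in> carrier P. w \<notin> half i \<and> w \<cdot> s \<in> half i}"
  using assms
proof (induction s rule: P_letter_induct)
  case one
  have "{w \<in> carrier P. w \<notin> half i \<and> w \<cdot> [] \<in> half i} = {}"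
    by auto
  then show ?case by (metis finite.emptyI)
next
  case (mult u j g)
  have l: "letter j g \<in> carrier P" using mult letter_in_P by blast
  have eq: "u @ [(j, g)] = u \<cdot> letter j g" using mult by (intro snoc_eq_mult) (auto simp: snoc_in_P)
  have "w \<cdot> u \<in> half i \<or> w = inv\<^bsub>P\<^esub> u"
    if w: "w \<in> carrier P" "w \<cdot> (u @ [(j, g)]) \<in> half i" for w
  proof (rule ccontr)
    assume n: "\<not> (w \<cdot> u \<in> half i \<or> w = inv\<^bsub>P\<^esub> u)"
    have "w \<cdot> u \<noteq> []" using n w mult(1) P.inv_equality by (metis one_P)
    moreover have "w \<cdot> u \<cdot> letter j g \<in> half i"
      using w mult(1) l by (simp add: eq mult_assoc_P)
    ultimately show False
      using first_type_mult_letter[of "w \<cdot> u" j g] n w mult mult_closed by (auto simp: half_def)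
  qed
  then have "{w \<in> carrier P. w \<notin> half i \<and> w \<cdot> (u @ [(j, g)]) \<in> half i} \<subseteq>
     {w \<in> carrier P. w \<notin> half i \<and> w \<cdot> u \<in> half i} \<union> {inv\<^bsub>P\<^esub> u}"
    by blast
  then show ?case using mult.IH by (meson finite.emptyI finite.insertI finite_UnI finite_subset)
qed

lemma strip_first:
  assumes "u \<in> carrier P" "i \<in> I"
  obtains h x where "h \<in> carrier (\<Gamma> i)" "x \<in> carrier P" "x = [] \<or> fst (hd x) \<noteq> i"
    "u = letter i h \<cdot> x"
proof (cases "u = [] \<or> fst (hd u) \<noteq> i")
  case True
  interpret group "\<Gamma> i" using factor_group assms by blast
  show ?thesis using that[of "\<one>\<^bsub>\<Gamma> i\<^esub>" u] assms True by (simp add: mult_P)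
next
  case False
  then obtain h x where u: "u = (i, h) # x" by (cases u) auto
  then show ?thesis using that[of h x] assms by (auto simp: Cons_in_P Cons_eq_mult)
qed

lemma strip_last:
  assumes "u \<in> carrier P" "j \<in> I"
  obtains h x y where "h \<in> carrier (\<Gamma> j)" "x \<in> carrier P" "x = [] \<or> fst (last x) \<noteq> j"
    "u = x \<cdot> letter j h" "u = x @ y"
proof (cases "u = [] \<or> fst (last u) \<noteq> j")
  case True
  interpret group "\<Gamma> j" using factor_group assms by blast
  show ?thesis using that[of "\<one>\<^bsub>\<Gamma> j\<^esub>" u "[]"] assms True P.r_one by (simp add: one_P)
next
  case False
  then obtain h x where u: "u = x @ [(j, h)]" by (cases u rule: rev_cases) auto
  then show ?thesis using that[of h x "[(j, h)]"] assms by (auto simp: snoc_in_P snoc_eq_mult)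
qed

text \<open>
  Two different coset vertices of the tree are \<open>\<Gamma> i\<close> and \<open>u \<cdot> \<Gamma> j\<close>. The half-space of an edge at a coset vertex, on
  the side of this vertex, omits one branch of the tree. If at each of the two vertices the omitted branch is
  the one that contains the other vertex, then the two half-spaces are disjoint. These branches are found by
  cancelling letters of type \<open>i\<close> at the beginning of \<open>u\<close> and letters of type \<open>j\<close> at its end.
\<close>

lemma disjoint_half_translates:
  assumes u: "u \<in> carrier P" and ij: "i \<in> I" "j \<in> I"
    and neq: "\<not> (i = j \<and> u \<in> letter i ` carrier (\<Gamma> i))"
  obtains h h' where "h \<in> carrier (\<Gamma> i)" "h' \<in> carrier (\<Gamma> j)"
    "\<And>w. w \<in> carrier P \<Longrightarrow> inv\<^bsub>P\<^esub> (letter i h) \<cdot> w \<in> half i \<Longrightarrow>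
       inv\<^bsub>P\<^esub> (u \<cdot> letter j h') \<cdot> w \<notin> half j"
proof -
  obtain h x where h: "h \<in> carrier (\<Gamma> i)" "x \<in> carrier P" "x = [] \<or> fst (hd x) \<noteq> i"
    "u = letter i h \<cdot> x" using strip_first[OF u ij(1)] .
  obtain k y z where k: "k \<in> carrier (\<Gamma> j)" "y \<in> carrier P" "y = [] \<or> fst (last y) \<noteq> j"
    "x = y \<cdot> letter j k" "x = y @ z" using strip_last[OF h(2) ij(2)] .
  interpret j: group "\<Gamma> j" using factor_group ij by blast
  interpret i: group "\<Gamma> i" using factor_group ij by blast
  have y_hd: "y = [] \<or> fst (hd y) \<noteq> i" using h(3) k(5) by auto
  have lc: "letter i h \<in> carrier P" "letter j k \<in> carrier P" using h k ij letter_in_P by auto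
  have y: "y \<noteq> [] \<or> i \<noteq> j"
  proof (rule ccontr)
    assume "\<not> ?thesis"
    then have "u = letter i (h \<otimes>\<^bsub>\<Gamma> i\<^esub> k)" "i = j"
      using h k ij letter_mult_letter[of i h k] by (auto simp: mult_P)
    then show False using neq h k by auto
  qed
  have uk: "u \<cdot> letter j (inv\<^bsub>\<Gamma> j\<^esub> k) = letter i h \<cdot> y"
    using lc k(1,2) ij by (simp add: h(4) k(4) flip: inv_letter) (simp add: P.m_assoc)
  show ?thesis
  proof (rule that[of h "inv\<^bsub>\<Gamma> j\<^esub> k"])
    fix w assume w: "w \<in> carrier P" "inv\<^bsub>P\<^esub> (letter i h) \<cdot> w \<in> half i"
    show "inv\<^bsub>P\<^esub> (u \<cdot> letter j (inv\<^bsub>\<Gamma> j\<^esub> k)) \<cdot> w \<notin> half j"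
    proof
      assume a: "inv\<^bsub>P\<^esub> (u \<cdot> letter j (inv\<^bsub>\<Gamma> j\<^esub> k)) \<cdot> w \<in> half j"
      define v where "v = inv\<^bsub>P\<^esub> y \<cdot> (inv\<^bsub>P\<^esub> (letter i h) \<cdot> w)"
      have v: "v \<in> half j"
        using a w lc k by (simp add: uk v_def P.inv_mult_group P.m_assoc)
      then have "y @ v \<in> carrier P" using k by (auto simp: append_in_P half_def)
      then have "y \<cdot> v = y @ v" by (rule mult_reduced)
      moreover have "y \<cdot> v = inv\<^bsub>P\<^esub> (letter i h) \<cdot> w"
        using k w lc by (simp add: v_def flip: P.m_assoc)
      ultimately have "y @ v \<in> half i" using w by simp
      then show False using y y_hd v by (auto simp: half_def hd_append split: if_splits)
    qed
  qed (use h k in auto)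
qed

end

locale infinite_group_in_free_product =
  free_product_of_groups I \<Gamma> + A: group A
  for I :: "'i set" and \<Gamma> :: "'i \<Rightarrow> ('a, 'm) monoid_scheme" and A :: "('b, 'n) monoid_scheme" +
  fixes \<psi> :: "'b \<Rightarrow> ('i \<times> 'a) list"
  assumes \<psi>_hom: "\<psi> \<in> hom A (free_product I \<Gamma>)"
    and \<psi>_inj: "inj_on \<psi> (carrier A)"
    and infinite_A: "infinite (carrier A)"
begin

sublocale \<psi>: group_hom A P \<psi>
  by unfold_locales (rule \<psi>_hom)

definition missing :: "('i \<times> 'a) list \<Rightarrow> 'i \<Rightarrow> 'b set" where
  "missing t i = {a \<in> carrier A. inv\<^bsub>P\<^esub> t \<cdot> \<psi> a \<notin> half i}"

text \<open>
  An edge points to the side that contains almost all of \<open>A\<close>. A sink is a coset vertex \<open>t \<cdot> \<Gamma> i\<close> to which all its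
  edges point; their other ends are the words \<open>t \<cdot> letter i h\<close>.
\<close>

definition sink :: "('i \<times> 'a) list \<Rightarrow> 'i \<Rightarrow> bool" where
  "sink t i \<longleftrightarrow> t \<in> carrier P \<and> i \<in> I \<and> (\<forall>h\<in>carrier (\<Gamma> i). finite (missing (t \<cdot> letter i h) i))"

lemma inj_left_translate: "t \<in> carrier P \<Longrightarrow> inj_on (\<lambda>a. t \<cdot> \<psi> a) (carrier A)"
  using \<psi>_inj by (auto simp: inj_on_def)

text \<open>
  The infinite group \<open>A\<close> does not have almost all its elements in each of two disjoint half-spaces.
\<close>

lemma sink_unique:
  assumes "sink t i" "sink s j"
  shows "i = j \<and> inv\<^bsub>P\<^esub> t \<cdot> s \<in> letter i ` carrier (\<Gamma> i)"
proof (rule ccontr)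
  assume neq: "\<not> ?thesis"
  have c: "t \<in> carrier P" "s \<in> carrier P" "i \<in> I" "j \<in> I" using assms by (auto simp: sink_def)
  have uP: "inv\<^bsub>P\<^esub> t \<cdot> s \<in> carrier P" using c by simp
  obtain h h' where h: "h \<in> carrier (\<Gamma> i)" "h' \<in> carrier (\<Gamma> j)"
    "\<And>w. w \<in> carrier P \<Longrightarrow> inv\<^bsub>P\<^esub> (letter i h) \<cdot> w \<in> half i \<Longrightarrow>
       inv\<^bsub>P\<^esub> (inv\<^bsub>P\<^esub> t \<cdot> s \<cdot> letter j h') \<cdot> w \<notin> half j"
    using disjoint_half_translates[OF uP c(3,4) neq] by metis
  have l: "letter i h \<in> carrier P" "letter j h' \<in> carrier P" using h c letter_in_P by auto
  have "carrier A \<subseteq> missing (t \<cdot> letter i h) i \<union> missing (s \<cdot> letter j h') j"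
  proof
    fix a assume a: "a \<in> carrier A"
    let ?w = "inv\<^bsub>P\<^esub> t \<cdot> \<psi> a"
    have "inv\<^bsub>P\<^esub> (t \<cdot> letter i h) \<cdot> \<psi> a = inv\<^bsub>P\<^esub> (letter i h) \<cdot> ?w"
      using a c l by (simp add: P.inv_mult_group P.m_assoc)
    moreover have "inv\<^bsub>P\<^esub> (s \<cdot> letter j h') \<cdot> \<psi> a
        = inv\<^bsub>P\<^esub> (inv\<^bsub>P\<^esub> t \<cdot> s \<cdot> letter j h') \<cdot> ?w"
    proof -
      have "s \<cdot> letter j h' = t \<cdot> (inv\<^bsub>P\<^esub> t \<cdot> s \<cdot> letter j h')"
        using c l by (simp flip: P.m_assoc)
      then have "inv\<^bsub>P\<^esub> (s \<cdot> letter j h') = inv\<^bsub>P\<^esub> (inv\<^bsub>P\<^esub> t \<cdot> s \<cdot> letter j h') \<cdot> inv\<^bsub>P\<^esub> t"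
        using c l P.inv_mult_group[of t "inv\<^bsub>P\<^esub> t \<cdot> s \<cdot> letter j h'"] by simp
      then show ?thesis using a c l by (simp add: P.m_assoc)
    qed
    ultimately show "a \<in> missing (t \<cdot> letter i h) i \<union> missing (s \<cdot> letter j h') j"
      using h(3)[of ?w] a c by (auto simp: missing_def)
  qed
  moreover have "finite (missing (t \<cdot> letter i h) i \<union> missing (s \<cdot> letter j h') j)"
    using assms h by (auto simp: sink_def)
  ultimately show False using infinite_A finite_subset by blast
qed

lemma missing_translate:
  assumes "a \<in> carrier A" "t \<in> carrier P"
  shows "missing (\<psi> a \<cdot> t) i = (\<lambda>b. a \<otimes>\<^bsub>A\<^esub> b) ` missing t i"
proof -
  have *: "inv\<^bsub>P\<^esub> (\<psi> a \<cdot> t) \<cdot> \<psi> (a \<otimes>\<^bsub>A\<^esub> b) = inv\<^bsub>P\<^esub> t \<cdot> \<psi> b" if "b \<in> carrier A" for b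
  proof -
    have "inv\<^bsub>P\<^esub> (\<psi> a) \<cdot> (\<psi> a \<cdot> \<psi> b) = \<psi> b"
      using assms that by (simp flip: P.m_assoc)
    then show ?thesis using assms that by (simp add: P.inv_mult_group P.m_assoc)
  qed
  show ?thesis
  proof (intro equalityI subsetI)
    fix b assume b: "b \<in> missing (\<psi> a \<cdot> t) i"
    then have bA: "b \<in> carrier A" by (simp add: missing_def)
    have "b = a \<otimes>\<^bsub>A\<^esub> (inv\<^bsub>A\<^esub> a \<otimes>\<^bsub>A\<^esub> b)" using assms bA by (simp flip: A.m_assoc)
    moreover have "inv\<^bsub>A\<^esub> a \<otimes>\<^bsub>A\<^esub> b \<in> missing t i"
      using b *[of "inv\<^bsub>A\<^esub> a \<otimes>\<^bsub>A\<^esub> b"] calculation assms bA by (simp add: missing_def)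
    ultimately show "b \<in> (\<lambda>b. a \<otimes>\<^bsub>A\<^esub> b) ` missing t i" by blast
  qed (use assms * in \<open>auto simp: missing_def\<close>)
qed

lemma sink_translate:
  assumes "sink t i" "a \<in> carrier A"
  shows "sink (\<psi> a \<cdot> t) i"
proof -
  have c: "t \<in> carrier P" "i \<in> I" using assms by (auto simp: sink_def)
  have "finite (missing (\<psi> a \<cdot> t \<cdot> letter i h) i)" if "h \<in> carrier (\<Gamma> i)" for h
  proof -
    have l: "letter i h \<in> carrier P" using that c letter_in_P by auto
    then have "\<psi> a \<cdot> t \<cdot> letter i h = \<psi> a \<cdot> (t \<cdot> letter i h)"
      using assms c by (simp add: P.m_assoc)
    then show ?thesis using assms that c l missing_translate[of a "t \<cdot> letter i h" i]
      by (auto simp: sink_def)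
  qed
  then show ?thesis using c assms by (simp add: sink_def)
qed

text \<open>
  \<open>A\<close> permutes the sinks. As there is at most one, \<open>A\<close> fixes it and lies in its stabiliser.
\<close>

lemma sink_conjugate:
  assumes "sink t i" "a \<in> carrier A"
  shows "\<exists>x\<in>carrier (\<Gamma> i). \<psi> a = t \<cdot> letter i x \<cdot> inv\<^bsub>P\<^esub> t"
proof -
  have c: "t \<in> carrier P" "i \<in> I" using assms by (auto simp: sink_def)
  obtain x where x: "x \<in> carrier (\<Gamma> i)" "inv\<^bsub>P\<^esub> t \<cdot> (\<psi> a \<cdot> t) = letter i x"
    using sink_unique[OF assms(1) sink_translate[OF assms]] by auto
  have "t \<cdot> letter i x \<cdot> inv\<^bsub>P\<^esub> t = \<psi> a"
    using assms c by (simp add: P.m_assoc flip: x(2)) (simp flip: P.m_assoc)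
  then show ?thesis using x by metis
qed

text \<open>
  If \<open>A\<close> stabilises the vertex, then each branch at the vertex contains at most one element of \<open>A\<close>: if
  the inverse of the conjugating word is stripped of a first letter of type \<open>i\<close>, the word \<open>r\<close> below remains, and a
  translate of \<open>A\<close> misses the half-space at most at \<open>r\<close>.
\<close>

lemma conjugate_sink:
  assumes t: "t \<in> carrier P" "i \<in> I"
    and conj: "\<And>a. a \<in> carrier A \<Longrightarrow> \<exists>x\<in>carrier (\<Gamma> i). \<psi> a = t \<cdot> letter i x \<cdot> inv\<^bsub>P\<^esub> t"
  shows "sink t i"
  unfolding sink_def
proof (intro conjI ballI t)
  fix h assume h: "h \<in> carrier (\<Gamma> i)"
  interpret i: group "\<Gamma> i" using factor_group t by blast
  have l: "letter i h \<in> carrier P" using h t letter_in_P by auto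
  obtain k r where k: "k \<in> carrier (\<Gamma> i)" "r \<in> carrier P" "r = [] \<or> fst (hd r) \<noteq> i"
    "inv\<^bsub>P\<^esub> t = letter i k \<cdot> r" using strip_first[of "inv\<^bsub>P\<^esub> t" i] t by auto
  have lk: "letter i k \<in> carrier P" using k t letter_in_P by auto
  have "inv\<^bsub>P\<^esub> (t \<cdot> letter i h) \<cdot> \<psi> a = r" if a: "a \<in> missing (t \<cdot> letter i h) i" for a
  proof -
    have aA: "a \<in> carrier A" "inv\<^bsub>P\<^esub> (t \<cdot> letter i h) \<cdot> \<psi> a \<notin> half i"
      using a by (auto simp: missing_def)
    obtain x where x: "x \<in> carrier (\<Gamma> i)" "\<psi> a = t \<cdot> letter i x \<cdot> inv\<^bsub>P\<^esub> t"
      using conj aA by blast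
    have lx: "letter i x \<in> carrier P" using x t letter_in_P by auto
    define z where "z = inv\<^bsub>\<Gamma> i\<^esub> h \<otimes>\<^bsub>\<Gamma> i\<^esub> x \<otimes>\<^bsub>\<Gamma> i\<^esub> k"
    have z: "z \<in> carrier (\<Gamma> i)" using h k x by (simp add: z_def)
    have "inv\<^bsub>P\<^esub> (t \<cdot> letter i h) \<cdot> \<psi> a = inv\<^bsub>P\<^esub> (letter i h) \<cdot> (inv\<^bsub>P\<^esub> t \<cdot> (t \<cdot> (letter i x \<cdot> inv\<^bsub>P\<^esub> t)))"
      using t l lx by (simp add: x(2) P.inv_mult_group P.m_assoc)
    also have "inv\<^bsub>P\<^esub> t \<cdot> (t \<cdot> (letter i x \<cdot> inv\<^bsub>P\<^esub> t)) = letter i x \<cdot> inv\<^bsub>P\<^esub> t"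
      using t lx by (simp flip: P.m_assoc)
    also have "inv\<^bsub>P\<^esub> (letter i h) \<cdot> (letter i x \<cdot> inv\<^bsub>P\<^esub> t)
      = letter i (inv\<^bsub>\<Gamma> i\<^esub> h) \<cdot> letter i x \<cdot> letter i k \<cdot> r"
      using t h l lx lk k by (simp add: P.m_assoc flip: inv_letter)
    also have "\<dots> = letter i z \<cdot> r"
      using h x k t by (simp add: letter_mult_letter z_def)
    finally have eq: "inv\<^bsub>P\<^esub> (t \<cdot> letter i h) \<cdot> \<psi> a = letter i z \<cdot> r" .
    have "z = \<one>\<^bsub>\<Gamma> i\<^esub>"
    proof (rule ccontr)
      assume "z \<noteq> \<one>\<^bsub>\<Gamma> i\<^esub>"
      then have "(i, z) # r \<in> carrier P" using t z k by (auto simp: Cons_in_P)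
      then have "letter i z \<cdot> r \<in> half i" by (simp add: half_def flip: Cons_eq_mult)
      then show False using aA eq by simp
    qed
    then show ?thesis using eq k P.l_one by (simp add: one_P)
  qed
  then have "(\<lambda>a. inv\<^bsub>P\<^esub> (t \<cdot> letter i h) \<cdot> \<psi> a) ` missing (t \<cdot> letter i h) i \<subseteq> {r}" by blast
  moreover have "inj_on (\<lambda>a. inv\<^bsub>P\<^esub> (t \<cdot> letter i h) \<cdot> \<psi> a) (missing (t \<cdot> letter i h) i)"
    by (rule inj_on_subset[OF inj_left_translate]) (use t l in \<open>auto simp: missing_def\<close>)
  ultimately show "finite (missing (t \<cdot> letter i h) i)"
    by (meson finite.emptyI finite.insertI finite_imageD finite_subset)
qed

theorem conjugating_coset_unique:
  assumes "t \<in> carrier P" "i \<in> I"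
    and "\<And>a. a \<in> carrier A \<Longrightarrow> \<exists>x\<in>carrier (\<Gamma> i). \<psi> a = t \<cdot> letter i x \<cdot> inv\<^bsub>P\<^esub> t"
    and "s \<in> carrier P" "j \<in> I"
    and "\<And>a. a \<in> carrier A \<Longrightarrow> \<exists>x\<in>carrier (\<Gamma> j). \<psi> a = s \<cdot> letter j x \<cdot> inv\<^bsub>P\<^esub> s"
  shows "i = j \<and> inv\<^bsub>P\<^esub> t \<cdot> s \<in> letter i ` carrier (\<Gamma> i)"
  using assms by (intro sink_unique conjugate_sink)

text \<open>
  A vertex of the tree fixed by \<open>A\<close> is found as a sink. Half-spaces meet \<open>A\<close> in sets with finite
  boundary, and so, \<open>A\<close> being one-ended, each edge points to one of its sides. At a word vertex some edge points
  outwards since \<open>A\<close> is infinite and \<open>I\<close> is finite. If there were no sink, one could follow these edges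
  along an infinite ray. Along the ray the finite sets of elements left behind would exhaust \<open>A\<close>. But their
  sizes are bounded: the edge separates some \<open>g\<close> from some \<open>g s\<close> with a generator \<open>s\<close>, and after translation by the
  inverse of \<open>g\<close> there remain only finitely many such edges.
\<close>

theorem one_ended_conjugate_into_factor:
  assumes "one_ended_group A" and "finite I"
  shows "\<exists>t\<in>carrier P. \<exists>i\<in>I. \<forall>a\<in>carrier A.
    \<exists>x\<in>carrier (\<Gamma> i). \<psi> a = t \<cdot> letter i x \<cdot> inv\<^bsub>P\<^esub> t"
proof (rule ccontr)
  assume no: "\<not> ?thesis"
  have no_sink: "\<not> sink t i" for t i
    using no sink_conjugate by (metis sink_def)
  obtain S where gen: "finite_generating_set A S"
    and split: "\<And>B. B \<subseteq> carrier A \<Longrightarrow>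
       (\<And>s. s \<in> S \<Longrightarrow> finite {g \<in> carrier A. g \<in> B \<longleftrightarrow> g \<otimes>\<^bsub>A\<^esub> s \<notin> B}) \<Longrightarrow> finite B \<or> finite (carrier A - B)"
    using one_ended_group_splits_trivially[OF assms(1)] by blast
  have S: "finite S" "S \<subseteq> carrier A" "generate A S = carrier A"
    using gen by (auto simp: finite_generating_set_def)
  let ?S = "S \<union> m_inv A ` S"
  have S': "finite ?S" "?S \<subseteq> carrier A" using S by auto
  have bd: "finite {a \<in> carrier A. a \<in> missing t i \<and> a \<otimes>\<^bsub>A\<^esub> s \<notin> missing t i}"
    if "t \<in> carrier P" "s \<in> carrier A" for t s i
  proof (rule finite_imageD)
    show "inj_on (\<lambda>a. inv\<^bsub>P\<^esub> t \<cdot> \<psi> a) {a \<in> carrier A. a \<in> missing t i \<and> a \<otimes>\<^bsub>A\<^esub> s \<notin> missing t i}"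
      using that by (intro inj_on_subset[OF inj_left_translate]) auto
    have "(\<lambda>a. inv\<^bsub>P\<^esub> t \<cdot> \<psi> a) ` {a \<in> carrier A. a \<in> missing t i \<and> a \<otimes>\<^bsub>A\<^esub> s \<notin> missing t i}
       \<subseteq> {w \<in> carrier P. w \<notin> half i \<and> w \<cdot> \<psi> s \<in> half i}"
      using that by (auto simp: missing_def P.m_assoc)
    then show "finite ((\<lambda>a. inv\<^bsub>P\<^esub> t \<cdot> \<psi> a) ` {a \<in> carrier A. a \<in> missing t i \<and> a \<otimes>\<^bsub>A\<^esub> s \<notin> missing t i})"
      using finite_half_boundary[of "\<psi> s" i] that finite_subset by auto
  qed
  \<comment> \<open>One-endedness gives each edge a direction.\<close>
  have dichotomy: "finite (missing t i) \<or> finite (carrier A - missing t i)" if t: "t \<in> carrier P" for t i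
  proof (rule split)
    fix s assume "s \<in> S"
    then have s: "s \<in> carrier A" using S by auto
    let ?X = "{a \<in> carrier A. a \<in> missing t i \<and> a \<otimes>\<^bsub>A\<^esub> s \<notin> missing t i}"
    let ?Y = "{a \<in> carrier A. a \<in> missing t i \<and> a \<otimes>\<^bsub>A\<^esub> inv\<^bsub>A\<^esub> s \<notin> missing t i}"
    have "{g \<in> carrier A. g \<in> missing t i \<longleftrightarrow> g \<otimes>\<^bsub>A\<^esub> s \<notin> missing t i} \<subseteq> ?X \<union> (\<lambda>a. a \<otimes>\<^bsub>A\<^esub> inv\<^bsub>A\<^esub> s) ` ?Y"
    proof
      fix g assume g: "g \<in> {g \<in> carrier A. g \<in> missing t i \<longleftrightarrow> g \<otimes>\<^bsub>A\<^esub> s \<notin> missing t i}"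
      show "g \<in> ?X \<union> (\<lambda>a. a \<otimes>\<^bsub>A\<^esub> inv\<^bsub>A\<^esub> s) ` ?Y"
      proof (cases "g \<in> missing t i")
        case False
        have "g = (g \<otimes>\<^bsub>A\<^esub> s) \<otimes>\<^bsub>A\<^esub> inv\<^bsub>A\<^esub> s" using g s by (simp add: A.m_assoc)
        moreover then have "g \<otimes>\<^bsub>A\<^esub> s \<in> ?Y" using g s False by auto
        ultimately show ?thesis by blast
      qed (use g in auto)
    qed
    moreover have "finite (?X \<union> (\<lambda>a. a \<otimes>\<^bsub>A\<^esub> inv\<^bsub>A\<^esub> s) ` ?Y)" using bd[OF t s] bd[OF t, of "inv\<^bsub>A\<^esub> s"] s by simp
    ultimately show "finite {g \<in> carrier A. g \<in> missing t i \<longleftrightarrow> g \<otimes>\<^bsub>A\<^esub> s \<notin> missing t i}"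
      using finite_subset by blast
  qed (auto simp: missing_def)
  have direction: "\<exists>i\<in>I. finite (missing t i)" if t: "t \<in> carrier P" for t
  proof (rule ccontr)
    assume "\<not> ?thesis"
    then have "finite (\<Union>i\<in>I. carrier A - missing t i)" using dichotomy[OF t] assms(2) by blast
    moreover have "finite {a \<in> carrier A. inv\<^bsub>P\<^esub> t \<cdot> \<psi> a = []}"
    proof (rule finite_imageD)
      show "inj_on (\<lambda>a. inv\<^bsub>P\<^esub> t \<cdot> \<psi> a) {a \<in> carrier A. inv\<^bsub>P\<^esub> t \<cdot> \<psi> a = []}"
        using t by (intro inj_on_subset[OF inj_left_translate]) auto
      show "finite ((\<lambda>a. inv\<^bsub>P\<^esub> t \<cdot> \<psi> a) ` {a \<in> carrier A. inv\<^bsub>P\<^esub> t \<cdot> \<psi> a = []})"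
        by (rule finite_subset[of _ "{[]}"]) auto
    qed
    moreover have "carrier A \<subseteq> (\<Union>i\<in>I. carrier A - missing t i) \<union> {a \<in> carrier A. inv\<^bsub>P\<^esub> t \<cdot> \<psi> a = []}"
    proof
      fix a assume a: "a \<in> carrier A"
      have aP: "inv\<^bsub>P\<^esub> t \<cdot> \<psi> a \<in> carrier P" using a t by simp
      show "a \<in> (\<Union>i\<in>I. carrier A - missing t i) \<union> {a \<in> carrier A. inv\<^bsub>P\<^esub> t \<cdot> \<psi> a = []}"
      proof (cases "inv\<^bsub>P\<^esub> t \<cdot> \<psi> a")
        case (Cons p w)
        then have "fst p \<in> I" "inv\<^bsub>P\<^esub> t \<cdot> \<psi> a \<in> half (fst p)"
          using aP by (cases p; auto simp: Cons_in_P half_def)+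
        then show ?thesis using a by (auto simp: missing_def)
      qed (use a in auto)
    qed
    ultimately have "finite (carrier A)" by (meson finite_UnI finite_subset)
    then show False using infinite_A by contradiction
  qed
  have unique: "i = j" if "t \<in> carrier P" "finite (missing t i)" "finite (missing t j)" for t i j
  proof (rule ccontr)
    assume "i \<noteq> j"
    then have "carrier A \<subseteq> missing t i \<union> missing t j" by (auto simp: missing_def half_def)
    then have "finite (carrier A)" using that(2,3) by (meson finite_UnI finite_subset)
    then show False using infinite_A by contradiction
  qed
  \<comment> \<open>Without a sink, the edges that point outwards continue to words of any length.\<close>
  have path: "\<exists>t i. t \<in> carrier P \<and> length t = k \<and> i \<in> I \<and> (t = [] \<or> fst (last t) \<noteq> i) \<and> finite (missing t i)" for k
  proof (induction k)
    case 0
    then show ?case using direction[of "[]"] by auto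
  next
    case (Suc k)
    then obtain t i where t: "t \<in> carrier P" "length t = k" "i \<in> I" "t = [] \<or> fst (last t) \<noteq> i" "finite (missing t i)"
      by blast
    then obtain h where h: "h \<in> carrier (\<Gamma> i)" "infinite (missing (t \<cdot> letter i h) i)"
      using no_sink[of t i] by (auto simp: sink_def)
    have "h \<noteq> \<one>\<^bsub>\<Gamma> i\<^esub>" using h t by auto
    then have t': "t @ [(i, h)] \<in> carrier P" using t h by (simp add: snoc_in_P)
    then obtain j where j: "j \<in> I" "finite (missing (t @ [(i, h)]) j)" using direction by blast
    then have "j \<noteq> i" using h snoc_eq_mult[OF t'] by auto
    then show ?case using t' j t by (intro exI[of _ "t @ [(i, h)]"] exI[of _ j]) auto
  qed
  define D where "D = (\<Union>s\<in>?S. \<Union>i\<in>I. {w \<in> carrier P. w \<notin> half i \<and> w \<cdot> \<psi> s \<in> half i})"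
  have finD: "finite D" unfolding D_def using S' assms(2) finite_half_boundary by (intro finite_UN_I) auto
  define N where "N = Max ((\<lambda>(w, i). card {b \<in> carrier A. w \<cdot> \<psi> b \<notin> half i}) ` (D \<times> I))"
  \<comment> \<open>Up to translation by \<open>A\<close>, finitely many edges separate neighbouring elements of \<open>A\<close>.\<close>
  have bound: "card (missing t i) \<le> N"
    if t: "t \<in> carrier P" "i \<in> I" "finite (missing t i)" "\<one>\<^bsub>A\<^esub> \<in> missing t i" for t i
  proof -
    obtain a where a: "a \<in> carrier A" "a \<notin> missing t i"
      using t(3) infinite_A by (meson finite_subset subsetI)
    then obtain ws where ws: "set ws \<subseteq> ?S" "a = foldr (\<otimes>\<^bsub>A\<^esub>) ws \<one>\<^bsub>A\<^esub>"
      using A.generate_as_words[OF S(2)] S(3) by blast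
    have "\<exists>g\<in>missing t i. \<exists>s\<in>?S. g \<otimes>\<^bsub>A\<^esub> s \<notin> missing t i"
      if "set vs \<subseteq> ?S" "g \<in> missing t i" "g \<otimes>\<^bsub>A\<^esub> foldr (\<otimes>\<^bsub>A\<^esub>) vs \<one>\<^bsub>A\<^esub> \<notin> missing t i" for vs g
      using that
    proof (induction vs arbitrary: g)
      case Nil
      then show ?case by (auto simp: missing_def)
    next
      case (Cons s vs)
      have c: "g \<in> carrier A" "s \<in> carrier A" "set vs \<subseteq> carrier A"
        using Cons.prems S' by (auto simp: missing_def)
      have "g \<otimes>\<^bsub>A\<^esub> foldr (\<otimes>\<^bsub>A\<^esub>) (s # vs) \<one>\<^bsub>A\<^esub> = g \<otimes>\<^bsub>A\<^esub> s \<otimes>\<^bsub>A\<^esub> foldr (\<otimes>\<^bsub>A\<^esub>) vs \<one>\<^bsub>A\<^esub>"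
        using c A.foldr_mult_closed by (simp add: A.m_assoc)
      then show ?case using Cons.IH[of "g \<otimes>\<^bsub>A\<^esub> s"] Cons.prems by (cases "g \<otimes>\<^bsub>A\<^esub> s \<in> missing t i") auto
    qed
    from this[OF ws(1) t(4)] obtain g s where gs: "g \<in> missing t i" "s \<in> ?S" "g \<otimes>\<^bsub>A\<^esub> s \<notin> missing t i"
      using a ws A.l_one by metis
    have c: "g \<in> carrier A" "s \<in> carrier A" using gs S' by (auto simp: missing_def)
    define w where "w = inv\<^bsub>P\<^esub> t \<cdot> \<psi> g"
    have w: "w \<in> carrier P" using t c by (simp add: w_def)
    have "w \<in> D" unfolding D_def
      using gs c t by (intro UN_I[of s] UN_I[of i]) (auto simp: w_def missing_def P.m_assoc)
    then have le: "card {b \<in> carrier A. w \<cdot> \<psi> b \<notin> half i} \<le> N"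
      unfolding N_def using finD assms(2) t by (intro Max_ge) (auto intro: rev_image_eqI[of "(w, i)"])
    have "bij_betw (\<lambda>b. g \<otimes>\<^bsub>A\<^esub> b) {b \<in> carrier A. w \<cdot> \<psi> b \<notin> half i} (missing t i)"
    proof (rule bij_betwI[where g = "\<lambda>b. inv\<^bsub>A\<^esub> g \<otimes>\<^bsub>A\<^esub> b"])
      show "(\<lambda>b. g \<otimes>\<^bsub>A\<^esub> b) \<in> {b \<in> carrier A. w \<cdot> \<psi> b \<notin> half i} \<rightarrow> missing t i"
        using c t by (auto simp: missing_def w_def P.m_assoc)
      show "(\<lambda>b. inv\<^bsub>A\<^esub> g \<otimes>\<^bsub>A\<^esub> b) \<in> missing t i \<rightarrow> {b \<in> carrier A. w \<cdot> \<psi> b \<notin> half i}"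
      proof
        fix b assume b: "b \<in> missing t i"
        then have bA: "b \<in> carrier A" by (simp add: missing_def)
        have "\<psi> g \<cdot> \<psi> (inv\<^bsub>A\<^esub> g \<otimes>\<^bsub>A\<^esub> b) = \<psi> b"
          using c bA by (simp flip: P.m_assoc)
        then show "inv\<^bsub>A\<^esub> g \<otimes>\<^bsub>A\<^esub> b \<in> {b \<in> carrier A. w \<cdot> \<psi> b \<notin> half i}"
          using b bA c t by (simp add: missing_def w_def P.m_assoc del: \<psi>.hom_mult)
      qed
      show "inv\<^bsub>A\<^esub> g \<otimes>\<^bsub>A\<^esub> (g \<otimes>\<^bsub>A\<^esub> b) = b" if "b \<in> {b \<in> carrier A. w \<cdot> \<psi> b \<notin> half i}" for b
        using that c by (simp flip: A.m_assoc)
      show "g \<otimes>\<^bsub>A\<^esub> (inv\<^bsub>A\<^esub> g \<otimes>\<^bsub>A\<^esub> b) = b" if "b \<in> missing t i" for b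
        using that c by (simp add: missing_def flip: A.m_assoc)
    qed
    from bij_betw_same_card[OF this] le show ?thesis by simp
  qed
  obtain Y where Y: "Y \<subseteq> carrier A" "finite Y" "card Y = Suc N"
    using infinite_arbitrarily_large[OF infinite_A] by blast
  define k where "k = Max ((\<lambda>a. length (\<psi> a)) ` Y)"
  obtain t i where t: "t \<in> carrier P" "length t = k" "i \<in> I" "t = [] \<or> fst (last t) \<noteq> i" "finite (missing t i)"
    using path by blast
  \<comment> \<open>Words beyond an edge that starts at a word of length \<open>k\<close> are longer than \<open>k\<close>.\<close>
  have short: "a \<in> missing t i" if a: "a \<in> carrier A" "length (\<psi> a) \<le> k" for a
  proof (rule ccontr)
    assume "a \<notin> missing t i"
    then have v: "inv\<^bsub>P\<^esub> t \<cdot> \<psi> a \<in> half i" using a by (simp add: missing_def)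
    let ?v = "inv\<^bsub>P\<^esub> t \<cdot> \<psi> a"
    have "t @ ?v \<in> carrier P" using t v by (auto simp: append_in_P half_def)
    then have "t \<cdot> ?v = t @ ?v" by (rule mult_reduced)
    moreover have "t \<cdot> ?v = \<psi> a" using t a by (simp flip: P.m_assoc)
    ultimately have "length (\<psi> a) = k + length ?v" using t by (metis length_append)
    moreover have "?v \<noteq> []" using v by (simp add: half_def)
    ultimately show False using a by simp
  qed
  have "Y \<subseteq> missing t i"
  proof
    fix a assume "a \<in> Y"
    then have "length (\<psi> a) \<le> k" unfolding k_def using Y by auto
    then show "a \<in> missing t i" using short Y \<open>a \<in> Y\<close> by blast
  qed
  then have "Suc N \<le> card (missing t i)" using Y t card_mono by metis
  moreover have "\<one>\<^bsub>A\<^esub> \<in> missing t i" using short by (simp add: one_P)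
  ultimately show False using bound[of t i] t by simp
qed

end

section \<open>Isomorphism invariants from maximal subgroups\<close>

definition C_subgroups :: "'a monoid set \<Rightarrow> ('b, 'n) monoid_scheme \<Rightarrow> 'b set set" where
  "C_subgroups C M = {V. subgroup V M \<and> (\<exists>Q\<in>C. Q \<cong> M\<lparr>carrier := V\<rparr>)}"

text \<open>
  This notion refers to nothing but the group \<open>M\<close>. For a finite-index subgroup of a free product of members of \<open>C\<close> it
  recovers the vertex groups, see \<open>maximal_C_subgroups_eq\<close> below.
\<close>

definition maximal_C_subgroups :: "'a monoid set \<Rightarrow> ('b, 'n) monoid_scheme \<Rightarrow> 'b set set" where
  "maximal_C_subgroups C M = {V \<in> C_subgroups C M. \<forall>W\<in>C_subgroups C M. V \<subseteq> W \<longrightarrow> V = W}"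

definition conjugate :: "('b, 'n) monoid_scheme \<Rightarrow> 'b \<Rightarrow> 'b set \<Rightarrow> 'b set" where
  "conjugate M k V = (\<lambda>x. k \<otimes>\<^bsub>M\<^esub> x \<otimes>\<^bsub>M\<^esub> inv\<^bsub>M\<^esub> k) ` V"

text \<open>
  Homomorphisms \<open>f\<close> to the group of two elements (\<^typ>\<open>bool\<close> with inequality as addition), with a function \<open>v\<close> on the maximal
  subgroups that \<open>f\<close> twists under conjugation. Such an \<open>f\<close> vanishes on each of these
  subgroups, which are fixed by their own conjugations. The homomorphisms \<open>f\<close> alone would measure a rank that depends
  on the number of conjugacy classes of vertex groups. The choices for \<open>v\<close> compensate for this number, and the
  number of pairs depends only on the index of \<open>M\<close> and the number of factors, see \<open>card_colourings\<close>.
\<close>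

definition colourings :: "'a monoid set \<Rightarrow> ('b, 'n) monoid_scheme \<Rightarrow> (('b \<Rightarrow> bool) \<times> ('b set \<Rightarrow> bool)) set" where
  "colourings C M = {(f, v). f \<in> carrier M \<rightarrow>\<^sub>E UNIV \<and> v \<in> maximal_C_subgroups C M \<rightarrow>\<^sub>E UNIV \<and>
     (\<forall>x\<in>carrier M. \<forall>y\<in>carrier M. f (x \<otimes>\<^bsub>M\<^esub> y) = (f x \<noteq> f y)) \<and>
     (\<forall>k\<in>carrier M. \<forall>V\<in>maximal_C_subgroups C M. v (conjugate M k V) = (f k \<noteq> v V))}"

definition conjugacy_class :: "('b, 'n) monoid_scheme \<Rightarrow> 'b set \<Rightarrow> 'b set set" where
  "conjugacy_class M V = (\<lambda>k. conjugate M k V) ` carrier M"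

text \<open>
  If \<open>c\<close> is a conjugacy class, then the chosen member of \<open>C\<close> is determined up to isomorphism, and this
  determines the value of an invariant \<open>\<rho>\<close>.
\<close>

definition class_weight :: "'a monoid set \<Rightarrow> ('a monoid \<Rightarrow> real) \<Rightarrow> ('b, 'n) monoid_scheme \<Rightarrow> 'b set set \<Rightarrow> real" where
  "class_weight C \<rho> M c = \<bar>\<rho> (SOME Q. Q \<in> C \<and> (\<exists>V\<in>c. Q \<cong> M\<lparr>carrier := V\<rparr>))\<bar>"

definition total_weight :: "'a monoid set \<Rightarrow> ('a monoid \<Rightarrow> real) \<Rightarrow> ('b, 'n) monoid_scheme \<Rightarrow> real" where
  "total_weight C \<rho> M = (\<Sum>c\<in>conjugacy_class M ` maximal_C_subgroups C M. class_weight C \<rho> M c)"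

lemma C_subgroups_subset: "V \<in> C_subgroups C M \<Longrightarrow> V \<subseteq> carrier M"
  by (auto simp: C_subgroups_def dest: subgroup.subset)

lemma maximal_C_subgroups_subset: "V \<in> maximal_C_subgroups C M \<Longrightarrow> V \<subseteq> carrier M"
  by (auto simp: maximal_C_subgroups_def dest: C_subgroups_subset)

lemma iso_restrict_subgroup:
  assumes "\<phi> \<in> iso M N" "V \<subseteq> carrier M"
  shows "M\<lparr>carrier := V\<rparr> \<cong> N\<lparr>carrier := \<phi> ` V\<rparr>"
proof -
  have "\<phi> \<in> iso (M\<lparr>carrier := V\<rparr>) (N\<lparr>carrier := \<phi> ` V\<rparr>)"
    using assms by (auto simp: iso_iff hom_def subset_iff intro: inj_on_subset)
  then show ?thesis by (auto simp: is_iso_def)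
qed

lemma (in group) conjugation_iso:
  assumes k: "k \<in> carrier G"
  shows "(\<lambda>x. k \<otimes> x \<otimes> inv k) \<in> iso G G"
proof -
  have "y \<in> (\<lambda>x. k \<otimes> x \<otimes> inv k) ` carrier G" if y: "y \<in> carrier G" for y
  proof
    show "y = k \<otimes> (inv k \<otimes> y \<otimes> k) \<otimes> inv k"
      using k y by (simp add: m_assoc) (simp flip: m_assoc)
  qed (use k y in simp)
  then have "(\<lambda>x. k \<otimes> x \<otimes> inv k) ` carrier G = carrier G" using k by auto
  moreover have "(\<lambda>x. k \<otimes> x \<otimes> inv k) \<in> hom G G"
  proof (rule homI)
    fix x y assume xy: "x \<in> carrier G" "y \<in> carrier G"
    have "inv k \<otimes> (k \<otimes> z) = z" if "z \<in> carrier G" for z using k that by (simp flip: m_assoc)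
    then show "k \<otimes> (x \<otimes> y) \<otimes> inv k = k \<otimes> x \<otimes> inv k \<otimes> (k \<otimes> y \<otimes> inv k)"
      using xy k by (simp add: m_assoc)
  qed (use k in simp)
  moreover have "inj_on (\<lambda>x. k \<otimes> x \<otimes> inv k) (carrier G)" using k by (auto simp: inj_on_def)
  ultimately show ?thesis by (simp add: iso_iff)
qed

locale group_isomorphism = M: group M + N: group N
  for M :: "('b, 'm) monoid_scheme" and N :: "('c, 'n) monoid_scheme" +
  fixes \<phi> assumes iso: "\<phi> \<in> iso M N"
begin

sublocale \<phi>: group_hom M N \<phi>
  by unfold_locales (use iso in \<open>simp add: iso_iff\<close>)

definition \<phi>' where "\<phi>' = inv_into (carrier M) \<phi>"

lemma \<phi>'_iso: "\<phi>' \<in> iso N M"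
  unfolding \<phi>'_def using M.iso_set_sym iso .

lemma \<phi>_inj: "inj_on \<phi> (carrier M)" and \<phi>_surj: "\<phi> ` carrier M = carrier N"
  using iso by (auto simp: iso_iff)

lemma \<phi>'_\<phi>: "x \<in> carrier M \<Longrightarrow> \<phi>' (\<phi> x) = x"
  unfolding \<phi>'_def by (simp add: inv_into_f_f \<phi>_inj)

lemma \<phi>_\<phi>': "y \<in> carrier N \<Longrightarrow> \<phi> (\<phi>' y) = y"
  unfolding \<phi>'_def by (simp add: f_inv_into_f \<phi>_surj)

lemma image_\<phi>'_\<phi>: "V \<subseteq> carrier M \<Longrightarrow> \<phi>' ` \<phi> ` V = V"
  by (force simp: image_iff \<phi>'_\<phi> subset_iff)

lemma image_\<phi>_\<phi>': "W \<subseteq> carrier N \<Longrightarrow> \<phi> ` \<phi>' ` W = W"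
  by (force simp: image_iff \<phi>_\<phi>' subset_iff)

lemma C_subgroups_image:
  assumes "V \<in> C_subgroups C M"
  shows "\<phi> ` V \<in> C_subgroups C N"
proof -
  obtain Q where "subgroup V M" "Q \<in> C" "Q \<cong> M\<lparr>carrier := V\<rparr>"
    using assms by (auto simp: C_subgroups_def)
  moreover have "M\<lparr>carrier := V\<rparr> \<cong> N\<lparr>carrier := \<phi> ` V\<rparr>"
    using iso_restrict_subgroup[OF iso] C_subgroups_subset[OF assms] .
  ultimately show ?thesis
    using \<phi>.subgroup_img_is_subgroup iso_trans unfolding C_subgroups_def by blast
qed

lemma conjugate_image:
  assumes "k \<in> carrier M" "V \<subseteq> carrier M"
  shows "\<phi> ` conjugate M k V = conjugate N (\<phi> k) (\<phi> ` V)"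
  using assms by (auto simp: conjugate_def image_image subset_iff intro!: image_cong)

end

context group_isomorphism
begin

interpretation inverse_iso: group_isomorphism N M \<phi>'
  by unfold_locales (rule \<phi>'_iso)

lemma maximal_C_subgroups_image:
  assumes V: "V \<in> maximal_C_subgroups C M"
  shows "\<phi> ` V \<in> maximal_C_subgroups C N"
proof -
  have "\<phi> ` V = W" if W: "W \<in> C_subgroups C N" "\<phi> ` V \<subseteq> W" for W
  proof -
    have "V \<subseteq> \<phi>' ` W"
      using image_\<phi>'_\<phi>[OF maximal_C_subgroups_subset[OF V]] W by blast
    then have "V = \<phi>' ` W"
      using V inverse_iso.C_subgroups_image[OF W(1)] by (auto simp: maximal_C_subgroups_def)
    then show ?thesis using image_\<phi>_\<phi>' C_subgroups_subset[OF W(1)] by simp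
  qed
  then show ?thesis using V C_subgroups_image by (auto simp: maximal_C_subgroups_def)
qed

lemma maximal_C_subgroups_eq_image:
  "maximal_C_subgroups C N = (`) \<phi> ` maximal_C_subgroups C M"
proof (intro equalityI subsetI)
  fix W assume W: "W \<in> maximal_C_subgroups C N"
  have "group_isomorphism N M \<phi>'" by unfold_locales
  then have "\<phi>' ` W \<in> maximal_C_subgroups C M"
    using group_isomorphism.maximal_C_subgroups_image W by blast
  moreover have "W = \<phi> ` \<phi>' ` W" using image_\<phi>_\<phi>' maximal_C_subgroups_subset[OF W] by blast
  ultimately show "W \<in> (`) \<phi> ` maximal_C_subgroups C M" by blast
qed (use maximal_C_subgroups_image in blast)

lemma conjugate_closed:
  assumes V: "V \<in> maximal_C_subgroups C M" and k: "k \<in> carrier M"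
  shows "conjugate M k V \<in> maximal_C_subgroups C M"
proof -
  have "(\<lambda>x. k \<otimes>\<^bsub>M\<^esub> x \<otimes>\<^bsub>M\<^esub> inv\<^bsub>M\<^esub> k) \<in> iso M M" using M.conjugation_iso[OF k] .
  then have "group_isomorphism M M (\<lambda>x. k \<otimes>\<^bsub>M\<^esub> x \<otimes>\<^bsub>M\<^esub> inv\<^bsub>M\<^esub> k)"
    by unfold_locales
  then show ?thesis
    using group_isomorphism.maximal_C_subgroups_image V unfolding conjugate_def by blast
qed

text \<open>
  Colourings are pulled back along \<open>\<phi>\<close>, and this is injective. The opposite inequality will come from the
  inverse isomorphism.
\<close>

lemma card_colourings_le:
  assumes "finite (colourings C M)"
  shows "card (colourings C N) \<le> card (colourings C M)"
proof -
  let ?V = "maximal_C_subgroups C M" and ?W = "maximal_C_subgroups C N"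
  let ?pull = "\<lambda>(f, v). (restrict (f \<circ> \<phi>) (carrier M), restrict (v \<circ> (`) \<phi>) ?V)"
  have "inj_on ?pull (colourings C N)"
  proof (rule inj_onI, clarify, intro conjI)
    fix f v f' v'
    assume A: "(f, v) \<in> colourings C N" "(f', v') \<in> colourings C N"
      and eq: "restrict (f \<circ> \<phi>) (carrier M) = restrict (f' \<circ> \<phi>) (carrier M)"
        "restrict (v \<circ> (`) \<phi>) ?V = restrict (v' \<circ> (`) \<phi>) ?V"
    have ext: "f \<in> carrier N \<rightarrow>\<^sub>E UNIV" "f' \<in> carrier N \<rightarrow>\<^sub>E UNIV" "v \<in> ?W \<rightarrow>\<^sub>E UNIV" "v' \<in> ?W \<rightarrow>\<^sub>E UNIV"
      using A by (auto simp: colourings_def)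
    show "f = f'"
    proof (rule PiE_ext[OF ext(1,2)])
      fix y assume "y \<in> carrier N"
      then obtain x where "x \<in> carrier M" "y = \<phi> x" using \<phi>_surj by blast
      then show "f y = f' y" using fun_cong[OF eq(1), of x] by simp
    qed
    show "v = v'"
    proof (rule PiE_ext[OF ext(3,4)])
      fix W assume "W \<in> ?W"
      then obtain V where "V \<in> ?V" "W = \<phi> ` V" unfolding maximal_C_subgroups_eq_image by blast
      then show "v W = v' W" using fun_cong[OF eq(2), of V] by simp
    qed
  qed
  moreover have "?pull ` colourings C N \<subseteq> colourings C M"
  proof clarify
    fix f v assume "(f, v) \<in> colourings C N"
    then have fv: "\<And>x y. x \<in> carrier N \<Longrightarrow> y \<in> carrier N \<Longrightarrow> f (x \<otimes>\<^bsub>N\<^esub> y) = (f x \<noteq> f y)"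
      "\<And>k W. k \<in> carrier N \<Longrightarrow> W \<in> ?W \<Longrightarrow> v (conjugate N k W) = (f k \<noteq> v W)"
      by (auto simp: colourings_def)
    have "v (\<phi> ` conjugate M k V) = (f (\<phi> k) \<noteq> v (\<phi> ` V))" if "k \<in> carrier M" "V \<in> ?V" for k V
      using that fv(2)[of "\<phi> k" "\<phi> ` V"] maximal_C_subgroups_image[OF that(2)]
        conjugate_image[OF that(1) maximal_C_subgroups_subset[OF that(2)]] by simp
    then show "(restrict (f \<circ> \<phi>) (carrier M), restrict (v \<circ> (`) \<phi>) ?V) \<in> colourings C M"
      using fv(1) by (simp add: colourings_def conjugate_closed)
  qed
  ultimately show ?thesis using assms card_inj_on_le by blast
qed

lemma class_image:
  assumes "V \<in> maximal_C_subgroups C M"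
  shows "(`) \<phi> ` conjugacy_class M V = conjugacy_class N (\<phi> ` V)"
proof -
  have "conjugate N (\<phi> k) (\<phi> ` V) = \<phi> ` conjugate M k V" if "k \<in> carrier M" for k
    using that conjugate_image maximal_C_subgroups_subset[OF assms] by blast
  then show ?thesis unfolding conjugacy_class_def \<phi>_surj[symmetric]
    by (auto simp: image_image)
qed

lemma class_subset:
  assumes "V \<in> maximal_C_subgroups C M" "W \<in> conjugacy_class M V"
  shows "W \<subseteq> carrier M"
  using assms conjugate_closed maximal_C_subgroups_subset unfolding conjugacy_class_def by blast

lemma total_weight_iso: "total_weight C \<rho> M = total_weight C \<rho> N"
proof -
  let ?V = "maximal_C_subgroups C M"
  have im: "(`) ((`) \<phi>) ` conjugacy_class M ` ?V = conjugacy_class N ` maximal_C_subgroups C N"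
    unfolding maximal_C_subgroups_eq_image image_image by (intro image_cong refl class_image)
  have inj: "inj_on ((`) ((`) \<phi>)) (conjugacy_class M ` ?V)"
  proof (rule inj_on_inverseI[where g = "(`) ((`) \<phi>')"])
    fix c assume "c \<in> conjugacy_class M ` ?V"
    then obtain V where V: "V \<in> ?V" "c = conjugacy_class M V" by (rule imageE)
    have "\<phi>' ` \<phi> ` W = W" if "W \<in> c" for W
      using that class_subset[OF V(1)] V(2) by (intro image_\<phi>'_\<phi>) simp
    then show "(`) \<phi>' ` (`) \<phi> ` c = c" by (simp add: image_image)
  qed
  have "class_weight C \<rho> N ((`) \<phi> ` c) = class_weight C \<rho> M c" if c: "c \<in> conjugacy_class M ` ?V" for c
  proof -
    have "Q \<cong> M\<lparr>carrier := V\<rparr> \<longleftrightarrow> Q \<cong> N\<lparr>carrier := \<phi> ` V\<rparr>" if "V \<in> c" for Q :: "'a monoid" and V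
    proof -
      obtain V0 where V0: "V0 \<in> ?V" "c = conjugacy_class M V0" using c by (rule imageE)
      have V: "V \<subseteq> carrier M" using that class_subset[OF V0(1)] V0(2) by simp
      have MN: "M\<lparr>carrier := V\<rparr> \<cong> N\<lparr>carrier := \<phi> ` V\<rparr>" using iso_restrict_subgroup[OF iso V] .
      have NM: "N\<lparr>carrier := \<phi> ` V\<rparr> \<cong> M\<lparr>carrier := V\<rparr>"
        using iso_restrict_subgroup[OF \<phi>'_iso, of "\<phi> ` V"] image_mono[OF V, of \<phi>] image_\<phi>'_\<phi>[OF V]
        by (simp add: \<phi>_surj)
      show ?thesis by (rule iffI) (erule iso_trans[OF _ MN], erule iso_trans[OF _ NM])
    qed
    then show ?thesis unfolding class_weight_def by (simp cong: conj_cong)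
  qed
  then show ?thesis unfolding total_weight_def im[symmetric] using inj by (simp add: sum.reindex)
qed

end

section \<open>Finite-index subgroups of free products\<close>

lemma card_image_same_kernel:
  assumes "\<And>x y. x \<in> A \<Longrightarrow> y \<in> A \<Longrightarrow> f x = f y \<longleftrightarrow> g x = g y"
  shows "card (f ` A) = card (g ` A)" and "finite (f ` A) \<longleftrightarrow> finite (g ` A)"
proof -
  have "bij_betw (\<lambda>z. g (inv_into A f z)) (f ` A) (g ` A)"
  proof (rule bij_betwI')
    fix x y assume "x \<in> f ` A" "y \<in> f ` A"
    then show "g (inv_into A f x) = g (inv_into A f y) \<longleftrightarrow> x = y"
      using assms[of "inv_into A f x" "inv_into A f y"] by (auto simp: inv_into_into f_inv_into_f)
  next
    fix y assume "y \<in> g ` A"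
    then obtain a where a: "a \<in> A" "y = g a" by blast
    then have "g (inv_into A f (f a)) = y"
      using assms[of "inv_into A f (f a)" a] by (simp add: inv_into_into f_inv_into_f)
    then show "\<exists>x\<in>f ` A. y = g (inv_into A f x)" using a by blast
  qed (simp add: inv_into_into)
  then show "card (f ` A) = card (g ` A)" "finite (f ` A) \<longleftrightarrow> finite (g ` A)"
    by (simp_all add: bij_betw_same_card bij_betw_finite)
qed

lemma (in group) r_coset_eq_iff:
  assumes "subgroup H G" "x \<in> carrier G" "y \<in> carrier G"
  shows "H #> x = H #> y \<longleftrightarrow> x \<otimes> inv y \<in> H"
proof -
  have "x \<in> H #> y \<longleftrightarrow> x \<otimes> inv y \<in> H"
    using subgroup.rcos_module[OF assms(1) is_group assms(3,2)] .
  then show ?thesis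
    using rcos_self[OF assms(2,1)] repr_independence[of x H y] assms by auto
qed

locale finite_index_in_free_product =
  free_product_of_groups I \<Gamma> for I :: "'i set" and \<Gamma> :: "'i \<Rightarrow> 'a monoid" +
  fixes C :: "'a monoid set" and K :: "('i \<times> 'a) list set"
  assumes finite_I: "finite I"
    and K: "finite_index_subgroup K (free_product I \<Gamma>)"
    and C_one_ended: "\<And>Q. Q \<in> C \<Longrightarrow> one_ended_group Q"
    and C_closed: "finite_index_closed C"
    and factor_in_C: "\<And>i. i \<in> I \<Longrightarrow> \<Gamma> i \<in> C"
begin

abbreviation M where "M \<equiv> P\<lparr>carrier := K\<rparr>"
abbreviation X where "X \<equiv> rcosets\<^bsub>P\<^esub> K"

lemma K_subgroup: "subgroup K P" and finite_X: "finite X"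
  using K by (auto simp: finite_index_subgroup_def)

lemma K_in_P: "k \<in> K \<Longrightarrow> k \<in> carrier P"
  using subgroup.mem_carrier[OF K_subgroup] .

sublocale M: group M
  using subgroup.subgroup_is_group[OF K_subgroup group_P] .

lemma inv_M: "k \<in> K \<Longrightarrow> inv\<^bsub>M\<^esub> k = inv\<^bsub>P\<^esub> k"
  using P.m_inv_consistent[OF K_subgroup] by simp

text \<open>
  \<open>vertex g i\<close> is the intersection of \<open>K\<close> with the conjugate of the factor \<open>i\<close> by \<open>g\<close>, the stabiliser in \<open>K\<close> of the
  coset vertex \<open>g \<cdot> \<Gamma> i\<close> of the tree. Its copy \<open>stab g i\<close> inside the factor is the stabiliser of the
  coset of \<open>g\<close> for the action of \<open>\<Gamma> i\<close> on the cosets of \<open>K\<close> from the right.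
\<close>

definition conj_letter where
  "conj_letter g i x = g \<cdot> letter i x \<cdot> inv\<^bsub>P\<^esub> g"

definition stab where
  "stab g i = {x \<in> carrier (\<Gamma> i). conj_letter g i x \<in> K}"

definition vertex where
  "vertex g i = conj_letter g i ` stab g i"

lemma conj_letter_closed:
  "g \<in> carrier P \<Longrightarrow> i \<in> I \<Longrightarrow> x \<in> carrier (\<Gamma> i) \<Longrightarrow> conj_letter g i x \<in> carrier P"
  by (simp add: conj_letter_def letter_in_P)

lemma conj_letter_hom:
  assumes "g \<in> carrier P" "i \<in> I"
  shows "group_hom (\<Gamma> i) P (conj_letter g i)"
proof -
  have "conj_letter g i (x \<otimes>\<^bsub>\<Gamma> i\<^esub> y) = conj_letter g i x \<cdot> conj_letter g i y"
    if "x \<in> carrier (\<Gamma> i)" "y \<in> carrier (\<Gamma> i)" for x y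
  proof -
    have l: "letter i x \<in> carrier P" "letter i y \<in> carrier P" using assms that letter_in_P by auto
    have c: "inv\<^bsub>P\<^esub> g \<cdot> (g \<cdot> z) = z" if "z \<in> carrier P" for z using assms that by (simp flip: P.m_assoc)
    show ?thesis
      using assms that l c by (simp add: conj_letter_def P.m_assoc flip: letter_mult_letter)
  qed
  then show ?thesis
    using assms factor_group group_P conj_letter_closed
    by (simp add: group_hom_def group_hom_axioms_def hom_def)
qed

lemma conj_letter_inj:
  assumes "g \<in> carrier P" "i \<in> I"
  shows "inj_on (conj_letter g i) (carrier (\<Gamma> i))"
proof (rule inj_onI)
  fix x y assume xy: "x \<in> carrier (\<Gamma> i)" "y \<in> carrier (\<Gamma> i)" "conj_letter g i x = conj_letter g i y"
  then have "letter i x = letter i y" using assms letter_in_P by (simp add: conj_letter_def)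
  then show "x = y" using inj_onD[OF letter_inj] xy by metis
qed

lemma stab_subgroup:
  assumes "g \<in> carrier P" "i \<in> I"
  shows "subgroup (stab g i) (\<Gamma> i)"
proof -
  interpret h: group_hom "\<Gamma> i" P "conj_letter g i" using conj_letter_hom assms .
  interpret K: subgroup K P by (rule K_subgroup)
  show ?thesis
    by (rule h.subgroupI) (auto simp: stab_def intro: exI[of _ "\<one>\<^bsub>\<Gamma> i\<^esub>"])
qed

definition orbit where
  "orbit g i = (\<lambda>x. K #>\<^bsub>P\<^esub> (g \<cdot> letter i x)) ` carrier (\<Gamma> i)"

lemma orbit_subset: "g \<in> carrier P \<Longrightarrow> i \<in> I \<Longrightarrow> orbit g i \<subseteq> X"
  unfolding orbit_def using letter_in_P P.rcosetsI[OF subgroup.subset[OF K_subgroup]] by auto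

text \<open>
  The orbit-stabiliser theorem for this action.
\<close>

lemma stab_index:
  assumes g: "g \<in> carrier P" "i \<in> I"
  shows "finite_index_subgroup (stab g i) (\<Gamma> i)" and "subgroup_index (\<Gamma> i) (stab g i) = card (orbit g i)"
proof -
  interpret h: group_hom "\<Gamma> i" P "conj_letter g i" using conj_letter_hom assms .
  have ker: "stab g i #>\<^bsub>\<Gamma> i\<^esub> x = stab g i #>\<^bsub>\<Gamma> i\<^esub> y \<longleftrightarrow>
     K #>\<^bsub>P\<^esub> (g \<cdot> letter i x) = K #>\<^bsub>P\<^esub> (g \<cdot> letter i y)"
    if xy: "x \<in> carrier (\<Gamma> i)" "y \<in> carrier (\<Gamma> i)" for x y
  proof -
    have l: "letter i x \<in> carrier P" "letter i y \<in> carrier P" "letter i (inv\<^bsub>\<Gamma> i\<^esub> y) \<in> carrier P"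
      using g xy letter_in_P by auto
    have "conj_letter g i (x \<otimes>\<^bsub>\<Gamma> i\<^esub> inv\<^bsub>\<Gamma> i\<^esub> y) = (g \<cdot> letter i x) \<cdot> inv\<^bsub>P\<^esub> (g \<cdot> letter i y)"
      using g xy l by (simp add: conj_letter_def P.inv_mult_group P.m_assoc inv_letter flip: letter_mult_letter)
    then show ?thesis
      using g xy l h.r_coset_eq_iff[OF stab_subgroup[OF g]] P.r_coset_eq_iff[OF K_subgroup] by (simp add: stab_def)
  qed
  have "rcosets\<^bsub>\<Gamma> i\<^esub> (stab g i) = (\<lambda>x. stab g i #>\<^bsub>\<Gamma> i\<^esub> x) ` carrier (\<Gamma> i)"
    by (auto simp: RCOSETS_def)
  moreover have "finite (orbit g i)" using orbit_subset[OF g] finite_X finite_subset by blast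
  ultimately show "finite_index_subgroup (stab g i) (\<Gamma> i)" "subgroup_index (\<Gamma> i) (stab g i) = card (orbit g i)"
    using card_image_same_kernel[of "carrier (\<Gamma> i)", OF ker] stab_subgroup[OF g]
    by (simp_all add: finite_index_subgroup_def subgroup_index_def orbit_def)
qed

lemma stab_in_C:
  "g \<in> carrier P \<Longrightarrow> i \<in> I \<Longrightarrow> (\<Gamma> i)\<lparr>carrier := stab g i\<rparr> \<in> C"
  using stab_index(1) C_closed factor_in_C unfolding finite_index_closed_def by blast

lemma infinite_C: "Q \<in> C \<Longrightarrow> infinite (carrier Q)"
  using one_ended_group_splits_trivially C_one_ended by metis

lemma vertex_iso:
  assumes "g \<in> carrier P" "i \<in> I"
  shows "(\<Gamma> i)\<lparr>carrier := stab g i\<rparr> \<cong> M\<lparr>carrier := vertex g i\<rparr>"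
proof -
  interpret h: group_hom "\<Gamma> i" P "conj_letter g i" using conj_letter_hom assms .
  have "conj_letter g i \<in> iso ((\<Gamma> i)\<lparr>carrier := stab g i\<rparr>) (M\<lparr>carrier := vertex g i\<rparr>)"
    using inj_on_subset[OF conj_letter_inj[OF assms], of "stab g i"]
    by (auto simp: iso_iff hom_def vertex_def stab_def)
  then show ?thesis by (auto simp: is_iso_def)
qed

lemma vertex_C_subgroup:
  assumes "g \<in> carrier P" "i \<in> I"
  shows "vertex g i \<in> C_subgroups C M"
proof -
  interpret h: group_hom "\<Gamma> i" P "conj_letter g i" using conj_letter_hom assms .
  have "subgroup (vertex g i) P"
    unfolding vertex_def using h.subgroup_img_is_subgroup stab_subgroup[OF assms] by blast
  then have "subgroup (vertex g i) M"
    by (intro P.subgroup_incl K_subgroup) (auto simp: vertex_def stab_def)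
  moreover have "\<exists>Q\<in>C. Q \<cong> M\<lparr>carrier := vertex g i\<rparr>"
    using vertex_iso[OF assms] stab_in_C[OF assms] by (rule bexI)
  ultimately show ?thesis by (simp add: C_subgroups_def)
qed

text \<open>
  Members of \<open>C\<close> are one-ended, and hence their copies in the free product are conjugate into a factor.
\<close>

lemma C_subgroup_in_vertex:
  assumes "W \<in> C_subgroups C M"
  shows "\<exists>t\<in>carrier P. \<exists>j\<in>I. W \<subseteq> vertex t j"
proof -
  obtain Q \<eta> where Q: "subgroup W M" "Q \<in> C" "\<eta> \<in> iso Q (M\<lparr>carrier := W\<rparr>)"
    using assms by (auto simp: C_subgroups_def is_iso_def)
  have WK: "W \<subseteq> K" using subgroup.subset[OF Q(1)] by simp
  have oe: "one_ended_group Q" using C_one_ended Q by blast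
  have \<eta>: "\<eta> \<in> hom Q P" "inj_on \<eta> (carrier Q)" "\<eta> ` carrier Q = W"
    using Q(3) WK K_in_P by (auto simp: iso_iff hom_def)
  interpret infinite_group_in_free_product I \<Gamma> Q \<eta>
    using oe \<eta> infinite_C[OF Q(2)]
    by (simp add: infinite_group_in_free_product_def infinite_group_in_free_product_axioms_def
        one_ended_group_def free_product_of_groups_axioms)
  obtain t j where t: "t \<in> carrier P" "j \<in> I"
    "\<And>a. a \<in> carrier Q \<Longrightarrow> \<exists>x\<in>carrier (\<Gamma> j). \<eta> a = t \<cdot> letter j x \<cdot> inv\<^bsub>P\<^esub> t"
    using one_ended_conjugate_into_factor[OF oe finite_I] by blast
  have "W \<subseteq> vertex t j"
  proof
    fix w assume w: "w \<in> W"
    then obtain x where "x \<in> carrier (\<Gamma> j)" "w = conj_letter t j x"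
      using t(3) \<eta>(3) by (auto simp: conj_letter_def)
    then show "w \<in> vertex t j" using w WK by (auto simp: vertex_def stab_def)
  qed
  then show ?thesis using t by blast
qed

text \<open>
  Vertex groups are infinite, being isomorphic to members of \<open>C\<close>, and an infinite subgroup fixes at most one
  coset vertex.
\<close>

lemma vertex_subset_unique:
  assumes g: "g \<in> carrier P" "i \<in> I" and t: "t \<in> carrier P" "j \<in> I"
    and sub: "vertex g i \<subseteq> vertex t j"
  shows "i = j \<and> inv\<^bsub>P\<^esub> g \<cdot> t \<in> letter i ` carrier (\<Gamma> i)"
proof -
  let ?A = "(\<Gamma> i)\<lparr>carrier := stab g i\<rparr>"
  interpret h: group_hom "\<Gamma> i" P "conj_letter g i" using conj_letter_hom g .
  have "group ?A" using subgroup.subgroup_is_group[OF stab_subgroup[OF g] factor_group[OF g(2)]] .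
  moreover have "conj_letter g i \<in> hom ?A P"
    by (auto simp: hom_def stab_def)
  moreover have "inj_on (conj_letter g i) (carrier ?A)"
    using inj_on_subset[OF conj_letter_inj[OF g], of "stab g i"] by (auto simp: stab_def)
  ultimately interpret infinite_group_in_free_product I \<Gamma> ?A "conj_letter g i"
    using infinite_C[OF stab_in_C[OF g]]
    by (simp add: infinite_group_in_free_product_def infinite_group_in_free_product_axioms_def
        free_product_of_groups_axioms)
  show ?thesis
  proof (rule conjugating_coset_unique[OF g _ t])
    fix a assume a: "a \<in> carrier ?A"
    then show "\<exists>x\<in>carrier (\<Gamma> i). conj_letter g i a = g \<cdot> letter i x \<cdot> inv\<^bsub>P\<^esub> g"
      by (auto simp: stab_def conj_letter_def)
    show "\<exists>x\<in>carrier (\<Gamma> j). conj_letter g i a = t \<cdot> letter j x \<cdot> inv\<^bsub>P\<^esub> t"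
      using a sub by (force simp: vertex_def stab_def conj_letter_def)
  qed
qed

lemma vertex_altdef: "vertex g i = K \<inter> conj_letter g i ` carrier (\<Gamma> i)"
  by (auto simp: vertex_def stab_def)

lemma vertex_mult_letter:
  assumes g: "g \<in> carrier P" "i \<in> I" and s: "s \<in> carrier (\<Gamma> i)"
  shows "vertex (g \<cdot> letter i s) i = vertex g i"
proof -
  interpret i: group "\<Gamma> i" using factor_group g by blast
  have eq: "conj_letter (g \<cdot> letter i s) i x = conj_letter g i (s \<otimes>\<^bsub>\<Gamma> i\<^esub> x \<otimes>\<^bsub>\<Gamma> i\<^esub> inv\<^bsub>\<Gamma> i\<^esub> s)"
    if "x \<in> carrier (\<Gamma> i)" for x
  proof -
    have "letter i s \<in> carrier P" "letter i x \<in> carrier P" "letter i (inv\<^bsub>\<Gamma> i\<^esub> s) \<in> carrier P"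
      using g s that letter_in_P by auto
    then show ?thesis using g s that
      by (simp add: conj_letter_def P.inv_mult_group P.m_assoc inv_letter flip: letter_mult_letter)
  qed
  have "(\<lambda>x. s \<otimes>\<^bsub>\<Gamma> i\<^esub> x \<otimes>\<^bsub>\<Gamma> i\<^esub> inv\<^bsub>\<Gamma> i\<^esub> s) ` carrier (\<Gamma> i) = carrier (\<Gamma> i)"
    using i.conjugation_iso[OF s] by (simp add: iso_iff)
  then have "conj_letter g i ` carrier (\<Gamma> i) = conj_letter g i ` (\<lambda>x. s \<otimes>\<^bsub>\<Gamma> i\<^esub> x \<otimes>\<^bsub>\<Gamma> i\<^esub> inv\<^bsub>\<Gamma> i\<^esub> s) ` carrier (\<Gamma> i)"
    by simp
  also have "\<dots> = conj_letter (g \<cdot> letter i s) i ` carrier (\<Gamma> i)"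
    unfolding image_image by (intro image_cong refl) (simp add: eq)
  finally show ?thesis by (simp add: vertex_altdef)
qed

lemma vertex_eq_iff:
  assumes g: "g \<in> carrier P" "i \<in> I" and t: "t \<in> carrier P" "j \<in> I"
  shows "vertex g i = vertex t j \<longleftrightarrow> i = j \<and> (\<exists>s\<in>carrier (\<Gamma> i). t = g \<cdot> letter i s)"
proof
  assume "vertex g i = vertex t j"
  then have "i = j" "inv\<^bsub>P\<^esub> g \<cdot> t \<in> letter i ` carrier (\<Gamma> i)"
    using vertex_subset_unique[OF g t] by auto
  moreover have "t = g \<cdot> (inv\<^bsub>P\<^esub> g \<cdot> t)" using g t by (simp flip: P.m_assoc)
  ultimately show "i = j \<and> (\<exists>s\<in>carrier (\<Gamma> i). t = g \<cdot> letter i s)" by auto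
qed (use vertex_mult_letter g in auto)

lemma vertex_subset_eq:
  assumes g: "g \<in> carrier P" "i \<in> I" and t: "t \<in> carrier P" "j \<in> I"
    and sub: "vertex g i \<subseteq> vertex t j"
  shows "vertex g i = vertex t j"
proof -
  have "i = j" "inv\<^bsub>P\<^esub> g \<cdot> t \<in> letter i ` carrier (\<Gamma> i)"
    using vertex_subset_unique[OF g t sub] by auto
  moreover have "t = g \<cdot> (inv\<^bsub>P\<^esub> g \<cdot> t)" using g t by (simp flip: P.m_assoc)
  ultimately show ?thesis using vertex_eq_iff[OF g t] by auto
qed

text \<open>
  Each subgroup isomorphic to a member of \<open>C\<close> lies in a vertex group, and no vertex group is properly contained in another.
\<close>

lemma maximal_C_subgroups_eq:
  "maximal_C_subgroups C M = (\<lambda>(g, i). vertex g i) ` (carrier P \<times> I)"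
proof (intro equalityI subsetI)
  fix V assume V: "V \<in> maximal_C_subgroups C M"
  then have "V \<in> C_subgroups C M" by (simp add: maximal_C_subgroups_def)
  then obtain t j where t: "t \<in> carrier P" "j \<in> I" "V \<subseteq> vertex t j"
    using C_subgroup_in_vertex[of V] by blast
  then have "V = vertex t j" using V vertex_C_subgroup by (auto simp: maximal_C_subgroups_def)
  then show "V \<in> (\<lambda>(g, i). vertex g i) ` (carrier P \<times> I)" using t by auto
next
  fix V assume "V \<in> (\<lambda>(g, i). vertex g i) ` (carrier P \<times> I)"
  then obtain g i where g: "g \<in> carrier P" "i \<in> I" "V = vertex g i" by auto
  have "V = W" if W: "W \<in> C_subgroups C M" "V \<subseteq> W" for W
  proof -
    obtain t j where t: "t \<in> carrier P" "j \<in> I" "W \<subseteq> vertex t j"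
      using C_subgroup_in_vertex W by blast
    then have "vertex g i \<subseteq> vertex t j" using g W by blast
    then have "vertex g i = vertex t j" by (rule vertex_subset_eq[OF g(1,2) t(1,2)])
    then show ?thesis using g W t by blast
  qed
  then show "V \<in> maximal_C_subgroups C M" using g vertex_C_subgroup by (auto simp: maximal_C_subgroups_def)
qed

lemma conjugate_vertex:
  assumes g: "g \<in> carrier P" "i \<in> I" and k: "k \<in> K"
  shows "conjugate M k (vertex g i) = vertex (k \<cdot> g) i"
proof -
  interpret K: subgroup K P by (rule K_subgroup)
  have kP: "k \<in> carrier P" using k K_in_P by blast
  have eq: "conj_letter (k \<cdot> g) i x = k \<cdot> conj_letter g i x \<cdot> inv\<^bsub>P\<^esub> k" if "x \<in> carrier (\<Gamma> i)" for x
    using g kP that letter_in_P by (simp add: conj_letter_def P.inv_mult_group P.m_assoc)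
  have "stab (k \<cdot> g) i = stab g i"
  proof -
    have "k \<cdot> z \<cdot> inv\<^bsub>P\<^esub> k \<in> K \<longleftrightarrow> z \<in> K" if "z \<in> carrier P" for z
    proof
      assume "k \<cdot> z \<cdot> inv\<^bsub>P\<^esub> k \<in> K"
      then have "inv\<^bsub>P\<^esub> k \<cdot> (k \<cdot> z \<cdot> inv\<^bsub>P\<^esub> k) \<cdot> k \<in> K" using k by blast
      moreover have "inv\<^bsub>P\<^esub> k \<cdot> (k \<cdot> z \<cdot> inv\<^bsub>P\<^esub> k) \<cdot> k = z"
        using that kP by (simp add: P.m_assoc) (simp flip: P.m_assoc)
      ultimately show "z \<in> K" by simp
    qed (use k in auto)
    then show ?thesis using eq conj_letter_closed[OF g] by (auto simp: stab_def)
  qed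
  then show ?thesis
    using k inv_M by (auto simp: conjugate_def vertex_def image_image stab_def eq intro!: image_cong)
qed

definition rep where "rep x = (SOME g. g \<in> x)"

lemma rep:
  assumes "x \<in> X"
  shows "rep x \<in> carrier P" "K #>\<^bsub>P\<^esub> rep x = x"
proof -
  obtain g where g: "g \<in> carrier P" "x = K #>\<^bsub>P\<^esub> g" using assms by (auto simp: RCOSETS_def)
  have "rep x \<in> x" unfolding rep_def by (rule someI[of _ g]) (use g P.rcos_self[OF _ K_subgroup] in auto)
  then show "rep x \<in> carrier P" "K #>\<^bsub>P\<^esub> rep x = x"
    using g P.r_coset_subset_G[OF subgroup.subset[OF K_subgroup]] P.repr_independence[OF _ g(1) K_subgroup] by auto
qed

lemma coset_in_X: "g \<in> carrier P \<Longrightarrow> K #>\<^bsub>P\<^esub> g \<in> X"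
  using P.rcosetsI[OF subgroup.subset[OF K_subgroup]] .

lemma coset_mult:
  assumes "k \<in> K" "g \<in> carrier P"
  shows "K #>\<^bsub>P\<^esub> (k \<cdot> g) = K #>\<^bsub>P\<^esub> g"
  using assms K_in_P P.r_coset_eq_iff[OF K_subgroup, of "k \<cdot> g" g] by (simp add: P.m_assoc)

lemma rep_decomp:
  assumes "g \<in> carrier P"
  shows "g \<cdot> inv\<^bsub>P\<^esub> rep (K #>\<^bsub>P\<^esub> g) \<in> K" "g = (g \<cdot> inv\<^bsub>P\<^esub> rep (K #>\<^bsub>P\<^esub> g)) \<cdot> rep (K #>\<^bsub>P\<^esub> g)"
  using rep[OF coset_in_X[OF assms]] assms P.r_coset_eq_iff[OF K_subgroup, of g "rep (K #>\<^bsub>P\<^esub> g)"]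
  by (auto simp: P.m_assoc)

lemma vertex_maximal: "g \<in> carrier P \<Longrightarrow> i \<in> I \<Longrightarrow> vertex g i \<in> maximal_C_subgroups C M"
  unfolding maximal_C_subgroups_eq by auto

text \<open>
  Colourings of \<open>K\<close> together with a function \<open>u\<close> on the free product that \<open>f\<close> twists under multiplication by \<open>K\<close>
  from the left. They are counted in two ways. For a given colouring, \<open>u\<close> can be prescribed on representatives
  of the cosets. On the other hand, \<open>u g \<noteq> v (vertex g i)\<close>, the difference of the two colours, depends only on \<open>i\<close> and on
  the coset of \<open>g\<close>. These differences can be prescribed, and together with the value of \<open>u\<close> at the empty word they determine
  \<open>u\<close>, \<open>v\<close> and \<open>f\<close>.
\<close>

definition lifts :: "(((('i \<times> 'a) list \<Rightarrow> bool) \<times> (('i \<times> 'a) list set \<Rightarrow> bool)) \<times> (('i \<times> 'a) list \<Rightarrow> bool)) set" where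
  "lifts = {((f, v), u). (f, v) \<in> colourings C M \<and> u \<in> carrier P \<rightarrow>\<^sub>E UNIV \<and>
     (\<forall>k\<in>K. \<forall>g\<in>carrier P. u (k \<cdot> g) = (f k \<noteq> u g))}"

lemma colouringsD:
  assumes "(f, v) \<in> colourings C M"
  shows "f \<in> K \<rightarrow>\<^sub>E UNIV" "v \<in> maximal_C_subgroups C M \<rightarrow>\<^sub>E UNIV"
    "\<And>x y. x \<in> K \<Longrightarrow> y \<in> K \<Longrightarrow> f (x \<cdot> y) = (f x \<noteq> f y)"
    "\<And>k g i. k \<in> K \<Longrightarrow> g \<in> carrier P \<Longrightarrow> i \<in> I \<Longrightarrow> v (vertex (k \<cdot> g) i) = (f k \<noteq> v (vertex g i))"
proof -
  show "f \<in> K \<rightarrow>\<^sub>E UNIV" "v \<in> maximal_C_subgroups C M \<rightarrow>\<^sub>E UNIV"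
    "\<And>x y. x \<in> K \<Longrightarrow> y \<in> K \<Longrightarrow> f (x \<cdot> y) = (f x \<noteq> f y)"
    using assms by (auto simp: colourings_def)
  fix k g i assume A: "k \<in> K" "g \<in> carrier P" "i \<in> I"
  have "\<forall>k\<in>K. \<forall>V\<in>maximal_C_subgroups C M. v (conjugate M k V) = (f k \<noteq> v V)"
    using assms by (simp add: colourings_def)
  then show "v (vertex (k \<cdot> g) i) = (f k \<noteq> v (vertex g i))"
    using A vertex_maximal conjugate_vertex by metis
qed

lemma card_lifts_over_colourings:
  "card lifts = card (colourings C M) * 2 ^ card X"
proof -
  let ?to = "\<lambda>((f, v), u). ((f, v), \<lambda>x\<in>X. u (rep x))"
  let ?from = "\<lambda>((f, v), y). ((f, v), \<lambda>g\<in>carrier P. f (g \<cdot> inv\<^bsub>P\<^esub> rep (K #>\<^bsub>P\<^esub> g)) \<noteq> y (K #>\<^bsub>P\<^esub> g))"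
  have "bij_betw ?to lifts (colourings C M \<times> (X \<rightarrow>\<^sub>E UNIV))"
  proof (rule bij_betw_byWitness[where f' = ?from])
    show "\<forall>a\<in>lifts. ?from (?to a) = a"
    proof
      fix a assume "a \<in> lifts"
      moreover obtain f v u where a: "a = ((f, v), u)" by (metis surj_pair)
      ultimately have A: "u \<in> carrier P \<rightarrow>\<^sub>E UNIV"
        "\<And>k g. k \<in> K \<Longrightarrow> g \<in> carrier P \<Longrightarrow> u (k \<cdot> g) = (f k \<noteq> u g)"
        by (auto simp: lifts_def)
      have "(f (g \<cdot> inv\<^bsub>P\<^esub> rep (K #>\<^bsub>P\<^esub> g)) \<noteq> u (rep (K #>\<^bsub>P\<^esub> g))) = u g" if g: "g \<in> carrier P" for g
        using A(2)[OF rep_decomp(1)[OF g] rep(1)[OF coset_in_X[OF g]]] rep_decomp(2)[OF g] by simp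
      then have "(\<lambda>g\<in>carrier P. f (g \<cdot> inv\<^bsub>P\<^esub> rep (K #>\<^bsub>P\<^esub> g)) \<noteq> (\<lambda>x\<in>X. u (rep x)) (K #>\<^bsub>P\<^esub> g)) = u"
        using A(1) coset_in_X by (intro extensionalityI[of _ "carrier P"]) (auto simp: PiE_def)
      then show "?from (?to a) = a" by (simp add: a)
    qed
    show "\<forall>b\<in>colourings C M \<times> (X \<rightarrow>\<^sub>E UNIV). ?to (?from b) = b"
    proof
      fix b assume "b \<in> colourings C M \<times> (X \<rightarrow>\<^sub>E (UNIV::bool set))"
      then obtain f v y where b: "b = ((f, v), y)"
        and A: "(f, v) \<in> colourings C M" "y \<in> X \<rightarrow>\<^sub>E (UNIV::bool set)"
        by (metis SigmaE surj_pair)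
      have "\<not> f []" using colouringsD(3)[OF A(1), of "[]" "[]"] subgroup.one_closed[OF K_subgroup]
        by (simp add: one_P)
      then have "(f (rep x \<cdot> inv\<^bsub>P\<^esub> rep (K #>\<^bsub>P\<^esub> rep x)) \<noteq> y (K #>\<^bsub>P\<^esub> rep x)) = y x" if "x \<in> X" for x
        using rep[OF that] P.r_inv[of "rep x"] by (simp add: one_P)
      then have "(\<lambda>x\<in>X. (\<lambda>g\<in>carrier P. f (g \<cdot> inv\<^bsub>P\<^esub> rep (K #>\<^bsub>P\<^esub> g)) \<noteq> y (K #>\<^bsub>P\<^esub> g)) (rep x)) = y"
        using A(2) rep(1) by (intro extensionalityI[of _ X]) (auto simp: PiE_def)
      then show "?to (?from b) = b" by (simp add: b)
    qed
    show "?to ` lifts \<subseteq> colourings C M \<times> (X \<rightarrow>\<^sub>E UNIV)" by (auto simp: lifts_def)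
    show "?from ` (colourings C M \<times> (X \<rightarrow>\<^sub>E UNIV)) \<subseteq> lifts"
    proof clarify
      fix f v y assume A: "(f, v) \<in> colourings C M"
      have "f (k \<cdot> g \<cdot> inv\<^bsub>P\<^esub> rep (K #>\<^bsub>P\<^esub> g)) = (f k \<noteq> f (g \<cdot> inv\<^bsub>P\<^esub> rep (K #>\<^bsub>P\<^esub> g)))"
        if "k \<in> K" "g \<in> carrier P" for k g
        using colouringsD(3)[OF A that(1) rep_decomp(1)[OF that(2)]] that K_in_P rep[OF coset_in_X[OF that(2)]]
        by (simp add: P.m_assoc)
      then show "((f, v), \<lambda>g\<in>carrier P. f (g \<cdot> inv\<^bsub>P\<^esub> rep (K #>\<^bsub>P\<^esub> g)) \<noteq> y (K #>\<^bsub>P\<^esub> g)) \<in> lifts"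
        using A K_in_P coset_mult by (auto simp: lifts_def)
    qed
  qed
  then have "card lifts = card (colourings C M \<times> (X \<rightarrow>\<^sub>E (UNIV::bool set)))"
    by (rule bij_betw_same_card)
  then show ?thesis using finite_X by (simp add: card_cartesian_product card_PiE)
qed

text \<open>
  This recovers \<open>u\<close> from its value \<open>b\<close> at the empty word and the differences \<open>m\<close>: a letter of type \<open>i\<close> at the end
  of \<open>g\<close> does not change \<open>vertex g i\<close>, and so \<open>u\<close> changes exactly as \<open>m\<close> does. The word is read in reverse.
\<close>

fun potential :: "bool \<Rightarrow> (('i \<times> 'a) list set \<times> 'i \<Rightarrow> bool) \<Rightarrow> ('i \<times> 'a) list \<Rightarrow> bool" where
  "potential b m [] = b"
| "potential b m ((i, g) # r) =
     (potential b m r \<noteq> (m (K #>\<^bsub>P\<^esub> rev r, i) \<noteq> m (K #>\<^bsub>P\<^esub> rev ((i, g) # r), i)))"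

text \<open>
  The formula holds as well when the letter merges with the last letter of \<open>w\<close>, because the changes of \<open>m\<close> telescope
  within a coset of the factor.
\<close>

lemma potential_mult_letter:
  assumes w: "w \<in> carrier P" "i \<in> I" "s \<in> carrier (\<Gamma> i)"
  shows "potential b m (rev (w \<cdot> letter i s)) =
    (potential b m (rev w) \<noteq> (m (K #>\<^bsub>P\<^esub> w, i) \<noteq> m (K #>\<^bsub>P\<^esub> (w \<cdot> letter i s), i)))"
proof -
  interpret i: group "\<Gamma> i" using factor_group w by blast
  obtain h x y where h: "h \<in> carrier (\<Gamma> i)" "x \<in> carrier P" "x = [] \<or> fst (last x) \<noteq> i"
    "w = x \<cdot> letter i h" using strip_last[OF w(1,2)] by metis
  have *: "potential b m (rev (x \<cdot> letter i t)) =
      (potential b m (rev x) \<noteq> (m (K #>\<^bsub>P\<^esub> x, i) \<noteq> m (K #>\<^bsub>P\<^esub> (x \<cdot> letter i t), i)))"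
    if t: "t \<in> carrier (\<Gamma> i)" for t
  proof (cases "t = \<one>\<^bsub>\<Gamma> i\<^esub>")
    case False
    then have "x @ [(i, t)] \<in> carrier P" using h t w by (simp add: snoc_in_P)
    then have "x \<cdot> letter i t = x @ [(i, t)]" using snoc_eq_mult by simp
    then show ?thesis by simp
  qed (use h in simp)
  have "w \<cdot> letter i s = x \<cdot> letter i (h \<otimes>\<^bsub>\<Gamma> i\<^esub> s)"
    using h w letter_in_P by (simp add: P.m_assoc flip: letter_mult_letter)
  then show ?thesis using *[of "h \<otimes>\<^bsub>\<Gamma> i\<^esub> s"] *[of h] h w by auto
qed

lemma lifts_potential:
  assumes "((f, v), u) \<in> lifts" and g: "g \<in> carrier P" "i \<in> I"
  shows "(u g \<noteq> v (vertex g i)) = (u (rep (K #>\<^bsub>P\<^esub> g)) \<noteq> v (vertex (rep (K #>\<^bsub>P\<^esub> g)) i))"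
proof -
  have A: "(f, v) \<in> colourings C M"
    "\<And>k g. k \<in> K \<Longrightarrow> g \<in> carrier P \<Longrightarrow> u (k \<cdot> g) = (f k \<noteq> u g)"
    using assms by (auto simp: lifts_def)
  show ?thesis
    using A(2)[OF rep_decomp(1) rep(1)[OF coset_in_X], OF g(1,1)]
      colouringsD(4)[OF A(1) rep_decomp(1) rep(1)[OF coset_in_X] g(2), OF g(1,1)]
      rep_decomp(2)[OF g(1)] by auto
qed

lemma lifts_eq_potential:
  assumes L: "((f, v), u) \<in> lifts"
    and m: "\<And>x i. x \<in> X \<Longrightarrow> i \<in> I \<Longrightarrow> m (x, i) = (u (rep x) \<noteq> v (vertex (rep x) i))"
    and w: "w \<in> carrier P"
  shows "u w = potential (u []) m (rev w)"
  using w
proof (induction w rule: P_letter_induct)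
  case (mult w i s)
  have ws: "w @ [(i, s)] \<in> carrier P" using mult by (simp add: snoc_in_P)
  have mK: "m (K #>\<^bsub>P\<^esub> g, i) = (u g \<noteq> v (vertex g i))" if "g \<in> carrier P" for g
    using m[OF coset_in_X[OF that]] lifts_potential[OF L that] mult(2,3) by simp
  have "vertex (w @ [(i, s)]) i = vertex w i"
    using vertex_mult_letter[of w i s] mult snoc_eq_mult[OF ws] by simp
  then show ?case using mult.IH mK[OF mult(1)] mK[OF ws] by auto
qed simp

lemma card_lifts_over_potentials:
  "card lifts = 2 * 2 ^ (card X * card I)"
proof -
  let ?to = "\<lambda>((f, v), u). (u [], \<lambda>(x, i)\<in>X \<times> I. u (rep x) \<noteq> v (vertex (rep x) i))"
  have "bij_betw ?to lifts (UNIV \<times> (X \<times> I \<rightarrow>\<^sub>E UNIV))"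
  proof (rule bij_betw_imageI)
    show "inj_on ?to lifts"
    proof (rule inj_onI)
      fix a a' assume a: "a \<in> lifts" "a' \<in> lifts" "?to a = ?to a'"
      obtain f v u f' v' u' where aa: "a = ((f, v), u)" "a' = ((f', v'), u')" by (metis surj_pair)
      have L: "((f, v), u) \<in> lifts" "((f', v'), u') \<in> lifts"
        and eq: "u [] = u' []" "(\<lambda>(x, i)\<in>X \<times> I. u (rep x) \<noteq> v (vertex (rep x) i)) =
          (\<lambda>(x, i)\<in>X \<times> I. u' (rep x) \<noteq> v' (vertex (rep x) i))"
        using a by (simp_all add: aa)
      define m where "m = (\<lambda>(x, i)\<in>X \<times> I. u (rep x) \<noteq> v (vertex (rep x) i))"
      have m: "m (x, i) = (u (rep x) \<noteq> v (vertex (rep x) i))"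
        "m (x, i) = (u' (rep x) \<noteq> v' (vertex (rep x) i))" if "x \<in> X" "i \<in> I" for x i
        using that fun_cong[OF eq(2), of "(x, i)"] by (auto simp: m_def)
      have ext: "f \<in> K \<rightarrow>\<^sub>E UNIV" "f' \<in> K \<rightarrow>\<^sub>E UNIV" "v \<in> maximal_C_subgroups C M \<rightarrow>\<^sub>E UNIV"
        "v' \<in> maximal_C_subgroups C M \<rightarrow>\<^sub>E UNIV" "u \<in> carrier P \<rightarrow>\<^sub>E UNIV" "u' \<in> carrier P \<rightarrow>\<^sub>E UNIV"
        using L colouringsD(1,2)[of f v] colouringsD(1,2)[of f' v'] by (simp_all add: lifts_def)
      have uw: "u w = u' w" if "w \<in> carrier P" for w
        using lifts_eq_potential[OF L(1) m(1) that] lifts_eq_potential[OF L(2) m(2) that] eq(1) by simp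
      have "f = f'"
      proof (rule PiE_ext[OF ext(1,2)])
        fix k assume k: "k \<in> K"
        then have "u (k \<cdot> []) = (f k \<noteq> u [])" "u' (k \<cdot> []) = (f' k \<noteq> u' [])"
          using L by (auto simp: lifts_def)
        then show "f k = f' k" using uw[of k] uw[of "[]"] k K_in_P by auto
      qed
      moreover have "v = v'"
      proof (rule PiE_ext[OF ext(3,4)])
        fix V assume "V \<in> maximal_C_subgroups C M"
        then obtain g i where g: "g \<in> carrier P" "i \<in> I" "V = vertex g i"
          unfolding maximal_C_subgroups_eq by auto
        then show "v V = v' V"
          using lifts_potential[OF L(1) g(1,2)] lifts_potential[OF L(2) g(1,2)] uw[OF g(1)]
            m[OF coset_in_X[OF g(1)] g(2)] by auto
      qed
      moreover have "u = u'" by (rule PiE_ext[OF ext(5,6)]) (rule uw)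
      ultimately show "a = a'" by (simp add: aa)
    qed
    show "?to ` lifts = UNIV \<times> (X \<times> I \<rightarrow>\<^sub>E UNIV)"
    proof (intro equalityI subsetI)
      fix z assume "z \<in> (UNIV :: bool set) \<times> (X \<times> I \<rightarrow>\<^sub>E (UNIV :: bool set))"
      then obtain b m where z: "z = (b, m)" "m \<in> X \<times> I \<rightarrow>\<^sub>E (UNIV :: bool set)" by auto
      define u where "u = (\<lambda>w\<in>carrier P. potential b m (rev w))"
      define f where "f = (\<lambda>k\<in>K. u k \<noteq> u [])"
      define v where "v = (\<lambda>V\<in>maximal_C_subgroups C M.
        (case SOME (g, i). g \<in> carrier P \<and> i \<in> I \<and> V = vertex g i of (g, i) \<Rightarrow> u g \<noteq> m (K #>\<^bsub>P\<^esub> g, i)))"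
      have u_mult: "u (w \<cdot> letter i s) = (u w \<noteq> (m (K #>\<^bsub>P\<^esub> w, i) \<noteq> m (K #>\<^bsub>P\<^esub> (w \<cdot> letter i s), i)))"
        if "w \<in> carrier P" "i \<in> I" "s \<in> carrier (\<Gamma> i)" for w i s
        using potential_mult_letter[OF that] that letter_in_P by (simp add: u_def)
      have v: "v (vertex g i) = (u g \<noteq> m (K #>\<^bsub>P\<^esub> g, i))" if g: "g \<in> carrier P" "i \<in> I" for g i
      proof -
        define p where "p = (SOME (t, j). t \<in> carrier P \<and> j \<in> I \<and> vertex g i = vertex t j)"
        have "case p of (t, j) \<Rightarrow> t \<in> carrier P \<and> j \<in> I \<and> vertex g i = vertex t j"
          unfolding p_def by (rule someI[of _ "(g, i)"]) (use g in simp)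
        then obtain t j where t: "p = (t, j)" "t \<in> carrier P" "j \<in> I" "vertex g i = vertex t j"
          by (cases p) auto
        then obtain s where s: "i = j" "s \<in> carrier (\<Gamma> i)" "t = g \<cdot> letter i s"
          using vertex_eq_iff[OF g t(2,3)] by auto
        have "v (vertex g i) = (u t \<noteq> m (K #>\<^bsub>P\<^esub> t, j))"
          using vertex_maximal[OF g] t(1) by (simp add: v_def p_def)
        then show ?thesis using u_mult[OF g s(2)] s by auto
      qed
      \<comment> \<open>The potential changes under multiplication by \<open>k\<close> by a constant, which is the value of \<open>f\<close> at \<open>k\<close>.\<close>
      have equiv: "u (k \<cdot> g) = (f k \<noteq> u g)" if k: "k \<in> K" and g: "g \<in> carrier P" for k g
        using g
      proof (induction g rule: P_letter_induct)
        case one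
        then show ?case using k K_in_P by (auto simp: f_def)
      next
        case (mult w i s)
        have ws: "w @ [(i, s)] = w \<cdot> letter i s" using mult by (intro snoc_eq_mult) (simp add: snoc_in_P)
        have l: "letter i s \<in> carrier P" using mult letter_in_P by blast
        have "K #>\<^bsub>P\<^esub> (k \<cdot> w \<cdot> letter i s) = K #>\<^bsub>P\<^esub> (w \<cdot> letter i s)"
          using coset_mult[OF k, of "w \<cdot> letter i s"] k K_in_P mult(1) l by (simp add: P.m_assoc)
        then have "u (k \<cdot> w \<cdot> letter i s) = (f k \<noteq> u (w \<cdot> letter i s))"
          using u_mult[of "k \<cdot> w" i s] u_mult[of w i s] mult k K_in_P coset_mult[OF k mult(1)] by auto
        then show ?case using k K_in_P mult(1) l by (simp add: ws P.m_assoc)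
      qed
      have "(f, v) \<in> colourings C M"
        unfolding colourings_def
      proof (clarify, intro conjI ballI)
        show "f \<in> carrier M \<rightarrow>\<^sub>E UNIV" by (simp add: f_def)
        show "v \<in> maximal_C_subgroups C M \<rightarrow>\<^sub>E UNIV" by (simp add: v_def)
        fix x assume x: "x \<in> carrier M"
        {
          fix y assume y: "y \<in> carrier M"
          have "x \<cdot> y \<in> K" using x y subgroup.m_closed[OF K_subgroup] by simp
          then show "f (x \<otimes>\<^bsub>M\<^esub> y) = (f x \<noteq> f y)"
            using x y equiv[of x y] K_in_P by (auto simp: f_def)
        next
          fix V assume "V \<in> maximal_C_subgroups C M"
          then obtain g i where g: "g \<in> carrier P" "i \<in> I" "V = vertex g i"
            unfolding maximal_C_subgroups_eq by auto
          then show "v (conjugate M x V) = (f x \<noteq> v V)"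
            using x conjugate_vertex[of g i x] K_in_P v[of g i] v[of "x \<cdot> g" i] coset_mult[of x g] equiv[of x g]
            by auto
        }
      qed
      then have L: "((f, v), u) \<in> lifts" using equiv by (auto simp: lifts_def u_def)
      have "(\<lambda>(x, i)\<in>X \<times> I. u (rep x) \<noteq> v (vertex (rep x) i)) = m"
        using z(2) v rep by (intro extensionalityI[of _ "X \<times> I"]) (auto simp: PiE_def)
      moreover have "u [] = b" by (simp add: u_def)
      ultimately show "z \<in> ?to ` lifts" using L z(1) by (intro image_eqI[where x = "((f, v), u)"]) auto
    qed auto
  qed
  then have "card lifts = card ((UNIV::bool set) \<times> (X \<times> I \<rightarrow>\<^sub>E (UNIV::bool set)))"
    by (rule bij_betw_same_card)
  then show ?thesis using finite_X finite_I by (simp add: card_cartesian_product card_PiE)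
qed

theorem card_colourings:
  "card (colourings C M) * 2 ^ card X = 2 * 2 ^ (card X * card I)"
  using card_lifts_over_colourings card_lifts_over_potentials by simp

lemma finite_colourings: "finite (colourings C M)"
  using card_colourings by (metis card.infinite mult_is_0 power_not_zero zero_neq_numeral)

lemma class_vertex:
  assumes "g \<in> carrier P" "i \<in> I"
  shows "conjugacy_class M (vertex g i) = (\<lambda>c. vertex (c \<cdot> g) i) ` K"
  using conjugate_vertex[OF assms] by (auto simp: conjugacy_class_def)

lemma vertex_in_class:
  assumes "g \<in> carrier P" "i \<in> I"
  shows "vertex g i \<in> conjugacy_class M (vertex g i)"
  unfolding class_vertex[OF assms]
  using assms subgroup.one_closed[OF K_subgroup] by (intro image_eqI[where x = "\<one>\<^bsub>P\<^esub>"]) simp_all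

lemma class_vertex_mult:
  assumes g: "g \<in> carrier P" "i \<in> I" and k: "k \<in> K"
  shows "conjugacy_class M (vertex (k \<cdot> g) i) = conjugacy_class M (vertex g i)"
proof -
  interpret K: subgroup K P by (rule K_subgroup)
  have "(\<lambda>c. c \<cdot> k) ` K = K"
  proof (intro equalityI subsetI)
    fix c assume "c \<in> K"
    then show "c \<in> (\<lambda>c. c \<cdot> k) ` K"
      using k by (intro image_eqI[where x = "c \<cdot> inv\<^bsub>P\<^esub> k"]) (auto simp: P.m_assoc)
  qed (use k in auto)
  then have "(\<lambda>c. vertex (c \<cdot> g) i) ` K = (\<lambda>c. vertex (c \<cdot> g) i) ` (\<lambda>c. c \<cdot> k) ` K" by simp
  also have "\<dots> = (\<lambda>c. vertex (c \<cdot> (k \<cdot> g)) i) ` K"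
    unfolding image_image using k g K_in_P by (intro image_cong refl) (simp add: P.m_assoc)
  finally show ?thesis using g k K_in_P by (simp add: class_vertex)
qed

text \<open>
  Conjugacy classes of vertex groups correspond to pairs of an index \<open>i\<close> and an orbit of \<open>\<Gamma> i\<close> on the cosets of \<open>K\<close>.
\<close>

lemma class_fibre:
  assumes x0: "x0 \<in> X" and i0: "i0 \<in> I"
  shows "{p \<in> X \<times> I. conjugacy_class M (vertex (rep (fst p)) (snd p)) = conjugacy_class M (vertex (rep x0) i0)}
    = (\<lambda>x. (x, i0)) ` orbit (rep x0) i0"
proof (intro equalityI subsetI)
  fix p assume p: "p \<in> {p \<in> X \<times> I. conjugacy_class M (vertex (rep (fst p)) (snd p)) = conjugacy_class M (vertex (rep x0) i0)}"
  obtain x i where xi: "p = (x, i)" "x \<in> X" "i \<in> I"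
    "conjugacy_class M (vertex (rep x) i) = conjugacy_class M (vertex (rep x0) i0)" using p by (cases p) auto
  have "vertex (rep x) i \<in> conjugacy_class M (vertex (rep x) i)"
    using vertex_in_class[OF rep(1)[OF xi(2)] xi(3)] .
  then obtain k where k: "k \<in> K" "vertex (rep x) i = vertex (k \<cdot> rep x0) i0"
    unfolding xi(4) class_vertex[OF rep(1)[OF x0] i0] by (rule imageE)
  then obtain s where s: "i0 = i" "s \<in> carrier (\<Gamma> i0)" "rep x = k \<cdot> rep x0 \<cdot> letter i0 s"
    using vertex_eq_iff[of "k \<cdot> rep x0" i0 "rep x" i] rep(1) x0 i0 xi K_in_P by auto
  have "x = K #>\<^bsub>P\<^esub> (k \<cdot> (rep x0 \<cdot> letter i0 s))"
    using rep[OF xi(2)] s k rep(1)[OF x0] K_in_P i0 letter_in_P by (simp add: P.m_assoc)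
  also have "\<dots> = K #>\<^bsub>P\<^esub> (rep x0 \<cdot> letter i0 s)"
    using coset_mult k s rep(1)[OF x0] i0 letter_in_P by simp
  finally show "p \<in> (\<lambda>x. (x, i0)) ` orbit (rep x0) i0" using s xi by (auto simp: orbit_def)
next
  fix p assume "p \<in> (\<lambda>x. (x, i0)) ` orbit (rep x0) i0"
  then obtain s where s: "s \<in> carrier (\<Gamma> i0)" "p = (K #>\<^bsub>P\<^esub> (rep x0 \<cdot> letter i0 s), i0)"
    by (auto simp: orbit_def)
  define g where "g = rep x0 \<cdot> letter i0 s"
  have g: "g \<in> carrier P" using s i0 letter_in_P rep(1)[OF x0] by (simp add: g_def)
  define k where "k = g \<cdot> inv\<^bsub>P\<^esub> rep (K #>\<^bsub>P\<^esub> g)"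
  have k: "k \<in> K" "g = k \<cdot> rep (K #>\<^bsub>P\<^esub> g)" using rep_decomp[OF g] by (simp_all add: k_def)
  let ?r = "rep (K #>\<^bsub>P\<^esub> g)"
  have r: "?r \<in> carrier P" using rep(1)[OF coset_in_X[OF g]] .
  have "vertex (rep x0) i0 = vertex (k \<cdot> ?r) i0"
    using vertex_mult_letter[OF rep(1)[OF x0] i0 s(1)] k(2) by (simp add: g_def)
  then have "conjugacy_class M (vertex ?r i0) = conjugacy_class M (vertex (rep x0) i0)"
    using class_vertex_mult[OF r i0 k(1)] by simp
  then show "p \<in> {p \<in> X \<times> I. conjugacy_class M (vertex (rep (fst p)) (snd p)) = conjugacy_class M (vertex (rep x0) i0)}"
    using s g coset_in_X[OF g] i0 by (simp add: g_def)
qed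

text \<open>
  By multiplicativity the weight of the class is the index of \<open>stab g i\<close> times \<open>\<bar>\<rho> (\<Gamma> i)\<bar>\<close>, and this
  index is the size of the orbit.
\<close>

lemma vertex_class_weight:
  assumes inv: "multiplicative_invariant C \<rho>" and g: "g \<in> carrier P" "i \<in> I"
  shows "class_weight C \<rho> M (conjugacy_class M (vertex g i)) = real (card (orbit g i)) * \<bar>\<rho> (\<Gamma> i)\<bar>"
proof -
  let ?c = "conjugacy_class M (vertex g i)"
  define Q where "Q = (SOME Q. Q \<in> C \<and> (\<exists>V\<in>?c. Q \<cong> M\<lparr>carrier := V\<rparr>))"
  have vc: "vertex g i \<in> ?c" using vertex_in_class[OF g] .
  have "Q \<in> C \<and> (\<exists>V\<in>?c. Q \<cong> M\<lparr>carrier := V\<rparr>)"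
    unfolding Q_def using vertex_iso[OF g] stab_in_C[OF g] vc by (intro someI[of "\<lambda>Q. Q \<in> C \<and> (\<exists>V\<in>?c. Q \<cong> M\<lparr>carrier := V\<rparr>)"]) blast
  then obtain V where Q: "Q \<in> C" "V \<in> ?c" "Q \<cong> M\<lparr>carrier := V\<rparr>" by blast
  then obtain k where k: "k \<in> K" "V = vertex (k \<cdot> g) i"
    unfolding class_vertex[OF g] by blast
  have kg: "k \<cdot> g \<in> carrier P" using k K_in_P g by simp
  let ?S = "(\<Gamma> i)\<lparr>carrier := stab (k \<cdot> g) i\<rparr>"
  have grp: "group ?S"
    using subgroup.subgroup_is_group[OF stab_subgroup[OF kg g(2)] factor_group[OF g(2)]] .
  have "M\<lparr>carrier := V\<rparr> \<cong> ?S"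
    using group.iso_sym[OF grp vertex_iso[OF kg g(2)]] k by simp
  then have "Q \<cong> ?S" by (rule iso_trans[OF Q(3)])
  then have "\<rho> Q = \<rho> ?S"
    using inv Q(1) stab_in_C[OF kg g(2)] unfolding multiplicative_invariant_def by blast
  also have "\<dots> = real (subgroup_index (\<Gamma> i) (stab (k \<cdot> g) i)) * \<rho> (\<Gamma> i)"
    using inv factor_in_C[OF g(2)] stab_index(1)[OF kg g(2)] unfolding multiplicative_invariant_def by blast
  also have "subgroup_index (\<Gamma> i) (stab (k \<cdot> g) i) = card (orbit (k \<cdot> g) i)"
    using stab_index(2)[OF kg g(2)] .
  also have "orbit (k \<cdot> g) i = orbit g i"
    unfolding orbit_def using coset_mult[OF k(1)] k K_in_P g letter_in_P
    by (intro image_cong refl) (simp add: P.m_assoc)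
  finally show ?thesis 
    unfolding class_weight_def Q_def[symmetric] by (simp add: abs_mult)
qed

text \<open>
  By the two preceding lemmas, the weight of a class is a sum of \<open>\<bar>\<rho> (\<Gamma> i)\<bar>\<close> over the pairs of a coset
  and an index that belong to the class. All pairs together give the right-hand side.
\<close>

theorem total_weight_eq:
  assumes inv: "multiplicative_invariant C \<rho>"
  shows "total_weight C \<rho> M = real (card X) * (\<Sum>i\<in>I. \<bar>\<rho> (\<Gamma> i)\<bar>)"
proof -
  let ?cl = "\<lambda>p. conjugacy_class M (vertex (rep (fst p)) (snd p))"
  have fin: "finite (X \<times> I)" using finite_X finite_I by simp
  have im: "conjugacy_class M ` maximal_C_subgroups C M = ?cl ` (X \<times> I)"
  proof (intro equalityI subsetI)
    fix c assume "c \<in> conjugacy_class M ` maximal_C_subgroups C M"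
    then obtain g i where g: "g \<in> carrier P" "i \<in> I" "c = conjugacy_class M (vertex g i)"
      unfolding maximal_C_subgroups_eq by auto
    define x where "x = K #>\<^bsub>P\<^esub> g"
    have x: "x \<in> X" using coset_in_X g by (simp add: x_def)
    obtain k where k: "k \<in> K" "g = k \<cdot> rep x" using rep_decomp[OF g(1)] by (auto simp: x_def)
    have "c = conjugacy_class M (vertex (rep x) i)"
      using class_vertex_mult[OF rep(1)[OF x] g(2) k(1)] g(3) k(2) by simp
    then show "c \<in> ?cl ` (X \<times> I)" using x g by force
  next
    fix c assume "c \<in> ?cl ` (X \<times> I)"
    then show "c \<in> conjugacy_class M ` maximal_C_subgroups C M" using vertex_maximal rep(1) by auto
  qed
  have "class_weight C \<rho> M (?cl p0) = (\<Sum>p\<in>{p \<in> X \<times> I. ?cl p = ?cl p0}. \<bar>\<rho> (\<Gamma> (snd p))\<bar>)" if p0: "p0 \<in> X \<times> I" for p0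
  proof -
    obtain x0 i0 where p: "p0 = (x0, i0)" "x0 \<in> X" "i0 \<in> I" using p0 by auto
    have "(\<Sum>p\<in>{p \<in> X \<times> I. ?cl p = ?cl p0}. \<bar>\<rho> (\<Gamma> (snd p))\<bar>) =
        (\<Sum>p\<in>(\<lambda>x. (x, i0)) ` orbit (rep x0) i0. \<bar>\<rho> (\<Gamma> (snd p))\<bar>)"
      using class_fibre[OF p(2,3)] p by simp
    also have "\<dots> = real (card (orbit (rep x0) i0)) * \<bar>\<rho> (\<Gamma> i0)\<bar>"
      by (subst sum.reindex) (auto simp: inj_on_def)
    finally show ?thesis using vertex_class_weight[OF inv rep(1)[OF p(2)] p(3)] p by simp
  qed
  then have "total_weight C \<rho> M = (\<Sum>c\<in>?cl ` (X \<times> I). \<Sum>p\<in>{p \<in> X \<times> I. ?cl p = c}. \<bar>\<rho> (\<Gamma> (snd p))\<bar>)"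
    unfolding total_weight_def im by (intro sum.cong refl) auto
  also have "\<dots> = (\<Sum>p\<in>X \<times> I. \<bar>\<rho> (\<Gamma> (snd p))\<bar>)"
    using sum.image_gen[OF fin, of "\<lambda>p. \<bar>\<rho> (\<Gamma> (snd p))\<bar>" ?cl] by simp
  also have "\<dots> = (\<Sum>x\<in>X. \<Sum>i\<in>I. \<bar>\<rho> (\<Gamma> i)\<bar>)"
    unfolding sum.cartesian_product by (simp only: case_prod_unfold)
  finally show ?thesis by simp
qed

lemma card_X_pos: "card X > 0"
  using finite_X coset_in_X[of "[]"] by (auto simp: card_gt_0_iff)

end

section \<open>Commensurable free products\<close>

text \<open>
  The isomorphic subgroups have the same number of colourings, so their indices in the two free products agree; then
  their total weights can be compared.
\<close>

theorem commensurable_free_products: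
  fixes G :: "'i \<Rightarrow> 'a monoid" and H :: "'i \<Rightarrow> 'a monoid" and C :: "'a monoid set"
  assumes one_ended: "\<And>Q. Q \<in> C \<Longrightarrow> one_ended_group Q"
    and closed: "finite_index_closed C" and inv: "multiplicative_invariant C \<rho>"
    and I: "finite I" "card I > 1"
    and GH: "\<And>i. i \<in> I \<Longrightarrow> G i \<in> C" "\<And>i. i \<in> I \<Longrightarrow> H i \<in> C"
    and comm: "abstractly_commensurable (free_product I G) (free_product I H)"
  shows "(\<Sum>i\<in>I. \<bar>\<rho> (G i)\<bar>) = (\<Sum>i\<in>I. \<bar>\<rho> (H i)\<bar>)"
proof -
  obtain K L where KL: "finite_index_subgroup K (free_product I G)" "finite_index_subgroup L (free_product I H)"
    "(free_product I G)\<lparr>carrier := K\<rparr> \<cong> (free_product I H)\<lparr>carrier := L\<rparr>"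
    using comm by (auto simp: abstractly_commensurable_def)
  have grp: "group Q" if "Q \<in> C" for Q using one_ended[OF that] by (simp add: one_ended_group_def)
  interpret G: finite_index_in_free_product I G C K
    by (intro finite_index_in_free_product.intro free_product_of_groups.intro
        finite_index_in_free_product_axioms.intro) (use KL one_ended closed I GH grp in blast)+
  interpret H: finite_index_in_free_product I H C L
    by (intro finite_index_in_free_product.intro free_product_of_groups.intro
        finite_index_in_free_product_axioms.intro) (use KL one_ended closed I GH grp in blast)+
  obtain \<phi> where \<phi>: "\<phi> \<in> iso G.M H.M" using KL(3) by (auto simp: is_iso_def)
  interpret iso: group_isomorphism G.M H.M \<phi>
    by unfold_locales (rule \<phi>)
  interpret osi: group_isomorphism H.M G.M iso.\<phi>'
    by unfold_locales (rule iso.\<phi>'_iso)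
  have "card (colourings C G.M) = card (colourings C H.M)"
    using iso.card_colourings_le[OF G.finite_colourings] osi.card_colourings_le[OF H.finite_colourings]
    by (rule antisym[rotated])
  then obtain c where c: "card (colourings C G.M) = c" "card (colourings C H.M) = c" by simp
  define d e where "d = card G.X" and "e = card H.X"
  have cd: "2 * 2 ^ (d * card I) = c * 2 ^ d" and ce: "2 * 2 ^ (e * card I) = c * 2 ^ e"
    using G.card_colourings H.card_colourings unfolding c d_def e_def by simp_all
  have "2 * 2 ^ (d * card I) * 2 ^ e = 2 * 2 ^ (e * card I) * (2::nat) ^ d"
    unfolding cd ce by (simp only: ac_simps)
  then have "(2::nat) ^ (d * card I + e) = 2 ^ (e * card I + d)" by (simp add: power_add)
  then have eq: "d * card I + e = e * card I + d" by simp
  \<comment> \<open>The number of colourings is 2 to the power \<open>(card I - 1) * d + 1\<close>.\<close>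
  have "d = e"
  proof -
    obtain m where m: "card I = m + 2" using I(2) by (intro that[of "card I - 2"]) simp
    have "d * (m + 1) = e * (m + 1)" using eq by (simp add: m)
    then show ?thesis unfolding mult_cancel2 by simp
  qed
  moreover have "real d * (\<Sum>i\<in>I. \<bar>\<rho> (G i)\<bar>) = real e * (\<Sum>i\<in>I. \<bar>\<rho> (H i)\<bar>)"
    using G.total_weight_eq[OF inv] H.total_weight_eq[OF inv] iso.total_weight_iso[of C \<rho>] by (simp add: d_def e_def)
  moreover have "d > 0" using G.card_X_pos by (simp add: d_def)
  ultimately show ?thesis by simp
qed

theorem free_products_not_commensurable:
  fixes G :: "'i \<Rightarrow> 'a monoid" and H :: "'i \<Rightarrow> 'a set" and C :: "'a monoid set"
  assumes one_ended: "\<And>Q. Q \<in> C \<Longrightarrow> one_ended_group Q"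
    and closed: "finite_index_closed C" and inv: "multiplicative_invariant C \<rho>"
    and nz: "\<And>Q. Q \<in> C \<Longrightarrow> \<rho> Q \<noteq> 0"
    and I: "finite I" "card I > 1"
    and G: "\<And>i. i \<in> I \<Longrightarrow> G i \<in> C"
    and H: "\<And>i. i \<in> I \<Longrightarrow> finite_index_subgroup (H i) (G i)" "\<And>i. i \<in> I \<Longrightarrow> H i \<noteq> carrier (G i)"
  shows "\<not> abstractly_commensurable (free_product I G) (free_product I (\<lambda>i. (G i)\<lparr>carrier := H i\<rparr>))"
proof
  assume comm: "abstractly_commensurable (free_product I G) (free_product I (\<lambda>i. (G i)\<lparr>carrier := H i\<rparr>))"
  have HC: "(G i)\<lparr>carrier := H i\<rparr> \<in> C" if "i \<in> I" for i
    using closed G H that by (auto simp: finite_index_closed_def)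
  have "\<bar>\<rho> (G i)\<bar> < \<bar>\<rho> ((G i)\<lparr>carrier := H i\<rparr>)\<bar>" if i: "i \<in> I" for i
  proof -
    interpret group "G i" using one_ended[OF G[OF i]] by (simp add: one_ended_group_def)
    have sub: "subgroup (H i) (G i)" and fin: "finite (rcosets\<^bsub>G i\<^esub> (H i))"
      using H(1)[OF i] by (auto simp: finite_index_subgroup_def)
    obtain g where g: "g \<in> carrier (G i)" "g \<notin> H i"
      using H(2)[OF i] subgroup.subset[OF sub] by blast
    have "H i #>\<^bsub>G i\<^esub> g \<noteq> H i #>\<^bsub>G i\<^esub> \<one>\<^bsub>G i\<^esub>"
      using r_coset_eq_iff[OF sub g(1) one_closed] g by simp
    moreover have "{H i #>\<^bsub>G i\<^esub> g, H i #>\<^bsub>G i\<^esub> \<one>\<^bsub>G i\<^esub>} \<subseteq> rcosets\<^bsub>G i\<^esub> (H i)"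
      using g rcosetsI[OF subgroup.subset[OF sub]] by auto
    ultimately have "2 \<le> subgroup_index (G i) (H i)"
      unfolding subgroup_index_def using card_mono[OF fin] by (metis card_2_iff)
    moreover have "\<rho> ((G i)\<lparr>carrier := H i\<rparr>) = real (subgroup_index (G i) (H i)) * \<rho> (G i)"
      using inv G[OF i] H(1)[OF i] unfolding multiplicative_invariant_def by blast
    moreover have "\<bar>\<rho> (G i)\<bar> > 0" using nz[OF G[OF i]] by simp
    ultimately show ?thesis by (simp add: abs_mult)
  qed
  then have "(\<Sum>i\<in>I. \<bar>\<rho> (G i)\<bar>) < (\<Sum>i\<in>I. \<bar>\<rho> ((G i)\<lparr>carrier := H i\<rparr>)\<bar>)"
    using I by (intro sum_strict_mono) auto
  moreover have "(\<Sum>i\<in>I. \<bar>\<rho> (G i)\<bar>) = (\<Sum>i\<in>I. \<bar>\<rho> ((G i)\<lparr>carrier := H i\<rparr>)\<bar>)"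
    using commensurable_free_products[OF one_ended closed inv I G HC comm] .
  ultimately show False by simp
qed

section \<open>Bilipschitz bijections between groups\<close>

text \<open>
  Along edges labelled by \<open>s\<close> the map \<open>f\<close> has only finitely many displacements. As balls in a finitely generated
  group are finite, this is a Lipschitz condition that does not mention generating sets, and no constants have to be
  tracked.
\<close>

definition coarse :: "('a, 'm) monoid_scheme \<Rightarrow> ('b, 'n) monoid_scheme \<Rightarrow> ('a \<Rightarrow> 'b) \<Rightarrow> 'a \<Rightarrow> bool" where
  "coarse G H f s \<longleftrightarrow> (\<exists>D. finite D \<and> (\<forall>x\<in>carrier G. inv\<^bsub>H\<^esub> (f x) \<otimes>\<^bsub>H\<^esub> f (x \<otimes>\<^bsub>G\<^esub> s) \<in> D))"

lemma coarse_mult: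
  assumes "group G" "group H" "f \<in> carrier G \<rightarrow> carrier H" "s \<in> carrier G" "t \<in> carrier G"
    and "coarse G H f s" "coarse G H f t"
  shows "coarse G H f (s \<otimes>\<^bsub>G\<^esub> t)"
proof -
  interpret G: group G by fact
  interpret H: group H by fact
  obtain D E where D: "finite D" "\<And>x. x \<in> carrier G \<Longrightarrow> inv\<^bsub>H\<^esub> (f x) \<otimes>\<^bsub>H\<^esub> f (x \<otimes>\<^bsub>G\<^esub> s) \<in> D"
    and E: "finite E" "\<And>x. x \<in> carrier G \<Longrightarrow> inv\<^bsub>H\<^esub> (f x) \<otimes>\<^bsub>H\<^esub> f (x \<otimes>\<^bsub>G\<^esub> t) \<in> E"
    using assms(6,7) unfolding coarse_def by blast
  have "inv\<^bsub>H\<^esub> (f x) \<otimes>\<^bsub>H\<^esub> f (x \<otimes>\<^bsub>G\<^esub> (s \<otimes>\<^bsub>G\<^esub> t)) \<in> (\<lambda>(d, e). d \<otimes>\<^bsub>H\<^esub> e) ` (D \<times> E)" if x: "x \<in> carrier G" for x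
  proof -
    have c: "f x \<in> carrier H" "f (x \<otimes>\<^bsub>G\<^esub> s) \<in> carrier H" "f (x \<otimes>\<^bsub>G\<^esub> s \<otimes>\<^bsub>G\<^esub> t) \<in> carrier H"
      using assms x by auto
    have "inv\<^bsub>H\<^esub> (f x) \<otimes>\<^bsub>H\<^esub> f (x \<otimes>\<^bsub>G\<^esub> (s \<otimes>\<^bsub>G\<^esub> t)) =
      (inv\<^bsub>H\<^esub> (f x) \<otimes>\<^bsub>H\<^esub> f (x \<otimes>\<^bsub>G\<^esub> s)) \<otimes>\<^bsub>H\<^esub> (inv\<^bsub>H\<^esub> (f (x \<otimes>\<^bsub>G\<^esub> s)) \<otimes>\<^bsub>H\<^esub> f (x \<otimes>\<^bsub>G\<^esub> s \<otimes>\<^bsub>G\<^esub> t))"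
      using c x assms(4,5) H.m_assoc[of "f (x \<otimes>\<^bsub>G\<^esub> s)" "inv\<^bsub>H\<^esub> (f (x \<otimes>\<^bsub>G\<^esub> s))" "f (x \<otimes>\<^bsub>G\<^esub> s \<otimes>\<^bsub>G\<^esub> t)"]
      by (simp add: G.m_assoc H.m_assoc)
    then show ?thesis using D(2)[OF x] E(2)[of "x \<otimes>\<^bsub>G\<^esub> s"] x assms(4) by force
  qed
  then show ?thesis unfolding coarse_def using D(1) E(1)
    by (intro exI[of _ "(\<lambda>(d, e). d \<otimes>\<^bsub>H\<^esub> e) ` (D \<times> E)"]) auto
qed

context group
begin

lemma word_length_le:
  assumes "set ws \<subseteq> S \<union> m_inv G ` S" "x = foldr (\<otimes>) ws \<one>"
  shows "word_length G S x \<le> length ws"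
  unfolding word_length_def by (rule Least_le) (use assms in blast)

lemma word_length_word:
  assumes "finite_generating_set G S" "x \<in> carrier G"
  obtains ws where "set ws \<subseteq> S \<union> m_inv G ` S" "x = foldr (\<otimes>) ws \<one>" "length ws = word_length G S x"
proof -
  have "\<exists>k ws. length ws = k \<and> set ws \<subseteq> S \<union> m_inv G ` S \<and> x = foldr (\<otimes>) ws \<one>"
    using generate_as_words[of S x] assms by (auto simp: finite_generating_set_def)
  then have "\<exists>ws. length ws = word_length G S x \<and> set ws \<subseteq> S \<union> m_inv G ` S \<and> x = foldr (\<otimes>) ws \<one>"
    unfolding word_length_def by (rule LeastI_ex)
  then show ?thesis using that by blast
qed

lemma word_length_one: "word_length G S \<one> = 0"
  using word_length_le[of "[]" S \<one>] by simp

lemma word_length_mult: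
  assumes S: "finite_generating_set G S" and xy: "x \<in> carrier G" "y \<in> carrier G"
  shows "word_length G S (x \<otimes> y) \<le> word_length G S x + word_length G S y"
proof -
  obtain us where us: "set us \<subseteq> S \<union> m_inv G ` S" "x = foldr (\<otimes>) us \<one>" "length us = word_length G S x"
    using word_length_word[OF S xy(1)] .
  obtain vs where vs: "set vs \<subseteq> S \<union> m_inv G ` S" "y = foldr (\<otimes>) vs \<one>" "length vs = word_length G S y"
    using word_length_word[OF S xy(2)] .
  have "S \<union> m_inv G ` S \<subseteq> carrier G" using S by (auto simp: finite_generating_set_def)
  then have "set us \<subseteq> carrier G" "set vs \<subseteq> carrier G" using us(1) vs(1) by blast+
  then have "x \<otimes> y = foldr (\<otimes>) (us @ vs) \<one>" using us vs foldr_mult_append[of us vs] by simp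
  then show ?thesis using word_length_le[of "us @ vs" S "x \<otimes> y"] us vs by simp
qed

end

lemma coarse_imp_Lipschitz:
  assumes "group G" "group H" and S: "finite_generating_set G S" and T: "finite_generating_set H T"
    and f: "f \<in> carrier G \<rightarrow> carrier H"
    and coarse: "\<And>s. s \<in> carrier G \<Longrightarrow> coarse G H f s"
  obtains k :: nat where
    "\<And>x y. x \<in> carrier G \<Longrightarrow> y \<in> carrier G \<Longrightarrow> word_dist H T (f x) (f y) \<le> real k * word_dist G S x y"
proof -
  interpret G: group G by fact
  interpret H: group H by fact
  let ?S = "S \<union> m_inv G ` S"
  have S': "finite ?S" "?S \<subseteq> carrier G" using S by (auto simp: finite_generating_set_def)
  have "\<forall>s\<in>?S. \<exists>D. finite D \<and> (\<forall>x\<in>carrier G. inv\<^bsub>H\<^esub> (f x) \<otimes>\<^bsub>H\<^esub> f (x \<otimes>\<^bsub>G\<^esub> s) \<in> D)"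
    using coarse S' unfolding coarse_def by blast
  then obtain D where D: "\<And>s. s \<in> ?S \<Longrightarrow> finite (D s)"
    "\<And>s x. s \<in> ?S \<Longrightarrow> x \<in> carrier G \<Longrightarrow> inv\<^bsub>H\<^esub> (f x) \<otimes>\<^bsub>H\<^esub> f (x \<otimes>\<^bsub>G\<^esub> s) \<in> D s" by metis
  define k where "k = Max (word_length H T ` (\<Union>s\<in>?S. D s))"
  have step: "word_length H T (inv\<^bsub>H\<^esub> (f x) \<otimes>\<^bsub>H\<^esub> f (x \<otimes>\<^bsub>G\<^esub> s)) \<le> k" if "s \<in> ?S" "x \<in> carrier G" for s x
    unfolding k_def using D(1) D(2)[OF that] S'(1) that(1) by (intro Max_ge) blast+
  have words: "word_length H T (inv\<^bsub>H\<^esub> (f x) \<otimes>\<^bsub>H\<^esub> f (x \<otimes>\<^bsub>G\<^esub> foldr (\<otimes>\<^bsub>G\<^esub>) ws \<one>\<^bsub>G\<^esub>)) \<le> k * length ws"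
    if "set ws \<subseteq> ?S" "x \<in> carrier G" for ws x
    using that
  proof (induction ws arbitrary: x)
    case Nil
    then have "f x \<in> carrier H" using f by blast
    then show ?case using Nil by (simp add: H.word_length_one)
  next
    case (Cons s ws)
    let ?w = "foldr (\<otimes>\<^bsub>G\<^esub>) ws \<one>\<^bsub>G\<^esub>"
    have c: "s \<in> carrier G" "?w \<in> carrier G" using Cons.prems S' G.foldr_mult_closed[of ws] by auto
    have xs: "x \<otimes>\<^bsub>G\<^esub> s \<in> carrier G" using c Cons.prems by simp
    have fc: "f x \<in> carrier H" "f (x \<otimes>\<^bsub>G\<^esub> s) \<in> carrier H" "f (x \<otimes>\<^bsub>G\<^esub> s \<otimes>\<^bsub>G\<^esub> ?w) \<in> carrier H"
      using f c xs Cons.prems by auto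
    have "inv\<^bsub>H\<^esub> (f x) \<otimes>\<^bsub>H\<^esub> f (x \<otimes>\<^bsub>G\<^esub> foldr (\<otimes>\<^bsub>G\<^esub>) (s # ws) \<one>\<^bsub>G\<^esub>) =
      (inv\<^bsub>H\<^esub> (f x) \<otimes>\<^bsub>H\<^esub> f (x \<otimes>\<^bsub>G\<^esub> s)) \<otimes>\<^bsub>H\<^esub> (inv\<^bsub>H\<^esub> (f (x \<otimes>\<^bsub>G\<^esub> s)) \<otimes>\<^bsub>H\<^esub> f (x \<otimes>\<^bsub>G\<^esub> s \<otimes>\<^bsub>G\<^esub> ?w))"
      using c Cons.prems fc H.m_assoc[of "f (x \<otimes>\<^bsub>G\<^esub> s)" "inv\<^bsub>H\<^esub> (f (x \<otimes>\<^bsub>G\<^esub> s))" "f (x \<otimes>\<^bsub>G\<^esub> s \<otimes>\<^bsub>G\<^esub> ?w)"]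
      by (simp add: G.m_assoc H.m_assoc)
    then have "word_length H T (inv\<^bsub>H\<^esub> (f x) \<otimes>\<^bsub>H\<^esub> f (x \<otimes>\<^bsub>G\<^esub> foldr (\<otimes>\<^bsub>G\<^esub>) (s # ws) \<one>\<^bsub>G\<^esub>)) \<le>
      word_length H T (inv\<^bsub>H\<^esub> (f x) \<otimes>\<^bsub>H\<^esub> f (x \<otimes>\<^bsub>G\<^esub> s)) +
      word_length H T (inv\<^bsub>H\<^esub> (f (x \<otimes>\<^bsub>G\<^esub> s)) \<otimes>\<^bsub>H\<^esub> f (x \<otimes>\<^bsub>G\<^esub> s \<otimes>\<^bsub>G\<^esub> ?w))"
      using H.word_length_mult[OF T] fc by simp
    also have "\<dots> \<le> k + k * length ws"
      using step[of s x] Cons.IH[OF _ xs] Cons.prems by (intro add_mono) auto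
    finally show ?case by simp
  qed
  show ?thesis
  proof (rule that[of k])
    fix x y assume xy: "x \<in> carrier G" "y \<in> carrier G"
    have "inv\<^bsub>G\<^esub> x \<otimes>\<^bsub>G\<^esub> y \<in> carrier G" using xy by simp
    then obtain ws where ws: "set ws \<subseteq> ?S" "inv\<^bsub>G\<^esub> x \<otimes>\<^bsub>G\<^esub> y = foldr (\<otimes>\<^bsub>G\<^esub>) ws \<one>\<^bsub>G\<^esub>"
      "length ws = word_length G S (inv\<^bsub>G\<^esub> x \<otimes>\<^bsub>G\<^esub> y)" using G.word_length_word[OF S] by metis
    have "x \<otimes>\<^bsub>G\<^esub> foldr (\<otimes>\<^bsub>G\<^esub>) ws \<one>\<^bsub>G\<^esub> = y" using xy by (simp flip: ws(2) G.m_assoc)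
    then have "word_length H T (inv\<^bsub>H\<^esub> (f x) \<otimes>\<^bsub>H\<^esub> f y) \<le> k * word_length G S (inv\<^bsub>G\<^esub> x \<otimes>\<^bsub>G\<^esub> y)"
      using words[OF ws(1) xy(1)] ws(3) by simp
    then show "word_dist H T (f x) (f y) \<le> real k * word_dist G S x y"
      unfolding word_dist_def by (metis of_nat_le_iff of_nat_mult)
  qed
qed

theorem coarse_bijection_quasi_isometric:
  assumes "group G" "group H" "\<exists>S. finite_generating_set G S" "\<exists>T. finite_generating_set H T"
    and f: "f \<in> carrier G \<rightarrow> carrier H" and g: "g \<in> carrier H \<rightarrow> carrier G"
    and gf: "\<And>x. x \<in> carrier G \<Longrightarrow> g (f x) = x" and fg: "\<And>y. y \<in> carrier H \<Longrightarrow> f (g y) = y"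
    and cf: "\<And>s. s \<in> carrier G \<Longrightarrow> coarse G H f s" and cg: "\<And>t. t \<in> carrier H \<Longrightarrow> coarse H G g t"
  shows "quasi_isometric_groups G H"
proof -
  interpret H: group H by fact
  have "quasi_isometric_spaces (carrier G) (word_dist G S) (carrier H) (word_dist H T)"
    if ST: "finite_generating_set G S" "finite_generating_set H T" for S T
  proof -
    obtain k where k: "\<And>x y. x \<in> carrier G \<Longrightarrow> y \<in> carrier G \<Longrightarrow>
        word_dist H T (f x) (f y) \<le> real k * word_dist G S x y"
      using coarse_imp_Lipschitz[OF assms(1,2) ST f cf] by metis
    obtain l where l: "\<And>x y. x \<in> carrier H \<Longrightarrow> y \<in> carrier H \<Longrightarrow>
        word_dist G S (g x) (g y) \<le> real l * word_dist H T x y"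
      using coarse_imp_Lipschitz[OF assms(2,1) ST(2,1) g cg] by metis
    define c where "c = real (Suc (k + l))"
    have c: "c \<ge> 1" "real k \<le> c" "real l \<le> c" by (auto simp: c_def)
    have upper: "word_dist H T (f x) (f y) \<le> c * word_dist G S x y" if "x \<in> carrier G" "y \<in> carrier G" for x y
      using k[OF that] c(2) mult_right_mono[of "real k" c "word_dist G S x y"] by (simp add: word_dist_def)
    have lower: "word_dist G S x y / c \<le> word_dist H T (f x) (f y)" if "x \<in> carrier G" "y \<in> carrier G" for x y
    proof -
      have "word_dist G S x y \<le> real l * word_dist H T (f x) (f y)"
        using l[of "f x" "f y"] f gf that by auto
      also have "\<dots> \<le> c * word_dist H T (f x) (f y)"
        using c(3) by (intro mult_right_mono) (auto simp: word_dist_def)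
      finally show ?thesis using c(1) by (simp add: divide_le_eq mult.commute)
    qed
    have "\<exists>x\<in>carrier G. word_dist H T (f x) y \<le> 0" if y: "y \<in> carrier H" for y
    proof
      show "word_dist H T (f (g y)) y \<le> 0" using fg[OF y] y by (simp add: word_dist_def H.word_length_one)
    qed (use g y in blast)
    then show ?thesis
      unfolding quasi_isometric_spaces_def using upper lower c(1) f
      by (intro bexI[of _ f] exI[of _ c] conjI exI[of _ 0]) auto
  qed
  then show ?thesis using assms(3,4) by (simp add: quasi_isometric_groups_def)
qed

context free_product_of_groups
begin

lemma finitely_generated:
  assumes "finite I" and gen: "\<And>i. i \<in> I \<Longrightarrow> \<exists>S. finite_generating_set (\<Gamma> i) S"
  shows "\<exists>S. finite_generating_set P S"
proof -
  obtain S where S: "\<And>i. i \<in> I \<Longrightarrow> finite_generating_set (\<Gamma> i) (S i)" using gen by metis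
  let ?T = "\<Union>i\<in>I. letter i ` S i"
  have T: "finite ?T" "?T \<subseteq> carrier P"
    using S assms(1) letter_in_P unfolding finite_generating_set_def by (auto simp: subset_iff)
  have letters: "letter i g \<in> generate P ?T" if i: "i \<in> I" and g: "g \<in> carrier (\<Gamma> i)" for i g
  proof -
    interpret h: group_hom "\<Gamma> i" P "letter i" using letter_group_hom i .
    have Si: "S i \<subseteq> carrier (\<Gamma> i)" "generate (\<Gamma> i) (S i) = carrier (\<Gamma> i)"
      using S[OF i] by (auto simp: finite_generating_set_def)
    have "letter i g \<in> generate P (letter i ` S i)" using h.generate_img[OF Si(1)] Si g by auto
    moreover have "letter i ` S i \<subseteq> ?T" using i by blast
    ultimately show ?thesis using P.mono_generate by blast
  qed
  have "w \<in> generate P ?T" if "w \<in> carrier P" for w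
    using that
  proof (induction w rule: P_letter_induct)
    case one
    then show ?case using generate.one[of P ?T] by (simp add: one_P)
  next
    case (mult u i g)
    then show ?case using snoc_eq_mult[of u i g] generate.eng[OF _ letters] by (simp add: snoc_in_P)
  qed
  then have "generate P ?T = carrier P" using P.generate_incl[OF T(2)] by blast
  then show ?thesis using T unfolding finite_generating_set_def by blast
qed

text \<open>
  The condition passes to products of elements, and so it need only be checked on letters.
\<close>

lemma coarse_of_letters:
  assumes "group Q" and f: "f \<in> carrier P \<rightarrow> carrier Q"
    and letters: "\<And>i g. i \<in> I \<Longrightarrow> g \<in> carrier (\<Gamma> i) \<Longrightarrow> coarse P Q f (letter i g)"
    and s: "s \<in> carrier P"
  shows "coarse P Q f s"
  using s
proof (induction s rule: P_letter_induct)
  case one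
  interpret Q: group Q by fact
  have "inv\<^bsub>Q\<^esub> (f x) \<otimes>\<^bsub>Q\<^esub> f (x \<cdot> []) = \<one>\<^bsub>Q\<^esub>" if "x \<in> carrier P" for x
    using that Q.l_inv[OF funcset_mem[OF f that]] by simp
  then show ?case unfolding coarse_def by (intro exI[of _ "{\<one>\<^bsub>Q\<^esub>}"]) simp
next
  case (mult u i g)
  then show ?case
    using coarse_mult[OF group_P assms(1) f, of u "letter i g"] letters letter_in_P snoc_eq_mult[of u i g]
    by (simp add: snoc_in_P)
qed

end

section \<open>Rearranging a free product over subgroups of its factors\<close>

text \<open>
  Data for a bijection from the free product \<open>Q\<close> of subgroups \<open>H i\<close> to the free product of the groups \<open>\<Gamma> i\<close>. The nontrivial
  elements of \<open>\<Gamma> i\<close> are distributed over those of \<open>H i\<close>: the list \<open>block i f h\<close> contains the elements assigned to \<open>h\<close>,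
  all of them close to \<open>h\<close>. There are two distributions. The second one, for \<open>f = True\<close>, leaves the
  element \<open>a i\<close> without a block; it is for the case that the position of \<open>a i\<close> is required for an element from
  elsewhere. The elements \<open>\<sigma> i k\<close> label the positions across which elements are handed on; they have to avoid \<open>a i\<close>, as
  the arguments below use that what is placed at them is taken from their own block.
\<close>

locale rearrangement = free_product_of_groups I \<Gamma>
  for I :: "'i set" and \<Gamma> :: "'i \<Rightarrow> ('a, 'm) monoid_scheme" +
  fixes H :: "'i \<Rightarrow> 'a set" and nx :: "'i \<Rightarrow> 'i" and a :: "'i \<Rightarrow> 'a" and \<sigma> :: "'i \<Rightarrow> nat \<Rightarrow> 'a"
    and block :: "'i \<Rightarrow> bool \<Rightarrow> 'a \<Rightarrow> 'a list" and \<Delta> :: "'i \<Rightarrow> 'a set" and N :: "'i \<Rightarrow> nat"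
  assumes finite_I: "finite I"
    and H: "i \<in> I \<Longrightarrow> subgroup (H i) (\<Gamma> i)"
    and nx: "i \<in> I \<Longrightarrow> nx i \<in> I" "i \<in> I \<Longrightarrow> nx i \<noteq> i"
    and a: "i \<in> I \<Longrightarrow> a i \<in> H i - {\<one>\<^bsub>\<Gamma> i\<^esub>}"
    and \<sigma>: "i \<in> I \<Longrightarrow> \<sigma> i k \<in> H i - {\<one>\<^bsub>\<Gamma> i\<^esub>, a i}" and \<sigma>_inj: "i \<in> I \<Longrightarrow> inj (\<sigma> i)"
    and block_empty: "i \<in> I \<Longrightarrow> h \<in> H i - {\<one>\<^bsub>\<Gamma> i\<^esub>} \<Longrightarrow> block i f h = [] \<longleftrightarrow> f \<and> h = a i"
    and block_in: "i \<in> I \<Longrightarrow> h \<in> H i - {\<one>\<^bsub>\<Gamma> i\<^esub>} \<Longrightarrow> set (block i f h) \<subseteq> carrier (\<Gamma> i) - {\<one>\<^bsub>\<Gamma> i\<^esub>}"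
    and block_length: "i \<in> I \<Longrightarrow> h \<in> H i - {\<one>\<^bsub>\<Gamma> i\<^esub>} \<Longrightarrow> length (block i f h) \<le> N i"
    and block_near: "i \<in> I \<Longrightarrow> h \<in> H i - {\<one>\<^bsub>\<Gamma> i\<^esub>} \<Longrightarrow> g \<in> set (block i f h) \<Longrightarrow> inv\<^bsub>\<Gamma> i\<^esub> h \<otimes>\<^bsub>\<Gamma> i\<^esub> g \<in> \<Delta> i"
    and finite_\<Delta>: "i \<in> I \<Longrightarrow> finite (\<Delta> i)"
    and block_unique: "i \<in> I \<Longrightarrow> g \<in> carrier (\<Gamma> i) - {\<one>\<^bsub>\<Gamma> i\<^esub>} \<Longrightarrow>
      \<exists>!p. fst p \<in> H i - {\<one>\<^bsub>\<Gamma> i\<^esub>} \<and> snd p < length (block i f (fst p)) \<and> block i f (fst p) ! snd p = g"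
begin

abbreviation \<Gamma>H where "\<Gamma>H \<equiv> \<lambda>i. (\<Gamma> i)\<lparr>carrier := H i\<rparr>"

sublocale H: free_product_of_groups I \<Gamma>H
  by (rule free_product_of_groups.intro) (rule subgroup.subgroup_is_group[OF H factor_group])

abbreviation Q where "Q \<equiv> free_product I \<Gamma>H"

lemma letter_H: "H.letter i g = letter i g"
  by (simp add: H.letter_def letter_def)

lemma H_in: "i \<in> I \<Longrightarrow> h \<in> H i \<Longrightarrow> h \<in> carrier (\<Gamma> i)"
  using subgroup.mem_carrier[OF H] .

text \<open>
  The place of \<open>g\<close> in the distribution: the element of \<open>H i\<close> whose block contains it and its index in the block.
\<close>

definition pos where
  "pos f i g = (THE p. fst p \<in> H i - {\<one>\<^bsub>\<Gamma> i\<^esub>} \<and> snd p < length (block i f (fst p)) \<and> block i f (fst p) ! snd p = g)"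

lemma pos:
  assumes "i \<in> I" "g \<in> carrier (\<Gamma> i) - {\<one>\<^bsub>\<Gamma> i\<^esub>}" "pos f i g = (h, k)"
  shows "h \<in> H i - {\<one>\<^bsub>\<Gamma> i\<^esub>}" "k < length (block i f h)" "block i f h ! k = g"
  using theI'[OF block_unique[OF assms(1,2), of f]] assms(3) by (auto simp: pos_def)

lemma pos_eq:
  assumes "i \<in> I" "h \<in> H i - {\<one>\<^bsub>\<Gamma> i\<^esub>}" "k < length (block i f h)"
  shows "pos f i (block i f h ! k) = (h, k)"
proof -
  have "block i f h ! k \<in> carrier (\<Gamma> i) - {\<one>\<^bsub>\<Gamma> i\<^esub>}" using block_in[OF assms(1,2)] nth_mem[OF assms(3)] by blast
  from the1_equality[OF block_unique[OF assms(1) this, of f], of "(h, k)"] show ?thesis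
    using assms by (simp add: pos_def)
qed

definition flagged :: "('i \<times> 'a) list option \<Rightarrow> 'i \<Rightarrow> bool" where
  "flagged passing i \<longleftrightarrow> (case passing of None \<Rightarrow> False | Some e \<Rightarrow> fst (last e) = i)"

text \<open>
  The state at a word \<open>w\<close> of \<open>Q\<close> consists of the element placed at \<open>w\<close>, the list of elements that wait at \<open>w\<close>, and
  possibly one element that passes through \<open>w\<close>. Let \<open>v\<close> be placed at \<open>w\<close>. The block of \<open>h\<close>, translated by \<open>v\<close>, is
  available at the word \<open>w @ [(i, h)]\<close>: the head of the block is placed there, the rest waits there.

  Only an element ending with type \<open>i\<close> may be placed at a word ending with type \<open>i\<close>, for it has to have the same
  types of continuations. Therefore the element with index \<open>k\<close> waiting at a word with last type \<open>i\<close> first passes through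
  the continuation of this word by \<open>\<sigma> (nx i) k\<close>, where another type \<open>nx i\<close> is appended. From there it comes to the
  position of \<open>a i\<close>; the condition \<open>flagged\<close> says that this happens, and then the second distribution
  is used for the other letters of type \<open>i\<close>.

  Elements that wait are thus always in a common translated block with the one that is placed. The element passing
  through displaces only elements that stay close to others of their own kind. This is why
  displacements do not add up along a word.
\<close>

fun next_state :: "('i \<times> 'a) list \<times> ('i \<times> 'a) list list \<times> ('i \<times> 'a) list option \<Rightarrow> 'i option \<Rightarrow> 'i \<times> 'a
    \<Rightarrow> ('i \<times> 'a) list \<times> ('i \<times> 'a) list list \<times> ('i \<times> 'a) list option" where
  "next_state (v, waiting, passing) j (i, h) =
    (if flagged passing i \<and> h = a i then the passing else v @ [(i, hd (block i (flagged passing i) h))],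
     if flagged passing i \<and> h = a i then [] else map (\<lambda>g. v @ [(i, g)]) (tl (block i (flagged passing i) h)),
     if (\<exists>j'. j = Some j' \<and> i = nx j') \<and> (\<exists>k<length waiting. h = \<sigma> i k) then Some (waiting ! (THE k. h = \<sigma> i k)) else None)"

text \<open>
  Words are processed from left to right, hence they are reversed for the recursion.
\<close>

fun state where
  "state [] = ([], [], None)"
| "state (p # r) = next_state (state r) (if r = [] then None else Some (fst (hd r))) p"

definition arrange where "arrange w = fst (state (rev w))"
definition waiting where "waiting w = fst (snd (state (rev w)))"
definition passing where "passing w = snd (snd (state (rev w)))"

lemma arrange_Nil [simp]: "arrange [] = []" and waiting_Nil [simp]: "waiting [] = []" and passing_Nil [simp]: "passing [] = None"
  by (simp_all add: arrange_def waiting_def passing_def)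

lemma state_eq: "state (rev w) = (arrange w, waiting w, passing w)"
  by (simp add: arrange_def waiting_def passing_def)

lemma arrange_snoc: "arrange (u @ [(i, h)]) =
    (if flagged (passing u) i \<and> h = a i then the (passing u) else arrange u @ [(i, hd (block i (flagged (passing u) i) h))])"
  and waiting_snoc: "waiting (u @ [(i, h)]) =
    (if flagged (passing u) i \<and> h = a i then [] else map (\<lambda>g. arrange u @ [(i, g)]) (tl (block i (flagged (passing u) i) h)))"
  and passing_snoc: "passing (u @ [(i, h)]) =
    (if u \<noteq> [] \<and> i = nx (fst (last u)) \<and> (\<exists>k<length (waiting u). h = \<sigma> i k) then Some (waiting u ! (THE k. h = \<sigma> i k)) else None)"
  using state_eq[of u]
  by (auto simp: arrange_def[of "u @ _"] waiting_def[of "u @ _"] passing_def[of "u @ _"] hd_rev)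

lemma passing_slot:
  assumes "i \<in> I" "u \<noteq> []" "i = nx (fst (last u))" "k < length (waiting u)"
  shows "passing (u @ [(i, \<sigma> i k)]) = Some (waiting u ! k)"
proof -
  have "(THE k'. \<sigma> i k = \<sigma> i k') = k" using \<sigma>_inj[OF assms(1)] by (auto simp: inj_eq)
  then show ?thesis using assms by (auto simp: passing_snoc)
qed

lemma passing_SomeE:
  assumes "passing w = Some e" "w \<in> carrier Q"
  obtains u i k where "w = u @ [(i, \<sigma> i k)]" "u \<in> carrier Q" "u \<noteq> []" "i \<in> I" "i = nx (fst (last u))"
    "k < length (waiting u)" "e = waiting u ! k"
proof -
  obtain u i h where w: "w = u @ [(i, h)]" using assms(1) by (cases w rule: rev_cases) auto
  then have u: "u \<in> carrier Q" "i \<in> I" using assms(2) by (auto simp: H.snoc_in_P)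
  obtain k where k: "u \<noteq> []" "i = nx (fst (last u))" "k < length (waiting u)" "h = \<sigma> i k"
    using assms(1) by (auto simp: w passing_snoc split: if_splits)
  then have "e = waiting u ! k" using assms(1) passing_slot[OF u(2) k(1-3)] by (simp add: w)
  then show ?thesis using that w u k by blast
qed

text \<open>
  Words with the same end have the same types of continuations.
\<close>

definition same_end where
  "same_end v w \<longleftrightarrow> v = [] \<and> w = [] \<or> v \<noteq> [] \<and> w \<noteq> [] \<and> fst (last v) = fst (last w)"

lemma hd_block:
  assumes "i \<in> I" "h \<in> H i - {\<one>\<^bsub>\<Gamma> i\<^esub>}" "\<not> (f \<and> h = a i)"
  shows "hd (block i f h) \<in> set (block i f h)" "block i f h = hd (block i f h) # tl (block i f h)"
  using block_empty[OF assms(1,2), of f] assms(3) by (cases "block i f h"; auto)+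

lemma Q_induct [consumes 1, case_names one snoc]:
  assumes "w \<in> carrier Q" "X []"
    and "\<And>u i h. u \<in> carrier Q \<Longrightarrow> X u \<Longrightarrow> i \<in> I \<Longrightarrow> h \<in> H i - {\<one>\<^bsub>\<Gamma> i\<^esub>} \<Longrightarrow>
      u = [] \<or> fst (last u) \<noteq> i \<Longrightarrow> X (u @ [(i, h)])"
  shows "X w"
  using assms(1)
proof (induction w rule: H.P_letter_induct)
  case (mult u i g)
  then show ?case using assms(3)[of u i g] by simp
qed (rule assms(2))

lemma arrange_in_P:
  assumes "w \<in> carrier Q"
  shows "arrange w \<in> carrier P \<and> same_end (arrange w) w \<and>
    (\<forall>e\<in>set (waiting w). e \<in> carrier P \<and> same_end e w \<and> e \<noteq> []) \<and>
    (\<forall>e. passing w = Some e \<longrightarrow> e \<in> carrier P \<and> e \<noteq> [] \<and> fst (last e) \<noteq> fst (last w))"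
  using assms
proof (induction w rule: Q_induct)
  case (snoc u i h)
  have ext: "arrange u @ [(i, g)] \<in> carrier P" if "g \<in> set (block i f h)" for f g
    using snoc.IH snoc.hyps that block_in[of i h f] by (auto simp: snoc_in_P same_end_def)
  let ?f = "flagged (passing u) i"
  have "arrange (u @ [(i, h)]) \<in> carrier P \<and> same_end (arrange (u @ [(i, h)])) (u @ [(i, h)])"
  proof (cases "?f \<and> h = a i")
    case True
    then obtain e where "passing u = Some e" "fst (last e) = i" by (auto simp: flagged_def split: option.splits)
    then show ?thesis using True snoc.IH by (auto simp: arrange_snoc same_end_def)
  next
    case False
    then show ?thesis using ext[OF hd_block(1)[OF snoc.hyps(2,3) False]] by (auto simp: arrange_snoc same_end_def)
  qed
  moreover have "e \<in> carrier P \<and> same_end e (u @ [(i, h)]) \<and> e \<noteq> []" if "e \<in> set (waiting (u @ [(i, h)]))" for e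
  proof -
    obtain g where g: "g \<in> set (tl (block i ?f h))" "e = arrange u @ [(i, g)]"
      using \<open>e \<in> set (waiting (u @ [(i, h)]))\<close> by (auto simp: waiting_snoc split: if_splits)
    then have "g \<in> set (block i ?f h)" by (cases "block i ?f h") auto
    then show ?thesis using ext g by (simp add: same_end_def)
  qed
  moreover have "e \<in> carrier P \<and> e \<noteq> [] \<and> fst (last e) \<noteq> i" if "passing (u @ [(i, h)]) = Some e" for e
  proof -
    have "u @ [(i, h)] \<in> carrier Q" using snoc.hyps by (simp add: H.snoc_in_P)
    from passing_SomeE[OF that this] obtain k where "u \<noteq> []" "k < length (waiting u)" "e = waiting u ! k" by (metis append1_eq_conv)
    then have "e \<in> set (waiting u)" by simp
    then show ?thesis using snoc.IH snoc.hyps \<open>u \<noteq> []\<close> by (auto simp: same_end_def)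
  qed
  ultimately show ?case by simp
qed (simp add: same_end_def)

text \<open>
  The inverse map follows an element \<open>v @ [(i, g)]\<close> from the word \<open>x\<close> at which \<open>v\<close> is placed: \<open>g\<close> either heads
  its block, or it waits and is handed on to a word that is two letters longer.
\<close>

fun locate_rev where
  "locate_rev [] = []"
| "locate_rev ((i, g) # r) = (let x = locate_rev r; p = pos (flagged (passing x) i) i g; y = x @ [(i, fst p)] in
     if snd p = 0 then y else y @ [(nx i, \<sigma> (nx i) (snd p - 1)), (i, a i)])"

definition locate where "locate y = locate_rev (rev y)"

lemma locate_Nil [simp]: "locate [] = []" by (simp add: locate_def)

lemma locate_snoc: "locate (v @ [(i, g)]) =
    (let p = pos (flagged (passing (locate v)) i) i g; y = locate v @ [(i, fst p)] in
     if snd p = 0 then y else y @ [(nx i, \<sigma> (nx i) (snd p - 1)), (i, a i)])"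
  by (simp add: locate_def Let_def)

lemma slot_in_Q:
  assumes "w \<in> carrier Q" "w \<noteq> []" "i = fst (last w)" "i \<in> I"
  shows "w @ [(nx i, \<sigma> (nx i) k)] \<in> carrier Q" "w @ [(nx i, \<sigma> (nx i) k), (i, a i)] \<in> carrier Q"
proof -
  show 1: "w @ [(nx i, \<sigma> (nx i) k)] \<in> carrier Q"
    using assms nx[OF assms(4)] \<sigma>[OF nx(1)[OF assms(4)], of k] by (auto simp: H.snoc_in_P)
  then show "w @ [(nx i, \<sigma> (nx i) k), (i, a i)] \<in> carrier Q"
    using assms nx[OF assms(4)] a[OF assms(4)] H.snoc_in_P[of "w @ [(nx i, \<sigma> (nx i) k)]" i "a i"] by auto
qed

lemma locate_in_Q:
  assumes "y \<in> carrier P"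
  shows "locate y \<in> carrier Q \<and> same_end (locate y) y"
  using assms
proof (induction y rule: P_letter_induct)
  case (mult v i g)
  let ?f = "flagged (passing (locate v)) i"
  obtain h k where p: "pos ?f i g = (h, k)" by (cases "pos ?f i g")
  have h: "h \<in> H i - {\<one>\<^bsub>\<Gamma> i\<^esub>}" using pos[OF _ _ p] mult.hyps by simp
  then have y: "locate v @ [(i, h)] \<in> carrier Q"
    using mult by (auto simp: H.snoc_in_P same_end_def)
  then show ?case using slot_in_Q[OF y, of i "k - 1"] mult.hyps
    by (auto simp: locate_snoc p Let_def same_end_def)
qed (simp add: same_end_def)

text \<open>
  The statements about waiting and passing elements record where they are going to be placed; the first statement
  for longer words depends on them.
\<close>

lemma locate_arrange_aux:
  assumes "w \<in> carrier Q"
  shows "locate (arrange w) = w \<and>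
    (\<forall>k<length (waiting w). locate (waiting w ! k) =
       w @ [(nx (fst (last w)), \<sigma> (nx (fst (last w))) k), (fst (last w), a (fst (last w)))]) \<and>
    (\<forall>e. passing w = Some e \<longrightarrow> locate e = w @ [(fst (last e), a (fst (last e)))])"
  using assms
proof (induction w rule: Q_induct)
  case (snoc u i h)
  let ?f = "flagged (passing u) i" and ?w = "u @ [(i, h)]"
  have locate_block: "locate (arrange u @ [(i, block i ?f h ! k)]) =
      (if k = 0 then ?w else ?w @ [(nx i, \<sigma> (nx i) (k - 1)), (i, a i)])" if "k < length (block i ?f h)" for k
    using snoc.IH pos_eq[OF snoc.hyps(2,3) that] by (simp add: locate_snoc Let_def)
  have 1: "locate (arrange ?w) = ?w"
  proof (cases "?f \<and> h = a i")
    case True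
    then obtain e where "passing u = Some e" "fst (last e) = i" by (auto simp: flagged_def split: option.splits)
    then show ?thesis using True snoc.IH by (auto simp: arrange_snoc)
  next
    case False
    then have "block i ?f h \<noteq> []" using block_empty[OF snoc.hyps(2,3)] by simp
    then show ?thesis using False locate_block[of 0] by (auto simp: arrange_snoc hd_conv_nth)
  qed
  have 2: "locate (waiting ?w ! k) = ?w @ [(nx i, \<sigma> (nx i) k), (i, a i)]" if "k < length (waiting ?w)" for k
    using that locate_block[of "Suc k"] by (auto simp: waiting_snoc nth_tl split: if_splits)
  have 3: "locate e = ?w @ [(fst (last e), a (fst (last e)))]" if Fe: "passing ?w = Some e" for e
  proof -
    have wQ: "?w \<in> carrier Q" using snoc.hyps by (simp add: H.snoc_in_P)
    from passing_SomeE[OF Fe wQ] obtain k where k: "u \<noteq> []" "i = nx (fst (last u))" "k < length (waiting u)" "e = waiting u ! k"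
      "h = \<sigma> i k" by (metis append1_eq_conv prod.inject)
    have "fst (last e) = fst (last u)"
      using arrange_in_P[OF snoc.hyps(1)] k by (auto simp: same_end_def)
    then show ?thesis using snoc.IH k by auto
  qed
  show ?case using 1 2 3 by simp
qed simp

lemma locate_arrange: "w \<in> carrier Q \<Longrightarrow> locate (arrange w) = w"
  using locate_arrange_aux by blast

lemma arrange_locate:
  assumes "y \<in> carrier P"
  shows "arrange (locate y) = y"
  using assms
proof (induction y rule: P_letter_induct)
  case (mult v i g)
  let ?x = "locate v"
  let ?f = "flagged (passing ?x) i"
  obtain h k where p: "pos ?f i g = (h, k)" by (cases "pos ?f i g")
  have g: "g \<in> carrier (\<Gamma> i) - {\<one>\<^bsub>\<Gamma> i\<^esub>}" using mult.hyps by simp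
  note ph = pos[OF mult.hyps(2) g p]
  have nf: "\<not> (?f \<and> h = a i)" using block_empty[OF mult.hyps(2) ph(1), of ?f] ph(2) by auto
  let ?w = "?x @ [(i, h)]"
  show ?case
  proof (cases k)
    case 0
    then show ?thesis using ph mult.IH nf by (auto simp: locate_snoc p Let_def arrange_snoc hd_conv_nth)
  next
    case (Suc j)
    have "waiting ?w = map (\<lambda>g. v @ [(i, g)]) (tl (block i ?f h))"
      unfolding waiting_snoc mult.IH using nf by (simp only: if_False)
    moreover have "j < length (tl (block i ?f h))" "tl (block i ?f h) ! j = g"
      using ph(2,3) by (simp_all add: Suc nth_tl)
    ultimately have j: "j < length (waiting ?w)" "waiting ?w ! j = v @ [(i, g)]" by simp_all
    have "passing (?w @ [(nx i, \<sigma> (nx i) j)]) = Some (v @ [(i, g)])"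
      using passing_slot[OF nx(1)[OF mult.hyps(2)] _ _ j(1)] unfolding j(2) by simp
    then have "arrange ((?w @ [(nx i, \<sigma> (nx i) j)]) @ [(i, a i)]) = v @ [(i, g)]"
      by (subst arrange_snoc) (simp add: flagged_def)
    then show ?thesis using Suc by (simp add: locate_snoc p Let_def)
  qed
qed simp

lemma P_cancel:
  "x \<in> carrier P \<Longrightarrow> y \<in> carrier P \<Longrightarrow> inv\<^bsub>P\<^esub> x \<cdot> (x \<cdot> y) = y"
  "x \<in> carrier P \<Longrightarrow> y \<in> carrier P \<Longrightarrow> x \<cdot> (inv\<^bsub>P\<^esub> x \<cdot> y) = y"
  by (simp_all flip: P.m_assoc)

text \<open>
  Two elements of a common block are close to the same element of \<open>H i\<close>, and so their difference lies in this set.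
\<close>

definition spread :: "'i \<Rightarrow> 'a set" where
  "spread i = (\<lambda>(x, y). inv\<^bsub>\<Gamma> i\<^esub> x \<otimes>\<^bsub>\<Gamma> i\<^esub> y) ` ((\<Delta> i \<inter> carrier (\<Gamma> i)) \<times> (\<Delta> i \<inter> carrier (\<Gamma> i)))"

lemma spread: "i \<in> I \<Longrightarrow> finite (spread i)" "i \<in> I \<Longrightarrow> spread i \<subseteq> carrier (\<Gamma> i)"
proof -
  assume i: "i \<in> I"
  interpret group "\<Gamma> i" using factor_group i .
  show "finite (spread i)" "spread i \<subseteq> carrier (\<Gamma> i)" using finite_\<Delta>[OF i] by (auto simp: spread_def)
qed

lemma block_spread:
  assumes "i \<in> I" "h \<in> H i - {\<one>\<^bsub>\<Gamma> i\<^esub>}" "x \<in> set (block i f h)" "y \<in> set (block i f h)"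
  shows "inv\<^bsub>\<Gamma> i\<^esub> x \<otimes>\<^bsub>\<Gamma> i\<^esub> y \<in> spread i"
proof -
  interpret group "\<Gamma> i" using factor_group assms by blast
  have c: "h \<in> carrier (\<Gamma> i)" "x \<in> carrier (\<Gamma> i)" "y \<in> carrier (\<Gamma> i)"
    using H_in assms block_in[OF assms(1,2)] by auto
  have "inv\<^bsub>\<Gamma> i\<^esub> x \<otimes>\<^bsub>\<Gamma> i\<^esub> y = inv\<^bsub>\<Gamma> i\<^esub> (inv\<^bsub>\<Gamma> i\<^esub> h \<otimes>\<^bsub>\<Gamma> i\<^esub> x) \<otimes>\<^bsub>\<Gamma> i\<^esub> (inv\<^bsub>\<Gamma> i\<^esub> h \<otimes>\<^bsub>\<Gamma> i\<^esub> y)"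
    using c by (simp add: inv_mult_group m_assoc) (simp flip: m_assoc)
  then show ?thesis unfolding spread_def
    using block_near[OF assms(1,2,3)] block_near[OF assms(1,2,4)] c
    by (intro rev_image_eqI[of "(inv\<^bsub>\<Gamma> i\<^esub> h \<otimes>\<^bsub>\<Gamma> i\<^esub> x, inv\<^bsub>\<Gamma> i\<^esub> h \<otimes>\<^bsub>\<Gamma> i\<^esub> y)"]) auto
qed

text \<open>
  The difference between the natural and the actual element at the position of \<open>a i\<close> in the case \<open>flagged\<close>: back from
  \<open>a i\<close> and from the head of the block of \<open>\<sigma> (nx i) k\<close>, and then from the head of a block to one of its other elements.
\<close>

definition passing_error where
  "passing_error i k f d =
     inv\<^bsub>P\<^esub> (letter i (a i)) \<cdot> (inv\<^bsub>P\<^esub> (letter (nx i) (hd (block (nx i) f (\<sigma> (nx i) k)))) \<cdot> letter i d)"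

definition arrange_error where
  "arrange_error = {[]} \<union> (\<Union>i\<in>I. letter i ` (\<Delta> i \<inter> carrier (\<Gamma> i))) \<union>
    (\<Union>i\<in>I. \<Union>f. (\<lambda>(k, d). passing_error i k f d) ` ({..<N i} \<times> spread i))"

lemma arrange_errorI:
  "[] \<in> arrange_error"
  "i \<in> I \<Longrightarrow> d \<in> \<Delta> i \<inter> carrier (\<Gamma> i) \<Longrightarrow> letter i d \<in> arrange_error"
  "i \<in> I \<Longrightarrow> k < N i \<Longrightarrow> d \<in> spread i \<Longrightarrow> passing_error i k f d \<in> arrange_error"
  unfolding arrange_error_def
  by (rule UnI1, rule UnI1, rule singletonI) (rule UnI1, rule UnI2, erule UN_I, erule imageI,
    rule UnI2, erule UN_I, rule UN_I[OF UNIV_I], rule image_eqI[where x = "(k, d)"], simp, simp)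

lemma finite_arrange_error: "finite arrange_error"
  unfolding arrange_error_def using finite_I finite_\<Delta> spread by auto

lemma block_carrier:
  "i \<in> I \<Longrightarrow> h \<in> H i - {\<one>\<^bsub>\<Gamma> i\<^esub>} \<Longrightarrow> g \<in> set (block i f h) \<Longrightarrow> g \<in> carrier (\<Gamma> i) \<and> g \<noteq> \<one>\<^bsub>\<Gamma> i\<^esub>"
  using block_in by blast

lemma slot_letter_in_P:
  assumes "i \<in> I"
  shows "letter (nx i) (hd (block (nx i) f (\<sigma> (nx i) k))) \<in> carrier P"
proof -
  have j: "nx i \<in> I" using nx assms by blast
  have s: "\<sigma> (nx i) k \<in> H (nx i) - {\<one>\<^bsub>\<Gamma> (nx i)\<^esub>}" "\<sigma> (nx i) k \<noteq> a (nx i)" using \<sigma>[OF j] by auto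
  then show ?thesis using hd_block(1)[OF j s(1), of f] block_carrier[OF j s(1)] letter_in_P[OF j] by blast
qed

lemma arrange_end:
  assumes "w \<in> carrier Q"
  shows "arrange w \<in> carrier P" "same_end (arrange w) w"
  using conjunct1[OF arrange_in_P[OF assms]] conjunct1[OF conjunct2[OF arrange_in_P[OF assms]]] .

lemma arrange_snoc_natural:
  assumes u: "u \<in> carrier Q" "i \<in> I" "h \<in> H i - {\<one>\<^bsub>\<Gamma> i\<^esub>}" "u = [] \<or> fst (last u) \<noteq> i"
    and nf: "\<not> (flagged (passing u) i \<and> h = a i)" and g: "g \<in> set (block i (flagged (passing u) i) h)"
  shows "arrange u @ [(i, g)] \<in> carrier P" "arrange u @ [(i, g)] = arrange u \<cdot> letter i g"
proof -
  show "arrange u @ [(i, g)] \<in> carrier P"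
    using arrange_end[OF u(1)] u(2,4) block_carrier[OF u(2,3) g] by (auto simp: snoc_in_P same_end_def)
  then show "arrange u @ [(i, g)] = arrange u \<cdot> letter i g" by (rule snoc_eq_mult)
qed

text \<open>
  This is the bound on displacements: the element placed at the continuation of \<open>u\<close> by \<open>h\<close> differs from the
  continuation by \<open>h\<close> of the element placed at \<open>u\<close> by one of finitely many elements. In the case \<open>flagged\<close>, the element \<open>e\<close>
  placed there waited at the word \<open>w\<close> of which \<open>u\<close> is a continuation by one letter. Both \<open>e\<close> and the
  element placed at \<open>w\<close> come from one block, while the element placed at \<open>u\<close> arises from the one at \<open>w\<close> by
  appending the head of a block. That no earlier words enter keeps the set of differences finite.
\<close>

lemma arrange_close:
  assumes u: "u \<in> carrier Q" "i \<in> I" "h \<in> H i" "u = [] \<or> fst (last u) \<noteq> i"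
  shows "inv\<^bsub>P\<^esub> (arrange u \<cdot> letter i h) \<cdot> arrange (u \<otimes>\<^bsub>Q\<^esub> letter i h) \<in> arrange_error"
proof (cases "h = \<one>\<^bsub>\<Gamma> i\<^esub>")
  case True
  then have "inv\<^bsub>P\<^esub> (arrange u \<cdot> letter i h) \<cdot> arrange (u \<otimes>\<^bsub>Q\<^esub> letter i h) = \<one>\<^bsub>P\<^esub>"
    using arrange_end(1)[OF u(1)] u(1) by (simp add: H.mult_Nil)
  then show ?thesis by (simp add: one_P arrange_errorI(1))
next
  case False
  then have h: "h \<in> H i - {\<one>\<^bsub>\<Gamma> i\<^esub>}" using u by simp
  interpret i: group "\<Gamma> i" using factor_group u by blast
  have uh: "u @ [(i, h)] \<in> carrier Q" using u h by (simp add: H.snoc_in_P)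
  have uhQ: "u \<otimes>\<^bsub>Q\<^esub> letter i h = u @ [(i, h)]" using H.snoc_eq_mult[OF uh] by (simp add: letter_H)
  have bu: "arrange u \<in> carrier P" using arrange_end(1)[OF u(1)] .
  have lh: "letter i h \<in> carrier P" using H_in u letter_in_P by blast
  show ?thesis
  proof (cases "flagged (passing u) i \<and> h = a i")
    case nf: False
    let ?g = "hd (block i (flagged (passing u) i) h)"
    have g: "?g \<in> set (block i (flagged (passing u) i) h)" using hd_block(1)[OF u(2) h nf] .
    have gc: "?g \<in> carrier (\<Gamma> i)" using block_carrier[OF u(2) h g] by blast
    have "arrange (u @ [(i, h)]) = arrange u \<cdot> letter i ?g"
      using nf arrange_snoc_natural(2)[OF u(1,2) h u(4) nf g] by (subst arrange_snoc) auto
    then have "inv\<^bsub>P\<^esub> (arrange u \<cdot> letter i h) \<cdot> arrange (u @ [(i, h)]) = letter i (inv\<^bsub>\<Gamma> i\<^esub> h \<otimes>\<^bsub>\<Gamma> i\<^esub> ?g)"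
      using bu lh gc u H_in letter_in_P P_cancel
      by (simp add: P.inv_mult_group P.m_assoc inv_letter flip: letter_mult_letter)
    moreover have "inv\<^bsub>\<Gamma> i\<^esub> h \<otimes>\<^bsub>\<Gamma> i\<^esub> ?g \<in> \<Delta> i \<inter> carrier (\<Gamma> i)"
      using block_near[OF u(2) h g] gc H_in u by simp
    ultimately show ?thesis unfolding uhQ using arrange_errorI(2)[OF u(2)] by simp
  next
    case fl: True
    then obtain e where e: "passing u = Some e" "fst (last e) = i" by (auto simp: flagged_def split: option.splits)
    then have be: "arrange (u @ [(i, h)]) = e" using fl by (simp add: arrange_snoc)
    obtain w j k where w: "u = w @ [(j, \<sigma> j k)]" "w \<in> carrier Q" "w \<noteq> []" "j \<in> I" "j = nx (fst (last w))"
      "k < length (waiting w)" "e = waiting w ! k" using passing_SomeE[OF e(1) u(1)] .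
    have eD: "e \<in> set (waiting w)" using w by simp
    then have iw: "fst (last w) = i" using arrange_in_P[OF w(2)] e w(3) by (auto simp: same_end_def)
    have j: "j = nx i" using w iw by simp
    obtain x h0 where x: "w = x @ [(i, h0)]" using w(3) iw by (cases w rule: rev_cases) auto
    have xQ: "x \<in> carrier Q" "h0 \<in> H i - {\<one>\<^bsub>\<Gamma> i\<^esub>}" "x = [] \<or> fst (last x) \<noteq> i"
      using w(2) by (auto simp: x H.snoc_in_P)
    let ?f = "flagged (passing x) i"
    have nf: "\<not> (?f \<and> h0 = a i)" using eD by (auto simp: x waiting_snoc)
    have Dw: "waiting w = map (\<lambda>g. arrange x @ [(i, g)]) (tl (block i ?f h0))" unfolding x waiting_snoc using nf by (simp only: if_False)
    then obtain g where g: "g \<in> set (tl (block i ?f h0))" "e = arrange x @ [(i, g)]" using eD by auto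
    then have gL: "g \<in> set (block i ?f h0)" by (cases "block i ?f h0") auto
    let ?g0 = "hd (block i ?f h0)"
    have g0: "?g0 \<in> set (block i ?f h0)" using hd_block(1)[OF u(2) xQ(2) nf] .
    have bx: "arrange x \<in> carrier P" using arrange_end(1)[OF xQ(1)] .
    have gc: "g \<in> carrier (\<Gamma> i)" "?g0 \<in> carrier (\<Gamma> i)" using block_carrier[OF u(2) xQ(2)] gL g0 by auto
    have lg: "letter i g \<in> carrier P" "letter i ?g0 \<in> carrier P" using gc u letter_in_P by auto
    have eP: "e = arrange x \<cdot> letter i g"
      using arrange_snoc_natural(2)[OF xQ(1) u(2) xQ(2,3) nf gL] g by simp
    have bw: "arrange w = arrange x \<cdot> letter i ?g0"
      using nf arrange_snoc_natural(2)[OF xQ(1) u(2) xQ(2,3) nf g0] unfolding x by (subst arrange_snoc) auto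
    have k: "k < N i" using w(6) block_length[OF u(2) xQ(2), of ?f] Dw by simp
    let ?f' = "flagged (passing w) j"
    let ?s = "hd (block j ?f' (\<sigma> j k))"
    have s: "\<sigma> j k \<in> H j - {\<one>\<^bsub>\<Gamma> j\<^esub>}" "\<not> (?f' \<and> \<sigma> j k = a j)" using \<sigma>[OF w(4), of k] by auto
    have ij: "w = [] \<or> fst (last w) \<noteq> j" using iw j nx(2)[OF u(2)] by auto
    have sL: "?s \<in> set (block j ?f' (\<sigma> j k))" using hd_block(1)[OF w(4) s] .
    have "arrange u = arrange w \<cdot> letter j ?s"
      using s arrange_snoc_natural(2)[OF w(2,4) s(1) ij s(2) sL] unfolding w(1) by (subst arrange_snoc) auto
    moreover have ls: "letter j ?s \<in> carrier P" using slot_letter_in_P[OF u(2)] unfolding j .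
    moreover have "letter i (a i) \<in> carrier P" using a u H_in letter_in_P by blast
    ultimately have "inv\<^bsub>P\<^esub> (arrange u \<cdot> letter i h) \<cdot> e =
        inv\<^bsub>P\<^esub> (letter i (a i)) \<cdot> (inv\<^bsub>P\<^esub> (letter j ?s) \<cdot> letter i (inv\<^bsub>\<Gamma> i\<^esub> ?g0 \<otimes>\<^bsub>\<Gamma> i\<^esub> g))"
      using bx lg gc fl u letter_in_P P_cancel
      by (simp add: bw eP P.inv_mult_group P.m_assoc inv_letter flip: letter_mult_letter)
    moreover have "inv\<^bsub>\<Gamma> i\<^esub> ?g0 \<otimes>\<^bsub>\<Gamma> i\<^esub> g \<in> spread i" using block_spread[OF u(2) xQ(2) g0 gL] .
    ultimately show ?thesis unfolding uhQ be using arrange_errorI(3)[OF u(2) k, unfolded passing_error_def] unfolding j by simp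
  qed
qed

definition locate_error where
  "locate_error = insert [] (\<Union>i\<in>I. \<Union>k<N i. {[(nx i, \<sigma> (nx i) k), (i, a i)]})"

lemma finite_locate_error: "finite locate_error"
  unfolding locate_error_def using finite_I by auto

lemma locate_error_in_Q: "locate_error \<subseteq> carrier Q"
proof -
  have "[(nx i, \<sigma> (nx i) k), (i, a i)] \<in> carrier Q" if "i \<in> I" for i k
    using \<sigma>[OF nx(1)[OF that], of k] a[OF that] nx[OF that] that by (simp add: H.Cons_in_P)
  then show ?thesis by (auto simp: locate_error_def)
qed

text \<open>
  In the other direction the bound is immediate from the definition of \<open>locate\<close>.
\<close>

lemma locate_close:
  assumes v: "v \<in> carrier P" "i \<in> I" "g \<in> carrier (\<Gamma> i)" "v = [] \<or> fst (last v) \<noteq> i"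
  shows "\<exists>h\<in>H i. inv\<^bsub>\<Gamma> i\<^esub> h \<otimes>\<^bsub>\<Gamma> i\<^esub> g \<in> insert \<one>\<^bsub>\<Gamma> i\<^esub> (\<Delta> i) \<and>
    (\<exists>d\<in>locate_error. locate (v \<cdot> letter i g) = locate v \<otimes>\<^bsub>Q\<^esub> letter i h \<otimes>\<^bsub>Q\<^esub> d)"
proof (cases "g = \<one>\<^bsub>\<Gamma> i\<^esub>")
  case True
  interpret i: group "\<Gamma> i" using factor_group v by blast
  have "locate v \<in> carrier Q" using locate_in_Q v by blast
  then show ?thesis using True v subgroup.one_closed[OF H[OF v(2)]]
    by (intro bexI[of _ "\<one>\<^bsub>\<Gamma> i\<^esub>"] conjI bexI[of _ "[]"]) (auto simp: H.mult_Nil locate_error_def)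
next
  case False
  let ?x = "locate v"
  let ?f = "flagged (passing ?x) i"
  obtain h k where p: "pos ?f i g = (h, k)" by (cases "pos ?f i g")
  have g: "g \<in> carrier (\<Gamma> i) - {\<one>\<^bsub>\<Gamma> i\<^esub>}" using v False by simp
  note ph = pos[OF v(2) g p]
  have x: "?x \<in> carrier Q" "?x = [] \<or> fst (last ?x) \<noteq> i"
    using locate_in_Q[OF v(1)] v(4) by (auto simp: same_end_def)
  have xh: "?x @ [(i, h)] \<in> carrier Q" using x ph v by (auto simp: H.snoc_in_P)
  have gL: "g \<in> set (block i ?f h)" using ph(2,3) by auto
  have vg: "v \<cdot> letter i g = v @ [(i, g)]"
    using snoc_eq_mult[of v i g] v False by (simp add: snoc_in_P)
  have xhm: "?x \<otimes>\<^bsub>Q\<^esub> letter i h = ?x @ [(i, h)]" using H.snoc_eq_mult[OF xh] by (simp add: letter_H)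
  show ?thesis
  proof (rule bexI[of _ h], rule conjI)
    show "h \<in> H i" using ph by simp
    show "inv\<^bsub>\<Gamma> i\<^esub> h \<otimes>\<^bsub>\<Gamma> i\<^esub> g \<in> insert \<one>\<^bsub>\<Gamma> i\<^esub> (\<Delta> i)" using block_near[OF v(2) ph(1) gL] by simp
    show "\<exists>d\<in>locate_error. locate (v \<cdot> letter i g) = ?x \<otimes>\<^bsub>Q\<^esub> letter i h \<otimes>\<^bsub>Q\<^esub> d"
    proof (cases k)
      case 0
      then show ?thesis using xh
        by (intro bexI[of _ "[]"]) (simp_all add: vg xhm locate_snoc p Let_def H.mult_Nil locate_error_def)
    next
      case (Suc j)
      let ?d = "[(nx i, \<sigma> (nx i) j), (i, a i)]"
      have "j < N i" using block_length[OF v(2) ph(1), of ?f] ph(2) Suc by simp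
      then have d: "?d \<in> locate_error" using v(2) by (auto simp: locate_error_def)
      have "?x @ [(i, h)] @ ?d \<in> carrier Q"
        using slot_in_Q(2)[OF xh, of i j] v by simp
      then have "?x \<otimes>\<^bsub>Q\<^esub> letter i h \<otimes>\<^bsub>Q\<^esub> ?d = ?x @ [(i, h)] @ ?d"
        using H.mult_reduced[of "?x @ [(i, h)]" ?d] by (simp add: xhm)
      then show ?thesis using d Suc by (intro bexI[of _ ?d]) (simp_all add: vg locate_snoc p Let_def)
    qed
  qed
qed

lemma coarse_arrange:
  assumes s: "s \<in> carrier Q"
  shows "coarse Q P arrange s"
proof (rule H.coarse_of_letters[OF group_P _ _ s])
  show "arrange \<in> carrier Q \<rightarrow> carrier P" using arrange_end(1) by (rule funcsetI)
  fix i t assume i: "i \<in> I" and "t \<in> carrier (\<Gamma>H i)"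
  then have t: "t \<in> H i" by simp
  interpret i: group "\<Gamma> i" using factor_group i .
  let ?E = "(\<lambda>(x, y). inv\<^bsub>P\<^esub> x \<cdot> letter i t \<cdot> y) ` (arrange_error \<times> arrange_error)"
  have "inv\<^bsub>P\<^esub> (arrange w) \<cdot> arrange (w \<otimes>\<^bsub>Q\<^esub> letter i t) \<in> ?E" if w: "w \<in> carrier Q" for w
  proof -
    obtain h u y where h: "h \<in> carrier (\<Gamma>H i)" "u \<in> carrier Q" "u = [] \<or> fst (last u) \<noteq> i"
      "w = u \<otimes>\<^bsub>Q\<^esub> H.letter i h" "w = u @ y" using H.strip_last[OF w i] .
    have hH: "h \<in> H i" using h by simp
    have ht: "h \<otimes>\<^bsub>\<Gamma> i\<^esub> t \<in> H i" using hH t subgroup.m_closed[OF H[OF i]] by blast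
    have l: "letter i h \<in> carrier Q" "letter i t \<in> carrier Q"
      using H.letter_in_P[OF i, of h] H.letter_in_P[OF i, of t] hH t by (simp_all add: letter_H)
    have wt: "w \<otimes>\<^bsub>Q\<^esub> letter i t = u \<otimes>\<^bsub>Q\<^esub> letter i (h \<otimes>\<^bsub>\<Gamma> i\<^esub> t)"
      using H.letter_mult_letter[OF i, of h t] h hH t l by (simp add: H.P.m_assoc letter_H)
    define x where "x = inv\<^bsub>P\<^esub> (arrange u \<cdot> letter i h) \<cdot> arrange w"
    define z where "z = inv\<^bsub>P\<^esub> (arrange u \<cdot> letter i (h \<otimes>\<^bsub>\<Gamma> i\<^esub> t)) \<cdot> arrange (w \<otimes>\<^bsub>Q\<^esub> letter i t)"
    have "x \<in> arrange_error"
      using arrange_close[OF h(2) i hH h(3)] unfolding x_def h(4) letter_H .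
    moreover have "z \<in> arrange_error"
      using arrange_close[OF h(2) i ht h(3)] unfolding z_def wt .
    ultimately have xz: "x \<in> arrange_error" "z \<in> arrange_error" .
    have c: "arrange u \<in> carrier P" "letter i h \<in> carrier P" "letter i t \<in> carrier P" "arrange w \<in> carrier P"
      "arrange (w \<otimes>\<^bsub>Q\<^esub> letter i t) \<in> carrier P"
      using arrange_end(1)[OF h(2)] arrange_end(1)[OF w] arrange_end(1)[OF H.mult_closed[OF w l(2)]]
        letter_in_P[OF i] H_in[OF i hH] H_in[OF i t] by simp_all
    have eq: "letter i (h \<otimes>\<^bsub>\<Gamma> i\<^esub> t) = letter i h \<cdot> letter i t"
      using letter_mult_letter i hH t H_in by metis
    have "inv\<^bsub>P\<^esub> x \<cdot> letter i t \<cdot> z = inv\<^bsub>P\<^esub> (arrange w) \<cdot> arrange (w \<otimes>\<^bsub>Q\<^esub> letter i t)"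
      using c P_cancel by (simp add: x_def z_def eq P.inv_mult_group P.m_assoc)
    then show ?thesis using xz by (auto intro!: rev_image_eqI[of "(x, z)"])
  qed
  then show "coarse Q P arrange (H.letter i t)" unfolding coarse_def letter_H
    using finite_arrange_error by (intro exI[of _ ?E]) simp
qed

lemma coarse_locate:
  assumes s: "s \<in> carrier P"
  shows "coarse P Q locate s"
proof (rule coarse_of_letters[OF H.group_P _ _ s])
  show "locate \<in> carrier P \<rightarrow> carrier Q" using locate_in_Q by blast
  fix i t assume i: "i \<in> I" and t: "t \<in> carrier (\<Gamma> i)"
  interpret i: group "\<Gamma> i" using factor_group i .
  let ?B = "insert \<one>\<^bsub>\<Gamma> i\<^esub> (\<Delta> i)"
  let ?T = "(\<lambda>(x, y). x \<otimes>\<^bsub>\<Gamma> i\<^esub> t \<otimes>\<^bsub>\<Gamma> i\<^esub> inv\<^bsub>\<Gamma> i\<^esub> y) ` (?B \<times> ?B)"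
  let ?E = "(\<lambda>(x, c, y). inv\<^bsub>Q\<^esub> x \<otimes>\<^bsub>Q\<^esub> letter i c \<otimes>\<^bsub>Q\<^esub> y) ` (locate_error \<times> ?T \<times> locate_error)"
  have "inv\<^bsub>Q\<^esub> (locate y) \<otimes>\<^bsub>Q\<^esub> locate (y \<cdot> letter i t) \<in> ?E" if y: "y \<in> carrier P" for y
  proof -
    obtain g v z where g: "g \<in> carrier (\<Gamma> i)" "v \<in> carrier P" "v = [] \<or> fst (last v) \<noteq> i"
      "y = v \<cdot> letter i g" "y = v @ z" using strip_last[OF y i] .
    have gt: "g \<otimes>\<^bsub>\<Gamma> i\<^esub> t \<in> carrier (\<Gamma> i)" using g t by simp
    have yt: "y \<cdot> letter i t = v \<cdot> letter i (g \<otimes>\<^bsub>\<Gamma> i\<^esub> t)"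
      using g t i letter_in_P by (simp add: P.m_assoc flip: letter_mult_letter)
    obtain h d where h: "h \<in> H i" "inv\<^bsub>\<Gamma> i\<^esub> h \<otimes>\<^bsub>\<Gamma> i\<^esub> g \<in> ?B" "d \<in> locate_error"
      "locate y = locate v \<otimes>\<^bsub>Q\<^esub> letter i h \<otimes>\<^bsub>Q\<^esub> d" using locate_close[OF g(2) i g(1,3)] g(4) by auto
    obtain h' d' where h': "h' \<in> H i" "inv\<^bsub>\<Gamma> i\<^esub> h' \<otimes>\<^bsub>\<Gamma> i\<^esub> (g \<otimes>\<^bsub>\<Gamma> i\<^esub> t) \<in> ?B" "d' \<in> locate_error"
      "locate (y \<cdot> letter i t) = locate v \<otimes>\<^bsub>Q\<^esub> letter i h' \<otimes>\<^bsub>Q\<^esub> d'"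
      using locate_close[OF g(2) i gt g(3)] yt by auto
    define c where "c = inv\<^bsub>\<Gamma> i\<^esub> h \<otimes>\<^bsub>\<Gamma> i\<^esub> h'"
    have hc: "h \<in> carrier (\<Gamma> i)" "h' \<in> carrier (\<Gamma> i)" using h h' H_in i by auto
    have "c = (inv\<^bsub>\<Gamma> i\<^esub> h \<otimes>\<^bsub>\<Gamma> i\<^esub> g) \<otimes>\<^bsub>\<Gamma> i\<^esub> t \<otimes>\<^bsub>\<Gamma> i\<^esub> inv\<^bsub>\<Gamma> i\<^esub> (inv\<^bsub>\<Gamma> i\<^esub> h' \<otimes>\<^bsub>\<Gamma> i\<^esub> (g \<otimes>\<^bsub>\<Gamma> i\<^esub> t))"
    proof -
      have cancel: "x \<otimes>\<^bsub>\<Gamma> i\<^esub> (inv\<^bsub>\<Gamma> i\<^esub> x \<otimes>\<^bsub>\<Gamma> i\<^esub> w) = w" if "x \<in> carrier (\<Gamma> i)" "w \<in> carrier (\<Gamma> i)" for x w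
        using that by (simp flip: i.m_assoc)
      show ?thesis using hc g t by (simp add: c_def i.inv_mult_group i.m_assoc cancel)
    qed
    then have cT: "c \<in> ?T" using h(2) h'(2)
      by (intro rev_image_eqI[of "(inv\<^bsub>\<Gamma> i\<^esub> h \<otimes>\<^bsub>\<Gamma> i\<^esub> g, inv\<^bsub>\<Gamma> i\<^esub> h' \<otimes>\<^bsub>\<Gamma> i\<^esub> (g \<otimes>\<^bsub>\<Gamma> i\<^esub> t))"]) auto
    have cH: "c \<in> H i" using h h' subgroup.m_closed[OF H[OF i]] subgroup.m_inv_closed[OF H[OF i]] by (simp add: c_def)
    have "h' = h \<otimes>\<^bsub>\<Gamma> i\<^esub> c" using hc by (simp add: c_def flip: i.m_assoc)
    then have eq: "letter i h' = letter i h \<otimes>\<^bsub>Q\<^esub> letter i c"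
      using H.letter_mult_letter[OF i, of h c] h cH by (simp add: letter_H)
    have l: "letter i h \<in> carrier Q" "letter i c \<in> carrier Q"
      using H.letter_in_P[OF i, of h] H.letter_in_P[OF i, of c] h cH by (simp_all add: letter_H)
    have dd: "d \<in> carrier Q" "d' \<in> carrier Q" "locate v \<in> carrier Q"
      using h h' locate_error_in_Q locate_in_Q[OF g(2)] by auto
    have cancel: "inv\<^bsub>Q\<^esub> x \<otimes>\<^bsub>Q\<^esub> (x \<otimes>\<^bsub>Q\<^esub> w) = w" if "x \<in> carrier Q" "w \<in> carrier Q" for x w
      using that by (simp flip: H.P.m_assoc)
    have "inv\<^bsub>Q\<^esub> (locate y) \<otimes>\<^bsub>Q\<^esub> locate (y \<cdot> letter i t) = inv\<^bsub>Q\<^esub> d \<otimes>\<^bsub>Q\<^esub> letter i c \<otimes>\<^bsub>Q\<^esub> d'"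
      using l dd by (simp add: h(4) h'(4) eq H.P.inv_mult_group H.P.m_assoc cancel)
    then show ?thesis using h(3) h'(3) cT by (intro rev_image_eqI[of "(d, c, d')"]) auto
  qed
  moreover have "finite ?E" using finite_locate_error finite_\<Delta>[OF i] by simp
  ultimately show "coarse P Q locate (letter i t)" unfolding coarse_def by blast
qed

theorem free_products_quasi_isometric:
  assumes "\<And>i. i \<in> I \<Longrightarrow> \<exists>S. finite_generating_set (\<Gamma> i) S"
    and "\<And>i. i \<in> I \<Longrightarrow> \<exists>S. finite_generating_set ((\<Gamma> i)\<lparr>carrier := H i\<rparr>) S"
  shows "quasi_isometric_groups P Q"
proof (rule coarse_bijection_quasi_isometric[OF group_P H.group_P])
  show "\<exists>S. finite_generating_set P S" "\<exists>S. finite_generating_set Q S"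
    using finitely_generated[OF finite_I assms(1)] H.finitely_generated[OF finite_I assms(2)] by auto
  show "locate \<in> carrier P \<rightarrow> carrier Q" "arrange \<in> carrier Q \<rightarrow> carrier P" using locate_in_Q arrange_end(1) by blast+
qed (use arrange_locate locate_arrange coarse_locate coarse_arrange in auto)

end

section \<open>Free products of finite-index subgroups\<close>

definition list_of :: "'a set \<Rightarrow> 'a list" where
  "list_of A = (SOME xs. set xs = A \<and> distinct xs)"

lemma list_of: "finite A \<Longrightarrow> set (list_of A) = A \<and> distinct (list_of A)"
  unfolding list_of_def by (rule someI_ex) (rule finite_distinct_list)

lemma length_list_of: "finite A \<Longrightarrow> length (list_of A) = card A"
  using list_of distinct_card by metis

text \<open>
  The requirements of \<open>rearrangement\<close> on a single group \<open>G\<close> with subgroup \<open>U\<close>.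
\<close>

definition block_system where
  "block_system G U a \<sigma> L D N \<longleftrightarrow> a \<in> U - {\<one>\<^bsub>G\<^esub>} \<and> (\<forall>k::nat. \<sigma> k \<in> U - {\<one>\<^bsub>G\<^esub>, a}) \<and> inj \<sigma> \<and> finite D \<and>
    (\<forall>f. \<forall>h\<in>U - {\<one>\<^bsub>G\<^esub>}. (L f h = [] \<longleftrightarrow> f \<and> h = a) \<and> set (L f h) \<subseteq> carrier G - {\<one>\<^bsub>G\<^esub>} \<and>
        length (L f h) \<le> (N::nat) \<and> (\<forall>g\<in>set (L f h). inv\<^bsub>G\<^esub> h \<otimes>\<^bsub>G\<^esub> g \<in> D)) \<and>
    (\<forall>f. \<forall>g\<in>carrier G - {\<one>\<^bsub>G\<^esub>}.
       \<exists>!p. fst p \<in> U - {\<one>\<^bsub>G\<^esub>} \<and> snd p < length (L f (fst p)) \<and> L f (fst p) ! snd p = g)"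

text \<open>
  Each element is \<open>h \<otimes> r\<close> with \<open>h \<in> U\<close> and a representative \<open>r\<close> of its coset, and it is assigned to \<open>h\<close>. The
  identity has no block of its own, so the elements with \<open>h = \<one>\<close> are assigned to another element \<open>b\<close>. For the second distribution
  the block of \<open>a\<close> is added to that of \<open>b\<close>.
\<close>

lemma (in group) exists_blocks:
  assumes sub: "subgroup U G" and fin: "finite (rcosets U)" and inf: "infinite U"
  shows "\<exists>a \<sigma> L D N. block_system G U a \<sigma> L D N"
proof -
  interpret U: subgroup U G by (rule sub)
  have "infinite (U - {\<one>})" using inf by simp
  then obtain a where a: "a \<in> U - {\<one>}" by (metis finite.emptyI ex_in_conv)
  have "infinite (U - {\<one>, a})" using inf by simp
  then obtain b where b: "b \<in> U - {\<one>, a}" by (metis finite.emptyI ex_in_conv)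
  obtain \<sigma> :: "nat \<Rightarrow> 'a" where \<sigma>: "inj \<sigma>" "range \<sigma> \<subseteq> U - {\<one>, a}"
    using \<open>infinite (U - {\<one>, a})\<close> infinite_countable_subset by blast
  define r where "r c = (if c = U then \<one> else SOME x. x \<in> c)" for c
  have r: "r (U #> g) \<in> carrier G" "g \<otimes> inv r (U #> g) \<in> U" if g: "g \<in> carrier G" for g
  proof -
    have "r (U #> g) \<in> U #> g"
    proof (cases "U #> g = U")
      case False
      then show ?thesis using rcos_self[OF g sub] someI[of "\<lambda>x. x \<in> U #> g" g] by (simp add: r_def)
    qed (simp add: r_def)
    then show c: "r (U #> g) \<in> carrier G" using r_coset_subset_G[OF U.subset g] by blast
    have "U #> g = U #> r (U #> g)" using repr_independence[OF \<open>r (U #> g) \<in> U #> g\<close> g sub] .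
    then have "g \<in> U #> r (U #> g)" using rcos_self[OF g sub] by simp
    then show "g \<otimes> inv r (U #> g) \<in> U" using subgroup.rcos_module[OF sub is_group c g] by simp
  qed
  define R where "R = r ` (rcosets U)"
  have finR: "finite R" using fin by (simp add: R_def)
  define p where "p g = g \<otimes> inv r (U #> g)" for g
  define q where "q g = (if p g = \<one> then b else p g)" for g
  have q_in: "q g \<in> U - {\<one>}" if "g \<in> carrier G" for g using r(2)[OF that] b by (auto simp: q_def p_def)
  have q_id: "q h = h" if "h \<in> U - {\<one>}" for h
  proof -
    have "U #> h = U" using that coset_join2[of h U] sub by auto
    then show ?thesis using that U.mem_carrier by (auto simp: q_def p_def r_def)
  qed
  have p_R: "g = p g \<otimes> r (U #> g)" "r (U #> g) \<in> R" if "g \<in> carrier G" for g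
    using that r(1)[OF that] rcosetsI[OF U.subset that] by (auto simp: p_def R_def m_assoc)
  define B where "B h = {g \<in> carrier G - {\<one>}. q g = h}" for h
  have B_sub: "B h \<subseteq> (\<lambda>x. h \<otimes> x) ` R \<union> (if h = b then R else {})" for h
  proof
    fix g assume "g \<in> B h"
    then have g: "g \<in> carrier G" "q g = h" by (auto simp: B_def)
    show "g \<in> (\<lambda>x. h \<otimes> x) ` R \<union> (if h = b then R else {})"
    proof (cases "p g = \<one>")
      case True
      then have "g \<in> R" "h = b" using p_R[OF g(1)] r(1)[OF g(1)] g(2) by (auto simp: q_def)
      then show ?thesis by simp
    next
      case False
      then show ?thesis using p_R[OF g(1)] g(2) by (auto simp: q_def)
    qed
  qed
  have finB: "finite (B h)" for h using finite_subset[OF B_sub] finR by simp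
  have cardB: "card (B h) \<le> card R + card R" for h
  proof -
    have "card (B h) \<le> card ((\<lambda>x. h \<otimes> x) ` R \<union> (if h = b then R else {}))"
      using B_sub finR by (intro card_mono) auto
    also have "\<dots> \<le> card ((\<lambda>x. h \<otimes> x) ` R) + card (if h = b then R else {})" by (rule card_Un_le)
    also have "\<dots> \<le> card R + card R" using card_image_le[OF finR] by (intro add_mono) auto
    finally show ?thesis .
  qed
  have B_disj: "B h \<inter> B h' = {}" if "h \<noteq> h'" for h h' using that by (auto simp: B_def)
  have B_self: "h \<in> B h" if "h \<in> U - {\<one>}" for h using that q_id U.mem_carrier by (auto simp: B_def)
  define L where "L f h = (if f \<and> h = a then [] else if f \<and> h = b then list_of (B a) @ list_of (B b) else list_of (B h))"
    for f h
  define D where "D = R \<union> (\<lambda>g. inv b \<otimes> g) ` (B a \<union> B b)"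
  have ab: "a \<noteq> b" using b by auto
  have setL: "set (L f h) = (if f \<and> h = a then {} else if f \<and> h = b then B a \<union> B b else B h)" for f h
    using list_of[OF finB] by (simp add: L_def)
  have distL: "distinct (L f h)" for f h
    using list_of[OF finB] B_disj[OF ab] by (simp add: L_def)
  have "block_system G U a \<sigma> L D (4 * card R)"
    unfolding block_system_def
  proof (intro conjI allI ballI)
    show "a \<in> U - {\<one>}" "inj \<sigma>" using a \<sigma> by auto
    show "\<sigma> k \<in> U - {\<one>, a}" for k using \<sigma> by auto
    show "finite D" using finR finB by (simp add: D_def)
  next
    fix f h assume h: "h \<in> U - {\<one>}"
    show "L f h = [] \<longleftrightarrow> f \<and> h = a"
      using B_self[OF h] setL[of f h] ab by (auto split: if_splits)
    show "set (L f h) \<subseteq> carrier G - {\<one>}" unfolding setL by (auto simp: B_def)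
    show "length (L f h) \<le> 4 * card R"
      using cardB[of h] cardB[of a] cardB[of b] by (auto simp: L_def length_list_of[OF finB])
    fix g assume g: "g \<in> set (L f h)"
    show "inv h \<otimes> g \<in> D"
    proof (cases "h = b")
      case True
      then show ?thesis using g unfolding setL D_def by (auto split: if_splits)
    next
      case False
      then have gB: "g \<in> B h" using g unfolding setL by (auto split: if_splits)
      then have gc: "g \<in> carrier G" "q g = h" by (auto simp: B_def)
      then have "p g = h" using False by (auto simp: q_def split: if_splits)
      then have "inv h \<otimes> g = inv h \<otimes> (h \<otimes> r (U #> g))" using p_R(1)[OF gc(1)] by simp
      also have "\<dots> = r (U #> g)" using h U.mem_carrier r(1)[OF gc(1)] by (simp flip: m_assoc)
      finally have "inv h \<otimes> g = r (U #> g)" .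
      then show ?thesis using p_R(2)[OF gc(1)] by (simp add: D_def)
    qed
  next
    fix f :: bool and g assume g: "g \<in> carrier G - {\<one>}"
    define h where "h = (if f \<and> q g = a then b else q g)"
    have h: "h \<in> U - {\<one>}" using q_in g b by (auto simp: h_def)
    have gh: "g \<in> set (L f h') \<longleftrightarrow> h' = h" for h'
      unfolding setL using g ab by (auto simp: h_def B_def)
    then obtain k where k: "k < length (L f h)" "L f h ! k = g" by (metis in_set_conv_nth)
    show "\<exists>!p. fst p \<in> U - {\<one>} \<and> snd p < length (L f (fst p)) \<and> L f (fst p) ! snd p = g"
    proof (rule ex1I[of _ "(h, k)"])
      fix p assume p: "fst p \<in> U - {\<one>} \<and> snd p < length (L f (fst p)) \<and> L f (fst p) ! snd p = g"
      then have "fst p = h" using gh[of "fst p"] by (metis nth_mem)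
      moreover have "snd p = k" using p k calculation distL nth_eq_iff_index_eq by metis
      ultimately show "p = (h, k)" by (simp add: prod_eq_iff)
    qed (use h k in auto)
  qed
  then show ?thesis by blast
qed

theorem finite_index_free_products_quasi_isometric:
  fixes G :: "'i \<Rightarrow> ('a, 'm) monoid_scheme"
  assumes I: "finite I" "card I > 1"
    and G: "\<And>i. i \<in> I \<Longrightarrow> group (G i)" "\<And>i. i \<in> I \<Longrightarrow> \<exists>S. finite_generating_set (G i) S"
    and U: "\<And>i. i \<in> I \<Longrightarrow> finite_index_subgroup (H i) (G i)" "\<And>i. i \<in> I \<Longrightarrow> infinite (H i)"
      "\<And>i. i \<in> I \<Longrightarrow> \<exists>S. finite_generating_set ((G i)\<lparr>carrier := H i\<rparr>) S"
  shows "quasi_isometric_groups (free_product I G) (free_product I (\<lambda>i. (G i)\<lparr>carrier := H i\<rparr>))"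
proof -
  have "\<exists>j. j \<in> I \<and> j \<noteq> i" if "i \<in> I" for i
  proof (rule ccontr)
    assume "\<not> ?thesis"
    then have "I \<subseteq> {i}" by blast
    then have "card I \<le> card {i}" by (intro card_mono) auto
    then show False using I(2) by simp
  qed
  then obtain nx where nx: "\<And>i. i \<in> I \<Longrightarrow> nx i \<in> I" "\<And>i. i \<in> I \<Longrightarrow> nx i \<noteq> i" by metis
  have "\<forall>i\<in>I. \<exists>a \<sigma> L D N. block_system (G i) (H i) a \<sigma> L D N"
    using group.exists_blocks[OF G(1)] U(1,2) by (auto simp: finite_index_subgroup_def)
  then obtain a \<sigma> L D N where b: "\<And>i. i \<in> I \<Longrightarrow> block_system (G i) (H i) (a i) (\<sigma> i) (L i) (D i) (N i)"
    by metis
  interpret rearrangement I G H nx a \<sigma> L D N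
  proof (intro rearrangement.intro free_product_of_groups.intro rearrangement_axioms.intro)
    show "subgroup (H i) (G i)" if "i \<in> I" for i using U(1)[OF that] by (simp add: finite_index_subgroup_def)
  qed (use G I(1) nx b in \<open>simp_all add: block_system_def\<close>)
  show ?thesis using free_products_quasi_isometric G(2) U(3) by blast
qed

theorem theorem1p4:
  fixes C :: "'a monoid set"
    and \<rho> :: "'a monoid \<Rightarrow> real"
    and n :: nat
    and G :: "nat \<Rightarrow> 'a monoid"
    and H :: "nat \<Rightarrow> 'a set"
  assumes "\<And>K. K \<in> C \<Longrightarrow> one_ended_group K"
    and "isomorphism_closed C"
    and "finite_index_closed C"
    and "multiplicative_invariant C \<rho>"
    and "\<And>K. K \<in> C \<Longrightarrow> \<rho> K \<noteq> 0"
    and "n > 1"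
    and "\<And>i. i \<in> {1..n} \<Longrightarrow> G i \<in> C"
    and "\<And>i. i \<in> {1..n} \<Longrightarrow> finite_index_subgroup (H i) (G i)"
    and "\<And>i. i \<in> {1..n} \<Longrightarrow> H i \<noteq> carrier (G i)"
  shows "quasi_isometric_groups
           (free_product {1..n} G) (free_product {1..n} (\<lambda>i. G i\<lparr>carrier := H i\<rparr>)) \<and>
         \<not> abstractly_commensurable
           (free_product {1..n} G) (free_product {1..n} (\<lambda>i. G i\<lparr>carrier := H i\<rparr>))"
proof
  let ?H = "\<lambda>i. G i\<lparr>carrier := H i\<rparr>"
  have HC: "?H i \<in> C" if "i \<in> {1..n}" for i
    using assms(3) assms(7)[OF that] assms(8)[OF that] by (auto simp: finite_index_closed_def)
  have C: "group Q" "infinite (carrier Q)" "\<exists>S. finite_generating_set Q S" if "Q \<in> C" for Q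
    using assms(1)[OF that] one_ended_group_splits_trivially[OF assms(1)[OF that]]
    by (auto simp: one_ended_group_def)
  have I: "finite {1..n}" "card {1..n} > 1" using assms(6) by auto
  show "quasi_isometric_groups (free_product {1..n} G) (free_product {1..n} ?H)"
  proof (rule finite_index_free_products_quasi_isometric[OF I])
    fix i assume i: "i \<in> {1..n}"
    show "group (G i)" "\<exists>S. finite_generating_set (G i) S" using C assms(7)[OF i] by auto
    show "finite_index_subgroup (H i) (G i)" using assms(8)[OF i] .
    show "infinite (H i)" "\<exists>S. finite_generating_set (?H i) S" using C[OF HC[OF i]] by auto
  qed
  show "\<not> abstractly_commensurable (free_product {1..n} G) (free_product {1..n} ?H)"
    by (rule free_products_not_commensurable[OF assms(1,3,4,5) I assms(7,8,9)])
qed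

end
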